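(* Let $g\in M^1(\mathbb{R}^d)$ and $\Lambda\subseteq\mathbb{R}^{2d}$, and assume that $\mathcal{G}(g,\Lambda)$ is a frame for $L^2(\mathbb{R}^d)$. If the deformation $\{\Lambda_n:n\ge1\}$ of $\Lambda$ is Lipschitz convergent to $\Lambda$, then $\mathcal{G}(g,\Lambda_n)$ is a frame for $L^2(\mathbb{R}^d)$ for all sufficiently large $n$.
   Context: For $z=(x,\xi)\in\mathbb{R}^d\times\mathbb{R}^d\simeq\mathbb{R}^{2d}$, the time-frequency shift is $\pi(z)g(t)=e^{2\pi i\xi\cdot t}g(t-x)$. $M^1(\mathbb{R}^d)$ consists of all $g\in L^2(\mathbb{R}^d)$ with $\int_{\mathbb{R}^{2d}}|\langle g,\pi(z)g\rangle|\,dz<\infty$. For a set $\Lambda\subseteq\mathbb{R}^{2d}$, $\mathcal{G}(g,\Lambda)=\{\pi(\lambda)g:\lambda\in\Lambda\}$ (indexed by $\Lambda$) is a frame for $L^2(\mathbb{R}^d)$ if there are constants $0<A\le B<\infty$ with $A\|f\|_2^2\le\sum_{\lambda\in\Lambda}|\langle f,\pi(\lambda)g\rangle|^2\le B\|f\|_2^2$ for all $f\in L^2(\mathbb{R}^d)$. A deformation of a (countable) set $\Lambda\subseteq\mathbb{R}^{2d}$ is a sequence of sets $\Lambda_n=\tau_n(\Lambda)=\{\tau_n(\lambda):\lambda\in\Lambda\}$, $n\ge1$, together with maps $\tau_n:\Lambda\to\mathbb{R}^{2d}$ such that $\tau_n(\lambda)\to\lambda$ as $n\to\infty$ for every $\lambda\in\Lambda$.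 The deformation is called Lipschitz (and $\Lambda_n$ Lipschitz convergent to $\Lambda$) if: (L1) for every $R>0$, $\sup_{\lambda,\lambda'\in\Lambda,\ |\lambda-\lambda'|\le R}|(\tau_n(\lambda)-\tau_n(\lambda'))-(\lambda-\lambda')|\to0$ as $n\to\infty$; (L2) for every $R>0$ there exist $R'>0$ and $n_0\in\mathbb{N}$ such that if $|\tau_n(\lambda)-\tau_n(\lambda')|\le R$ for some $n\ge n_0$ and some $\lambda,\lambda'\in\Lambda$, then $|\lambda-\lambda'|\le R'$. *)

theory Defs
  imports "HOL-Analysis.Analysis"
begin

text \<open>
  Elements of \<open>L\<^sup>2\<close> are represented by functions: two functions agreeing almost everywhere
  represent the same class, and every notion below depends on the class only.
  The space \<open>\<real>\<^sup>d\<close> is \<^typ>\<open>real ^ 'd\<close>, and the time-frequency plane \<open>\<real>\<^sup>2\<^sup>d\<close> is the product type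
  \<open>(real ^ 'd) \<times> (real ^ 'd)\<close>, whose norm in the library is the Euclidean one.
\<close>

type_synonym 'd signal = "real ^ 'd \<Rightarrow> complex"
type_synonym 'd phase_space = "(real ^ 'd) \<times> (real ^ 'd)"

definition L2 :: "'d::finite signal set" where
  "L2 = {f. f \<in> borel_measurable lebesgue \<and> integrable lebesgue (\<lambda>t. (norm (f t))\<^sup>2)}"

definition inner_L2 :: "'d::finite signal \<Rightarrow> 'd signal \<Rightarrow> complex" where
  "inner_L2 f h = (LINT t|lebesgue. f t * cnj (h t))"

definition norm_L2 :: "'d::finite signal \<Rightarrow> real" where
  "norm_L2 f = sqrt (LINT t|lebesgue. (norm (f t))\<^sup>2)"

definition tf_shift :: "'d::finite phase_space \<Rightarrow> 'd signal \<Rightarrow> 'd signal" where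
  "tf_shift z g = (\<lambda>t. exp (2 * complex_of_real pi * \<i> * complex_of_real (snd z \<bullet> t)) * g (t - fst z))"

definition M1 :: "'d::finite signal set" where
  "M1 = {g \<in> L2. (\<integral>\<^sup>+ z. ennreal (norm (inner_L2 g (tf_shift z g))) \<partial>lebesgue) < \<infinity>}"

text \<open>
  The summability conjunct expresses that the sum of nonnegative terms is finite, as the upper
  frame bound demands; it is needed because \<^const>\<open>infsum\<close> is \<open>0\<close> for non-summable families.
\<close>

definition gabor_frame :: "'d::finite signal \<Rightarrow> 'd phase_space set \<Rightarrow> bool" where
  "gabor_frame g \<Lambda> \<longleftrightarrow>
     (\<exists>A B. 0 < A \<and> A \<le> B \<and>
        (\<forall>f\<in>L2. (\<lambda>p. (norm (inner_L2 f (tf_shift p g)))\<^sup>2) summable_on \<Lambda> \<and>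
           A * (norm_L2 f)\<^sup>2 \<le> (\<Sum>\<^sub>\<infinity>p\<in>\<Lambda>. (norm (inner_L2 f (tf_shift p g)))\<^sup>2) \<and>
           (\<Sum>\<^sub>\<infinity>p\<in>\<Lambda>. (norm (inner_L2 f (tf_shift p g)))\<^sup>2) \<le> B * (norm_L2 f)\<^sup>2))"

text \<open>
  Sequences are indexed by \<open>n \<ge> 1\<close>; the values at \<open>n = 0\<close> are irrelevant. Only the values of
  \<open>\<tau> n\<close> on \<open>\<Lambda>\<close> matter. Countability of \<open>\<Lambda>\<close> is not required here.
\<close>

definition deformation ::
  "'d::finite phase_space set \<Rightarrow> (nat \<Rightarrow> 'd phase_space set) \<Rightarrow>
   (nat \<Rightarrow> 'd phase_space \<Rightarrow> 'd phase_space) \<Rightarrow> bool" where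
  "deformation \<Lambda> \<Lambda>s \<tau> \<longleftrightarrow>
     (\<forall>n\<ge>1. \<Lambda>s n = \<tau> n ` \<Lambda>) \<and> (\<forall>p\<in>\<Lambda>. (\<lambda>n. \<tau> n p) \<longlonglongrightarrow> p)"

text \<open>
  The supremum in the first condition is taken in \<open>[0, \<infinity>]\<close>: it may be infinite for some \<open>n\<close>,
  and it is \<open>0\<close> over the empty set.
\<close>

definition lipschitz_deformation ::
  "'d::finite phase_space set \<Rightarrow> (nat \<Rightarrow> 'd phase_space set) \<Rightarrow>
   (nat \<Rightarrow> 'd phase_space \<Rightarrow> 'd phase_space) \<Rightarrow> bool" where
  "lipschitz_deformation \<Lambda> \<Lambda>s \<tau> \<longleftrightarrow>
     deformation \<Lambda> \<Lambda>s \<tau> \<and>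
     (\<forall>R>0. (\<lambda>n. SUP (p, q)\<in>{(p, q). p \<in> \<Lambda> \<and> q \<in> \<Lambda> \<and> norm (p - q) \<le> R}.
                    ennreal (norm ((\<tau> n p - \<tau> n q) - (p - q)))) \<longlonglongrightarrow> 0) \<and>
     (\<forall>R>0. \<exists>R'>0. \<exists>n\<^sub>0\<ge>1. \<forall>n\<ge>n\<^sub>0. \<forall>p\<in>\<Lambda>. \<forall>q\<in>\<Lambda>.
        norm (\<tau> n p - \<tau> n q) \<le> R \<longrightarrow> norm (p - q) \<le> R')"

end

theory Submission
  imports Defs "HOL-Probability.Probability"
begin

text \<open>
  The lower frame inequality is transferred locally in the time-frequency plane, in \<open>L\<^sup>2\<close> throughout.
  Let \<open>V z = \<bar>\<langle>g, \<pi>(z) g\<rangle>\<bar>\<close>. Since \<open>V\<close> is integrable, Moyal's identity (only an inequality is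
  needed) dominates \<open>V\<close> by iterated convolutions of \<open>V\<close> with a Gaussian. Hence the sums of \<open>V\<close> over
  sets with at most \<open>N\<close> points in each unit ball are bounded and have uniformly small tails.

  Up to a small error, a signal is a finite sum \<open>h = \<Sum> c\<^sub>p \<pi>(p) g\<close> over \<open>p \<in> \<Lambda>\<close> whose coefficients are controlled in
  \<open>\<ell>\<^sup>2\<close>. Multiplying \<open>c\<close> by slowly varying cutoffs centred at the points \<open>y\<close> of a separated net gives
  pieces \<open>h\<^sub>y\<close>. By the Schur test this cutting almost commutes with the analysis operators of \<open>\<Lambda>\<close> and of
  \<open>\<Lambda>\<^sub>n\<close>. Near \<open>y\<close> the set \<open>\<Lambda>\<^sub>n\<close> is almost a translate of \<open>\<Lambda>\<close>, and translates of \<open>\<Lambda>\<close> have the same frame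
  bounds as \<open>\<Lambda>\<close>. So the lower frame inequality holds for each \<open>h\<^sub>y\<close> and \<open>\<Lambda>\<^sub>n\<close>, and one sums over \<open>y\<close>.
\<close>

section \<open>Square-integrable Borel functions\<close>

text \<open>The obstacle is that \<open>\<tau> n p - p\<close> tends to 0 only pointwise in
  \<open>p\<close>: over the whole of \<open>\<Lambda>\<close> it may be unbounded for every
  \<open>n\<close>, as the dilations by \<open>1 + 1/n\<close> show. The analysis operator of the
  deformed set is therefore not a small perturbation, in operator norm, of that of
  \<open>\<Lambda>\<close>. A comparison is possible only in windows of a fixed size, up to a
  translation that depends on the window. The cutting acts on coefficients and not on the signal
  itself: a piece is then again a combination of shifts of \<open>g\<close>, so its interaction with
  distant points is given by values of \<open>V\<close>, and the Schur test applies. This is why a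
  signal is expanded first. All errors come out as multiples of the sum of the squared coefficients,
  which the expansion bounds by the norm of the signal. The choice of constants is not circular,
  because the multiplicity of \<open>\<tau> n\<close>, the overlap of the cutoffs and the Bessel
  bound of the deformed sets depend neither on the size of the windows nor on \<open>n\<close>, once
  \<open>n\<close> is large.\<close>

lemma quadratic_nonneg_discriminant:
  fixes a b c :: real
  assumes "a \<ge> 0" and "\<And>t. 0 \<le> a * t\<^sup>2 - 2 * b * t + c"
  shows "b\<^sup>2 \<le> a * c"
proof (cases "a = 0")
  case True
  \<comment> \<open>For \<open>b \<noteq> 0\<close> the expression takes the value \<open>-1\<close>
    at this \<open>t\<close>.\<close>
  then show ?thesis using assms(2)[of "(c+1)/(2*b)"] by (cases "b = 0") (simp_all add: field_simps)
next
  case False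
  then have "a > 0" using assms(1) by simp
  then have "0 \<le> a * (a * (b/a)\<^sup>2 - 2 * b * (b/a) + c)" using assms(2)[of "b/a"] by simp
  also have "\<dots> = a * c - b\<^sup>2" using \<open>a > 0\<close> by (simp add: field_simps power2_eq_square)
  finally show ?thesis by simp
qed

lemma cmod_add_square_le: "(cmod (x + y))\<^sup>2 \<le> 2 * (cmod x)\<^sup>2 + 2 * (cmod y)\<^sup>2"
proof -
  have "(cmod (x + y))\<^sup>2 \<le> (cmod x + cmod y)\<^sup>2" by (intro power_mono norm_triangle_ineq) auto
  also have "\<dots> \<le> 2 * (cmod x)\<^sup>2 + 2 * (cmod y)\<^sup>2"
    using zero_le_power2[of "cmod x - cmod y"] by (simp add: power2_eq_square algebra_simps)
  finally show ?thesis .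
qed

lemma integral_lborel_translate:
  fixes F :: "'a::euclidean_space \<Rightarrow> 'b::{banach, second_countable_topology}"
  assumes [measurable]: "F \<in> borel_measurable borel"
  shows "(LINT t|lborel. F (t - u)) = (LINT t|lborel. F t)"
proof -
  have "(LINT t|lborel. F t) = (LINT t|distr lborel borel ((+) (-u)). F t)" by (simp add: lborel_distr_plus)
  also have "\<dots> = (LINT t|lborel. F (t - u))" by (subst integral_distr) auto
  finally show ?thesis by simp
qed

lemma integrable_lborel_translate:
  fixes F :: "'a::euclidean_space \<Rightarrow> 'b::{banach, second_countable_topology}"
  assumes F: "integrable lborel F"
  shows "integrable lborel (\<lambda>t. F (t - u))"
proof -
  have [measurable]: "F \<in> borel_measurable borel" using F by auto
  have "integrable (distr lborel borel ((+) (-u))) F" using F by (simp add: lborel_distr_plus)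
  then show ?thesis by (subst (asm) integrable_distr_eq) auto
qed

lemma nn_integral_lborel_reflect:
  fixes F :: "'a::euclidean_space \<Rightarrow> ennreal"
  assumes [measurable]: "F \<in> borel_measurable borel"
  shows "(\<integral>\<^sup>+ t. F (u - t) \<partial>lborel) = (\<integral>\<^sup>+ t. F t \<partial>lborel)"
proof -
  have "(\<integral>\<^sup>+ t. F t \<partial>lborel) = (\<integral>\<^sup>+ t. F (u + (-1) *\<^sub>R t) \<partial>lborel)"
    by (subst lborel_affine[of "-1" u]) (simp_all add: nn_integral_density nn_integral_distr)
  then show ?thesis by simp
qed

lemma lborel_distr_reflect: "distr lborel borel (\<lambda>t::'a::euclidean_space. u - t) = lborel"
proof (rule measure_eqI)
  fix A :: "'a set" assume "A \<in> sets (distr lborel borel (\<lambda>t. u - t))"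
  then have [measurable]: "A \<in> sets borel" by simp
  have "emeasure (distr lborel borel (\<lambda>t. u - t)) A = (\<integral>\<^sup>+ t. indicator A t \<partial>distr lborel borel (\<lambda>t. u - t))"
    by simp
  also have "\<dots> = (\<integral>\<^sup>+ t. indicator A (u - t) \<partial>lborel)" by (subst nn_integral_distr) auto
  also have "\<dots> = emeasure lborel A" by (subst nn_integral_lborel_reflect) auto
  finally show "emeasure (distr lborel borel (\<lambda>t. u - t)) A = emeasure lborel A" .
qed simp

lemma integral_lborel_reflect:
  fixes F :: "'a::euclidean_space \<Rightarrow> 'b::{banach, second_countable_topology}"
  assumes [measurable]: "F \<in> borel_measurable borel"
  shows "(LINT t|lborel. F (u - t)) = (LINT t|lborel. F t)"
  using integral_distr[of "\<lambda>t. u - t" lborel borel F] by (simp add: lborel_distr_reflect)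

text \<open>Every element of \<^const>\<open>L2\<close> has a Borel representative. For these the product measurability
  that Fubini's theorem needs is automatic.\<close>

definition L2b :: "'d::finite signal set" where
  "L2b = {f. f \<in> borel_measurable borel \<and> integrable lborel (\<lambda>t. (cmod (f t))\<^sup>2)}"

definition ip :: "'d::finite signal \<Rightarrow> 'd signal \<Rightarrow> complex" where
  "ip f h = (LINT t|lborel. f t * cnj (h t))"

definition nsq :: "'d::finite signal \<Rightarrow> real" where
  "nsq f = (LINT t|lborel. (cmod (f t))\<^sup>2)"

lemma L2b_measurable[measurable_dest]: "f \<in> L2b \<Longrightarrow> f \<in> borel_measurable borel"
  by (simp add: L2b_def)

lemma L2b_integrable: "f \<in> L2b \<Longrightarrow> integrable lborel (\<lambda>t. (cmod (f t))\<^sup>2)"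
  by (simp add: L2b_def)

lemma borel_measurable_cnj[measurable]: "cnj \<in> borel_measurable borel"
  by (intro borel_measurable_continuous_onI continuous_intros)

lemma L2b_integrable_prod:
  assumes "f \<in> L2b" "h \<in> L2b"
  shows "integrable lborel (\<lambda>t. f t * cnj (h t))"
proof (rule Bochner_Integration.integrable_bound)
  have [measurable]: "f \<in> borel_measurable borel" "h \<in> borel_measurable borel"
    using assms by (auto intro: L2b_measurable)
  show "(\<lambda>t. f t * cnj (h t)) \<in> borel_measurable lborel" by measurable
  show "integrable lborel (\<lambda>t. (cmod (f t))\<^sup>2 + (cmod (h t))\<^sup>2)"
    using assms by (intro Bochner_Integration.integrable_add L2b_integrable)
  have "a * b \<le> a\<^sup>2 + b\<^sup>2" if "a \<ge> 0" "b \<ge> 0" for a b :: real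
    using sum_squares_bound[of a b] mult_nonneg_nonneg[OF that] by linarith
  then show "AE t in lborel. norm (f t * cnj (h t)) \<le> norm ((cmod (f t))\<^sup>2 + (cmod (h t))\<^sup>2)"
    by (simp add: norm_mult)
qed

lemma L2b_add: assumes "f \<in> L2b" "h \<in> L2b" shows "(\<lambda>t. f t + h t) \<in> L2b"
proof -
  have "integrable lborel (\<lambda>t. (cmod (f t + h t))\<^sup>2)"
  proof (rule Bochner_Integration.integrable_bound)
    show "integrable lborel (\<lambda>t. 2 * (cmod (f t))\<^sup>2 + 2 * (cmod (h t))\<^sup>2)"
      using assms by (intro Bochner_Integration.integrable_add integrable_mult_right L2b_integrable)
    show "AE t in lborel. norm ((cmod (f t + h t))\<^sup>2) \<le> norm (2 * (cmod (f t))\<^sup>2 + 2 * (cmod (h t))\<^sup>2)"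
      by (simp add: cmod_add_square_le)
  qed (use assms in measurable)
  moreover have "(\<lambda>t. f t + h t) \<in> borel_measurable borel" using assms by measurable
  ultimately show ?thesis by (simp add: L2b_def)
qed

lemma L2b_scale: assumes "f \<in> L2b" shows "(\<lambda>t. c * f t) \<in> L2b"
proof -
  have [measurable]: "f \<in> borel_measurable borel" using assms by (rule L2b_measurable)
  have "(\<lambda>t. c * f t) \<in> borel_measurable borel" by measurable
  then show ?thesis using assms by (simp add: L2b_def norm_mult power_mult_distrib)
qed

lemma L2b_zero: "(\<lambda>t. 0) \<in> L2b" by (simp add: L2b_def)

lemma L2b_diff: assumes "f \<in> L2b" "h \<in> L2b" shows "(\<lambda>t. f t - h t) \<in> L2b"
  using L2b_add[OF assms(1) L2b_scale[OF assms(2), of "-1"]] by simp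

lemma L2b_sum: assumes "\<And>i. i \<in> I \<Longrightarrow> f i \<in> L2b" shows "(\<lambda>t. \<Sum>i\<in>I. f i t) \<in> L2b"
  using assms by (induction I rule: infinite_finite_induct) (auto simp: L2b_zero intro!: L2b_add)

lemma ip_cnj: "ip h f = cnj (ip f h)"
proof -
  have "cnj (ip f h) = (LINT t|lborel. cnj (f t * cnj (h t)))" unfolding ip_def by (rule Bochner_Integration.integral_cnj[symmetric])
  then show ?thesis by (simp add: ip_def mult.commute)
qed

lemma cmod_ip_commute: "cmod (ip h f) = cmod (ip f h)"
  by (subst ip_cnj) simp

lemma ip_self: "ip f f = of_real (nsq f)"
  unfolding ip_def nsq_def complex_norm_square[symmetric]
  by (subst integral_complex_of_real[symmetric]) (simp add: complex_norm_square)

lemma ip_diff_left: "f \<in> L2b \<Longrightarrow> f' \<in> L2b \<Longrightarrow> h \<in> L2b \<Longrightarrow> ip (\<lambda>t. f t - f' t) h = ip f h - ip f' h"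
  unfolding ip_def left_diff_distrib by (intro Bochner_Integration.integral_diff L2b_integrable_prod)

lemma ip_scale_left: "ip (\<lambda>t. c * f t) h = c * ip f h"
  unfolding ip_def by (simp add: mult.assoc)

lemma ip_scale_right: "ip f (\<lambda>t. c * h t) = cnj c * ip f h"
  using ip_cnj[of f "\<lambda>t. c * h t"] ip_cnj[of f h] by (simp add: ip_scale_left)

lemma ip_sum_left: "(\<And>i. i \<in> I \<Longrightarrow> f i \<in> L2b) \<Longrightarrow> h \<in> L2b \<Longrightarrow> ip (\<lambda>t. \<Sum>i\<in>I. f i t) h = (\<Sum>i\<in>I. ip (f i) h)"
  unfolding ip_def sum_distrib_right by (intro Bochner_Integration.integral_sum L2b_integrable_prod)

lemma ip_sum_right: "(\<And>i. i \<in> I \<Longrightarrow> f i \<in> L2b) \<Longrightarrow> h \<in> L2b \<Longrightarrow> ip h (\<lambda>t. \<Sum>i\<in>I. f i t) = (\<Sum>i\<in>I. ip h (f i))"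
  using ip_cnj[of h "\<lambda>t. \<Sum>i\<in>I. f i t"] by (simp add: ip_sum_left cnj_sum ip_cnj[symmetric])

lemma ip_diff_right: "f \<in> L2b \<Longrightarrow> f' \<in> L2b \<Longrightarrow> h \<in> L2b \<Longrightarrow> ip h (\<lambda>t. f t - f' t) = ip h f - ip h f'"
  using ip_cnj[of h "\<lambda>t. f t - f' t"] by (simp add: ip_diff_left ip_cnj[symmetric])

lemma nsq_nonneg[simp]: "nsq f \<ge> 0"
  by (simp add: nsq_def)

lemma nsq_diff_expand:
  assumes "f \<in> L2b" "h \<in> L2b"
  shows "nsq (\<lambda>t. f t - h t) = nsq f - 2 * Re (ip f h) + nsq h"
proof -
  have "complex_of_real (nsq (\<lambda>t. f t - h t)) = ip f f - ip f h - (ip h f - ip h h)"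
    using assms by (simp add: ip_self[symmetric] ip_diff_left ip_diff_right L2b_diff)
  also have "Re \<dots> = nsq f - 2 * Re (ip f h) + nsq h"
    by (simp add: ip_self ip_cnj[of h f])
  finally show ?thesis by simp
qed

lemma nsq_scale: "nsq (\<lambda>t. c * f t) = (cmod c)\<^sup>2 * nsq f"
  by (simp add: nsq_def norm_mult power_mult_distrib)

lemma ip_Cauchy_Schwarz_sq:
  assumes "f \<in> L2b" "h \<in> L2b"
  shows "(cmod (ip f h))\<^sup>2 \<le> nsq f * nsq h"
proof (cases "ip f h = 0")
  case False
  define z where "z = ip f h"
  \<comment> \<open>The factor \<open>z = ip f h\<close> in the coefficient turns the cross term
    into a nonnegative real number times \<open>t\<close>, so that a real parameter is
    enough.\<close>
  have q: "0 \<le> (nsq h * (cmod z)\<^sup>2) * t\<^sup>2 - 2 * (cmod z)\<^sup>2 * t + nsq f" for t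
  proof -
    have "0 \<le> nsq (\<lambda>s. f s - (of_real t * z) * h s)" by simp
    also have "\<dots> = nsq f - 2 * Re (cnj (of_real t * z) * z) + (cmod (of_real t * z))\<^sup>2 * nsq h"
      using assms by (subst nsq_diff_expand) (auto simp: L2b_scale ip_scale_right nsq_scale z_def)
    also have "Re (cnj (of_real t * z) * z) = t * (cmod z)\<^sup>2"
      by (simp add: cmod_power2) (simp add: power2_eq_square algebra_simps)
    finally show ?thesis by (simp add: norm_mult power_mult_distrib algebra_simps)
  qed
  have "((cmod z)\<^sup>2)\<^sup>2 \<le> nsq h * (cmod z)\<^sup>2 * nsq f"
    by (rule quadratic_nonneg_discriminant[OF _ q]) simp
  then have "(cmod z)\<^sup>2 * (cmod z)\<^sup>2 \<le> (cmod z)\<^sup>2 * (nsq f * nsq h)" by (simp only: power2_eq_square mult_ac)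
  moreover have "0 < (cmod z)\<^sup>2" using False z_def by simp
  ultimately show ?thesis unfolding z_def by (rule mult_left_le_imp_le)
qed simp

lemma ip_Cauchy_Schwarz:
  assumes "f \<in> L2b" "h \<in> L2b"
  shows "cmod (ip f h) \<le> sqrt (nsq f) * sqrt (nsq h)"
  using ip_Cauchy_Schwarz_sq[OF assms] real_le_rsqrt by (simp add: real_sqrt_mult[symmetric])

lemma nsq_add_le:
  assumes "f \<in> L2b" "h \<in> L2b"
  shows "nsq (\<lambda>t. f t + h t) \<le> 2 * nsq f + 2 * nsq h"
proof -
  have "nsq (\<lambda>t. f t + h t) \<le> (LINT t|lborel. 2 * (cmod (f t))\<^sup>2 + 2 * (cmod (h t))\<^sup>2)"
    unfolding nsq_def using assms
    by (intro integral_mono L2b_integrable L2b_add Bochner_Integration.integrable_add integrable_mult_right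
        cmod_add_square_le)
  also have "\<dots> = 2 * nsq f + 2 * nsq h"
    unfolding nsq_def using assms by (subst Bochner_Integration.integral_add) (auto intro!: integrable_mult_right L2b_integrable)
  finally show ?thesis .
qed

section \<open>Time-frequency shifts of Borel functions\<close>

definition chi :: "'d::finite phase_space \<Rightarrow> real ^ 'd \<Rightarrow> complex" where
  "chi z t = exp (2 * complex_of_real pi * \<i> * complex_of_real (snd z \<bullet> t))"

lemma chi_cis: "chi z t = cis (2 * pi * (snd z \<bullet> t))"
  by (simp add: chi_def cis_conv_exp mult_ac)

lemma norm_chi[simp]: "cmod (chi z t) = 1" by (simp add: chi_cis)

lemma tf_shift_chi: "tf_shift z g = (\<lambda>t. chi z t * g (t - fst z))"
  by (simp add: tf_shift_def chi_def)

lemma chi_measurable[measurable]: "chi z \<in> borel_measurable borel"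
  unfolding chi_def by measurable

lemma nsq_tf_shift[simp]:
  assumes "g \<in> L2b" shows "nsq (tf_shift z g) = nsq g"
  unfolding nsq_def tf_shift_chi using assms
  by (simp add: norm_mult integral_lborel_translate[where F="\<lambda>t. (cmod (g t))\<^sup>2"])

lemma L2b_tf_shift: assumes "g \<in> L2b" shows "tf_shift z g \<in> L2b"
proof -
  have [measurable]: "g \<in> borel_measurable borel" using assms by (rule L2b_measurable)
  have "integrable lborel (\<lambda>t. (cmod (g (t - fst z)))\<^sup>2)"
    by (rule integrable_lborel_translate[OF L2b_integrable[OF assms]])
  moreover have "(\<lambda>t. chi z t * g (t - fst z)) \<in> borel_measurable borel" by measurable
  ultimately show ?thesis by (simp add: L2b_def tf_shift_chi norm_mult)
qed

text \<open>Translations and modulations commute up to a factor of modulus one. Absolute values in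
  the Gram matrix of a Gabor system therefore depend on the difference of the indices only; every
  convolution-type estimate below rests on this.\<close>

lemma cmod_ip_tf_shift:
  assumes "f \<in> L2b" "h \<in> L2b"
  shows "cmod (ip (tf_shift z f) (tf_shift w h)) = cmod (ip f (tf_shift (w - z) h))"
proof -
  define F where "F = (\<lambda>t. f t * cnj (tf_shift (w - z) h t))"
  have [measurable]: "F \<in> borel_measurable borel"
    using L2b_integrable_prod[OF assms(1) L2b_tf_shift[OF assms(2)], of "w - z"] unfolding F_def by auto
  have "ip (tf_shift z f) (tf_shift w h) = (LINT t|lborel. cnj (cis (2 * pi * ((snd w - snd z) \<bullet> fst z))) * F (t - fst z))"
    unfolding ip_def
  proof (rule Bochner_Integration.integral_cong[OF refl])
    fix t
    have "chi z t * cnj (chi w t) = cnj (cis (2 * pi * ((snd w - snd z) \<bullet> fst z))) * cnj (chi (w - z) (t - fst z))"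
      by (simp add: chi_cis cis_cnj cis_mult) (simp add: algebra_simps inner_diff_left inner_diff_right)
    then show "tf_shift z f t * cnj (tf_shift w h t) = cnj (cis (2 * pi * ((snd w - snd z) \<bullet> fst z))) * F (t - fst z)"
      unfolding F_def tf_shift_chi by (simp add: algebra_simps)
  qed
  also have "\<dots> = cnj (cis (2 * pi * ((snd w - snd z) \<bullet> fst z))) * (LINT t|lborel. F (t - fst z))" by simp
  also have "cmod \<dots> = cmod (LINT t|lborel. F t)"
    by (simp add: norm_mult integral_lborel_translate)
  finally show ?thesis by (simp add: F_def ip_def)
qed

lemma cmod_ip_tf_shift_swap:
  assumes "f \<in> L2b" "h \<in> L2b"
  shows "cmod (ip f (tf_shift z h)) = cmod (ip h (tf_shift (- z) f))"
  using cmod_ip_tf_shift[OF assms(2,1), of z 0] cmod_ip_commute[of f "tf_shift z h"]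
  by (simp add: tf_shift_def)

lemma tf_shift_0[simp]: "tf_shift 0 f = f" by (simp add: tf_shift_def)

section \<open>Continuity of time-frequency shifts in the mean\<close>

lemma nsq_translation_continuous_compact_support:
  fixes h :: "'d::finite signal"
  assumes h: "continuous_on UNIV h" and r: "\<And>t. norm t > r \<Longrightarrow> h t = 0" and "e > 0"
  shows "\<exists>d>0. \<forall>u. norm u < d \<longrightarrow> nsq (\<lambda>t. h (t - u) - h t) < e"
proof -
  define K where "K = cball (0::real^'d) (r + 1)"
  define v where "v = measure lborel K"
  have v: "v \<ge> 0" by (simp add: v_def)
  \<comment> \<open>Chosen to give \<open>e'\<^sup>2 * v < e\<close>; the \<open>+ 1\<close> makes
    the denominator positive without an appeal to \<open>v > 0\<close>.\<close>
  define e' where "e' = sqrt (e / (2 * (v + 1)))"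
  have e': "e' > 0" using v \<open>e>0\<close> by (simp add: e'_def)
  have "uniformly_continuous_on (cball 0 (r + 2)) h"
    by (intro compact_uniformly_continuous continuous_on_subset[OF h]) auto
  then obtain d where d: "d > 0" "\<And>s t. s \<in> cball 0 (r+2) \<Longrightarrow> t \<in> cball 0 (r+2) \<Longrightarrow> dist s t < d \<Longrightarrow> dist (h s) (h t) < e'"
    using e' unfolding uniformly_continuous_on_def by metis
  have "nsq (\<lambda>t. h (t - u) - h t) < e" if u: "norm u < min d 1" for u
  proof -
    have bd: "(cmod (h (t - u) - h t))\<^sup>2 \<le> e'\<^sup>2 * indicator K t" for t
    proof (cases "t \<in> K")
      case True
      have "norm (t - u) \<le> norm t + norm u" by (rule norm_triangle_ineq4)
      then have "dist (h (t - u)) (h t) < e'" using True u by (intro d(2)) (auto simp: K_def dist_norm norm_minus_commute)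
      then show ?thesis using True by (auto simp: dist_norm intro!: power_mono)
    next
      case False
      have "norm t \<le> norm (t - u) + norm u" using norm_triangle_ineq[of "t - u" u] by simp
      then have "h (t - u) = 0" "h t = 0" using False u by (auto intro!: r simp: K_def)
      then show ?thesis using False by simp
    qed
    have K: "emeasure lborel K < \<infinity>" unfolding K_def by (rule emeasure_bounded_finite) auto
    have [measurable]: "h \<in> borel_measurable borel" using h by (rule borel_measurable_continuous_onI)
    have intK: "integrable lborel (\<lambda>t. e'\<^sup>2 * indicator K t)" using K
      by (intro integrable_mult_right) (auto simp: K_def)
    have "nsq (\<lambda>t. h (t - u) - h t) \<le> (LINT t|lborel. e'\<^sup>2 * indicator K t)"
      unfolding nsq_def
    proof (rule integral_mono)
      show "integrable lborel (\<lambda>t. (cmod (h (t - u) - h t))\<^sup>2)"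
        by (rule Bochner_Integration.integrable_bound[OF intK]) (use bd in auto)
    qed (use intK bd in auto)
    also have "\<dots> = e'\<^sup>2 * v" by (simp add: v_def)
    also have "\<dots> = e / (2 * (v+1)) * v" using v \<open>e>0\<close> by (simp add: e'_def)
    also have "\<dots> < e" using v \<open>e>0\<close> by (simp add: field_simps) (smt (verit) mult_nonneg_nonneg)
    finally show ?thesis .
  qed
  then show ?thesis using d(1) by (intro exI[of _ "min d 1"]) auto
qed

lemma nsq_tendsto_0_dominated:
  fixes s :: "nat \<Rightarrow> 'd::finite signal"
  assumes [measurable]: "\<And>n. s n \<in> borel_measurable borel"
    and w: "integrable lborel w" and "AE t in lborel. (\<lambda>n. s n t) \<longlonglongrightarrow> 0"
    and "\<And>n t. (cmod (s n t))\<^sup>2 \<le> w t"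
  shows "(\<lambda>n. nsq (s n)) \<longlonglongrightarrow> 0"
proof -
  have "(\<lambda>n. LINT t|lborel. (cmod (s n t))\<^sup>2) \<longlonglongrightarrow> (LINT t|(lborel :: (real^'d) measure). 0::real)"
  proof (rule integral_dominated_convergence[where w=w])
    show "AE t in lborel. (\<lambda>n. (cmod (s n t))\<^sup>2) \<longlonglongrightarrow> 0"
      using assms(3)
    proof eventually_elim
      case (elim t)
      then have "(\<lambda>n. (cmod (s n t))\<^sup>2) \<longlonglongrightarrow> (cmod 0)\<^sup>2" by (intro tendsto_intros)
      then show ?case by simp
    qed
  qed (use assms in auto)
  then show ?thesis by (simp add: nsq_def)
qed

lemma L2b_approx_bounded:
  assumes h: "h \<in> L2b" and "e > 0"
  shows "\<exists>n::nat. nsq (\<lambda>t. h t - (if cmod (h t) \<le> n \<and> norm t \<le> n then h t else 0)) < e"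
proof -
  have [measurable]: "h \<in> borel_measurable borel" using h by (rule L2b_measurable)
  let ?s = "\<lambda>n t. h t - (if cmod (h t) \<le> real n \<and> norm t \<le> real n then h t else 0)"
  have "(\<lambda>n. nsq (?s n)) \<longlonglongrightarrow> 0"
  proof (rule nsq_tendsto_0_dominated[OF _ L2b_integrable[OF h]])
    show "AE t in lborel. (\<lambda>n. ?s n t) \<longlonglongrightarrow> 0"
    proof (rule AE_I2)
      fix t
      obtain k where k: "max (cmod (h t)) (norm t) \<le> real k" using real_arch_simple by blast
      have "\<forall>\<^sub>F n in sequentially. ?s n t = 0"
        using eventually_ge_at_top[of k]
      proof eventually_elim
        case (elim n)
        have "real k \<le> real n" using elim by simp
        then show ?case using k by auto
      qed
      then show "(\<lambda>n. ?s n t) \<longlonglongrightarrow> 0" by (rule tendsto_eventually)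
    qed
  qed auto
  then obtain n where "nsq (?s n) < e"
    using order_tendstoD(2)[of "\<lambda>n. nsq (?s n)" 0 sequentially e] \<open>e>0\<close> eventually_happens by force
  then show ?thesis by blast
qed

text \<open>A measurable function is an almost everywhere limit of continuous functions, but nothing
  dominates that sequence. So \<open>h\<close> is first truncated to \<open>h1\<close>. The
  approximants are then retracted to a disc and multiplied by a tent function, which changes neither
  their continuity nor their limit and bounds them by a constant on a ball.\<close>

lemma L2b_dense_continuous:
  fixes h :: "'d::finite signal"
  assumes h: "h \<in> L2b" and "e > 0"
  shows "\<exists>h' r. h' \<in> L2b \<and> continuous_on UNIV h' \<and> (\<forall>t. norm t > r \<longrightarrow> h' t = 0) \<and> nsq (\<lambda>t. h t - h' t) < e"
proof -
  have [measurable]: "h \<in> borel_measurable borel" using h by (rule L2b_measurable)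
  obtain n :: nat where n: "nsq (\<lambda>t. h t - (if cmod (h t) \<le> n \<and> norm t \<le> n then h t else 0)) < e / 4"
    using L2b_approx_bounded[OF h, of "e/4"] \<open>e>0\<close> by auto
  define h1 where "h1 = (\<lambda>t. if cmod (h t) \<le> n \<and> norm t \<le> n then h t else 0)"
  have [measurable]: "h1 \<in> borel_measurable borel" unfolding h1_def by measurable
  have h1_le: "cmod (h1 t) \<le> n" "norm t > n \<Longrightarrow> h1 t = 0" for t by (auto simp: h1_def)
  have h1: "h1 \<in> L2b"
    unfolding L2b_def mem_Collect_eq
    by (intro conjI Bochner_Integration.integrable_bound[OF L2b_integrable[OF h]]) (auto simp: h1_def)
  have "h1 measurable_on UNIV"
    by (rule lebesgue_measurable_imp_measurable_on) (auto intro: measurable_completion)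
  then obtain N g where N: "negligible N" and g: "\<And>k. continuous_on UNIV (g k)"
    and lim: "\<And>t. t \<notin> N \<Longrightarrow> (\<lambda>k. g k t) \<longlonglongrightarrow> h1 t"
    unfolding measurable_on_def by auto
  define m where "m = real n + 1"
  have m: "m > 0" by (simp add: m_def)
  \<comment> \<open>The radial retraction of the complex plane onto the closed disc of radius
    \<open>m\<close>. Since \<open>m = n + 1\<close>, it fixes the values of \<open>h1\<close>, and
    \<open>th\<close> has room to descend from 1 to 0 outside the ball of radius
    \<open>n\<close>.\<close>
  define P where "P = (\<lambda>z::complex. of_real (m / max m (cmod z)) * z)"
  have P_id: "P z = z" if "cmod z \<le> m" for z using that m by (simp add: P_def max_def)
  have P_le: "cmod (P z) \<le> m" for z 
  proof (cases "cmod z \<le> m")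
    case False
    then show ?thesis using m by (simp add: P_def norm_mult norm_divide max_def)
  qed (simp add: P_id)
  have P_cont: "continuous_on UNIV P" unfolding P_def using m by (intro continuous_intros) auto
  define th where "th = (\<lambda>t::real^'d. max 0 (min 1 (m - norm t)))"
  have th: "th t = 1" if "norm t \<le> n" for t using that by (simp add: th_def m_def)
  have th0: "th t = 0" if "norm t > m" for t using that by (simp add: th_def)
  have th01: "0 \<le> th t" "th t \<le> 1" for t by (auto simp: th_def)
  have th_cont: "continuous_on UNIV th" unfolding th_def by (intro continuous_intros)
  define s where "s = (\<lambda>k t. of_real (th t) * P (g k t))"
  have s_cont: "continuous_on UNIV (s k)" for k
    unfolding s_def
    by (intro continuous_intros th_cont continuous_on_compose2[OF P_cont] g) auto
  then have [measurable]: "s k \<in> borel_measurable borel" for k by (rule borel_measurable_continuous_onI)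
  define K where "K = cball (0::real^'d) m"
  have K: "emeasure lborel K < \<infinity>" unfolding K_def by (rule emeasure_bounded_finite) auto
  have intK: "integrable lborel (\<lambda>t. c * indicator K t :: real)" for c using K
    by (intro integrable_mult_right) (auto simp: K_def)
  have s_le: "(cmod (s k t))\<^sup>2 \<le> m\<^sup>2 * indicator K t" for k t
  proof (cases "t \<in> K")
    case True
    have "cmod (s k t) \<le> 1 * m" unfolding s_def norm_mult using th01 P_le m by (intro mult_mono) auto
    then show ?thesis using True by (auto intro!: power_mono)
  qed (auto simp: s_def th0 K_def)
  have s_L2: "s k \<in> L2b" for k
    unfolding L2b_def mem_Collect_eq
    by (intro conjI Bochner_Integration.integrable_bound[OF intK[of "m\<^sup>2"]]) (use s_le in auto)
  have "(\<lambda>k. nsq (\<lambda>t. h1 t - s k t)) \<longlonglongrightarrow> 0"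
  proof (rule nsq_tendsto_0_dominated[OF _ intK[of "4 * m\<^sup>2"]])
    have "AE t in lebesgue. t \<notin> N" using N by (simp add: AE_not_in negligible_iff_null_sets)
    then have "AE t in lborel. t \<notin> N" by (simp add: AE_completion_iff)
    then show "AE t in lborel. (\<lambda>k. h1 t - s k t) \<longlonglongrightarrow> 0"
    proof eventually_elim
      case (elim t)
      have "isCont P (h1 t)" using P_cont by (simp add: continuous_on_eq_continuous_at)
      then have "(\<lambda>k. P (g k t)) \<longlonglongrightarrow> P (h1 t)" using lim[OF elim] by (rule isCont_tendsto_compose)
      then have "(\<lambda>k. h1 t - of_real (th t) * P (g k t)) \<longlonglongrightarrow> h1 t - of_real (th t) * P (h1 t)"
        by (intro tendsto_intros)
      moreover have "of_real (th t) * P (h1 t) = h1 t"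
      proof (cases "norm t > n")
        case True then show ?thesis using h1_le(2) by (simp add: P_def)
      next
        case False
        have "cmod (h1 t) \<le> m" using h1_le(1)[of t] by (simp add: m_def)
        then show ?thesis using False by (simp add: P_id th)
      qed
      ultimately show ?case by (simp add: s_def)
    qed
    fix k t
    show "(cmod (h1 t - s k t))\<^sup>2 \<le> 4 * m\<^sup>2 * indicator K t"
    proof (cases "t \<in> K")
      case True
      have "cmod (h1 t - s k t) \<le> cmod (h1 t) + cmod (s k t)" by (rule norm_triangle_ineq4)
      moreover have "cmod (s k t) \<le> m" using s_le[of k t] True m by (auto intro: power2_le_imp_le)
      ultimately have "cmod (h1 t - s k t) \<le> 2 * m" using h1_le(1)[of t] by (simp add: m_def)
      then have "(cmod (h1 t - s k t))\<^sup>2 \<le> (2 * m)\<^sup>2" by (intro power_mono) auto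
      then show ?thesis using True by (simp add: power_mult_distrib)
    qed (auto simp: s_def th0 K_def h1_le m_def)
  qed auto
  then obtain k where k: "nsq (\<lambda>t. h1 t - s k t) < e/4"
    using order_tendstoD(2)[of "\<lambda>k. nsq (\<lambda>t. h1 t - s k t)" 0 sequentially "e/4"] \<open>e>0\<close> eventually_happens by force
  have "nsq (\<lambda>t. h t - s k t) = nsq (\<lambda>t. (h t - h1 t) + (h1 t - s k t))" by simp
  also have "\<dots> \<le> 2 * nsq (\<lambda>t. h t - h1 t) + 2 * nsq (\<lambda>t. h1 t - s k t)"
    by (intro nsq_add_le L2b_diff h h1 s_L2)
  also have "\<dots> < e" using k n by (simp add: h1_def)
  finally show ?thesis using s_cont s_L2 th0 by (intro exI[of _ "s k"] exI[of _ m]) (auto simp: s_def)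
qed

lemma tf_shift_translation: "tf_shift (u, 0) h = (\<lambda>t. h (t - u))"
  by (simp add: tf_shift_def)

lemma nsq_minus_commute: "nsq (\<lambda>t. f t - h t) = nsq (\<lambda>t. h t - f t)"
  by (simp add: nsq_def norm_minus_commute)

lemma nsq_translation_continuous:
  fixes h :: "'d::finite signal"
  assumes h: "h \<in> L2b" and "e > 0"
  shows "\<exists>d>0. \<forall>u. norm u < d \<longrightarrow> nsq (\<lambda>t. h (t - u) - h t) < e"
proof -
  \<comment> \<open>The two uses of \<open>nsq_add_le\<close> below bound the target by 2 + 4 + 4
    times \<open>e / 20\<close>.\<close>
  obtain h' r where h': "h' \<in> L2b" "continuous_on UNIV h'" "\<And>t. norm t > r \<Longrightarrow> h' t = 0"
    and close: "nsq (\<lambda>t. h t - h' t) < e / 20"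
    using L2b_dense_continuous[OF h, of "e/20"] \<open>e>0\<close> by auto
  obtain d where d: "d > 0" "\<And>u. norm u < d \<Longrightarrow> nsq (\<lambda>t. h' (t - u) - h' t) < e / 20"
    using nsq_translation_continuous_compact_support[OF h'(2,3), where e="e/20"] \<open>e>0\<close> by auto
  have "nsq (\<lambda>t. h (t - u) - h t) < e" if u: "norm u < d" for u
  proof -
    have sh: "(\<lambda>t. f (t - u)) \<in> L2b" if "f \<in> L2b" for f :: "'d signal"
      using L2b_tf_shift[OF that, of "(u, 0)"] by (simp add: tf_shift_translation)
    have c: "nsq (\<lambda>t. h (t - u) - h' (t - u)) < e / 20"
      using nsq_tf_shift[OF L2b_diff[OF h h'(1)], of "(u,0)"] close by (simp add: tf_shift_translation)
    have "nsq (\<lambda>t. h (t - u) - h t) = nsq (\<lambda>t. (h (t - u) - h' (t - u)) + ((h' (t - u) - h' t) + (h' t - h t)))"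
      by simp
    also have "\<dots> \<le> 2 * nsq (\<lambda>t. h (t - u) - h' (t - u)) + 2 * nsq (\<lambda>t. (h' (t - u) - h' t) + (h' t - h t))"
      by (intro nsq_add_le L2b_diff L2b_add sh h h')
    moreover have "nsq (\<lambda>t. (h' (t - u) - h' t) + (h' t - h t)) \<le> 2 * nsq (\<lambda>t. h' (t - u) - h' t) + 2 * nsq (\<lambda>t. h' t - h t)"
      by (intro nsq_add_le L2b_diff L2b_add sh h h')
    ultimately show ?thesis using c d(2)[OF u] close nsq_minus_commute[of h h'] \<open>e>0\<close> by linarith
  qed
  then show ?thesis using d(1) by blast
qed

lemma ip_translation_tendsto:
  fixes f h :: "'d::finite signal"
  assumes f: "f \<in> L2b" and h: "h \<in> L2b"
  shows "((\<lambda>u. ip f (tf_shift (u, 0) h)) \<longlongrightarrow> ip f h) (at 0)"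
proof (rule tendstoI)
  fix e :: real assume "e > 0"
  define e' where "e' = e\<^sup>2 / (nsq f + 1)"
  have e': "e' > 0" using \<open>e>0\<close> by (auto simp: e'_def intro!: divide_pos_pos add_nonneg_pos)
  obtain d where d: "d > 0" "\<And>u. norm u < d \<Longrightarrow> nsq (\<lambda>t. h (t - u) - h t) < e'"
    using nsq_translation_continuous[OF h e'] by auto
  have "dist (ip f (tf_shift (u, 0) h)) (ip f h) < e" if "norm u < d" for u
  proof -
    have sh: "(\<lambda>t. h (t - u)) \<in> L2b"
      using L2b_tf_shift[OF h, of "(u, 0)"] by (simp add: tf_shift_translation)
    have "(cmod (ip f (\<lambda>t. h (t - u) - h t)))\<^sup>2 \<le> nsq f * nsq (\<lambda>t. h (t - u) - h t)"
      by (intro ip_Cauchy_Schwarz_sq L2b_diff f h sh)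
    also have "\<dots> \<le> nsq f * e'" using d(2)[OF that] by (intro mult_left_mono) auto
    also have "\<dots> < e\<^sup>2"
    proof -
      have p: "nsq f + 1 > 0" using nsq_nonneg[of f] by linarith
      have "nsq f * e' = nsq f * e\<^sup>2 / (nsq f + 1)" by (simp add: e'_def)
      also have "\<dots> < e\<^sup>2" using \<open>e>0\<close> by (subst pos_divide_less_eq[OF p]) (simp add: algebra_simps)
      finally show ?thesis .
    qed
    finally have "cmod (ip f (\<lambda>t. h (t - u) - h t)) < e" using \<open>e>0\<close> by (auto intro: power2_less_imp_less)
    then show ?thesis using f h sh by (simp add: ip_diff_right tf_shift_translation dist_norm)
  qed
  then show "\<forall>\<^sub>F u in at 0. dist (ip f (tf_shift (u, 0) h)) (ip f h) < e"
    using d(1) unfolding eventually_at by (intro exI[of _ d]) (auto simp: dist_norm)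
qed

text \<open>Unlike translates, modulated functions converge at every point and are dominated by a
  multiple of \<open>h\<close>, so dominated convergence replaces the density argument.\<close>

lemma nsq_modulation_continuous:
  fixes h :: "'d::finite signal"
  assumes h: "h \<in> L2b" and X: "X \<longlonglongrightarrow> 0"
  shows "(\<lambda>n. nsq (\<lambda>t. chi (0, X n) t * h t - h t)) \<longlonglongrightarrow> 0"
proof (rule nsq_tendsto_0_dominated[where w="\<lambda>t. 4 * (cmod (h t))\<^sup>2"])
  have [measurable]: "h \<in> borel_measurable borel" using h by (rule L2b_measurable)
  show "(\<lambda>t. chi (0, X n) t * h t - h t) \<in> borel_measurable borel" for n by measurable
  show "integrable lborel (\<lambda>t. 4 * (cmod (h t))\<^sup>2)" using L2b_integrable[OF h] by simp
  show "AE t in lborel. (\<lambda>n. chi (0, X n) t * h t - h t) \<longlonglongrightarrow> 0"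
  proof (intro always_eventually allI)
    fix t
    have "(\<lambda>n. chi (0, X n) t * h t - h t) \<longlonglongrightarrow> exp (2 * complex_of_real pi * \<i> * complex_of_real (0 \<bullet> t)) * h t - h t"
      unfolding chi_def snd_conv by (intro tendsto_intros X)
    then show "(\<lambda>n. chi (0, X n) t * h t - h t) \<longlonglongrightarrow> 0" by simp
  qed
  fix n t
  have "cmod (chi (0, X n) t * h t - h t) \<le> 2 * cmod (h t)"
    using norm_triangle_ineq4[of "chi (0, X n) t * h t" "h t"] by (simp add: norm_mult)
  then have "(cmod (chi (0, X n) t * h t - h t))\<^sup>2 \<le> (2 * cmod (h t))\<^sup>2" by (intro power_mono) auto
  then show "(cmod (chi (0, X n) t * h t - h t))\<^sup>2 \<le> 4 * (cmod (h t))\<^sup>2" by (simp add: power_mult_distrib)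
qed

lemma nsq_tf_shift_continuous:
  fixes h :: "'d::finite signal"
  assumes h: "h \<in> L2b" and "e > 0"
  shows "\<exists>d>0. \<forall>z. norm z < d \<longrightarrow> nsq (\<lambda>t. tf_shift z h t - h t) < e"
proof -
  have "((\<lambda>x. nsq (\<lambda>t. chi (0, x) t * h t - h t)) \<longlongrightarrow> 0) (at 0)"
    unfolding tendsto_at_iff_sequentially o_def using nsq_modulation_continuous[OF h] by blast
  then have "\<forall>\<^sub>F x in at 0. nsq (\<lambda>t. chi (0, x) t * h t - h t) < e / 4"
    using \<open>e>0\<close> by (intro order_tendstoD) auto
  then obtain d1 where d1: "d1 > 0" "\<And>x. x \<noteq> 0 \<Longrightarrow> norm x < d1 \<Longrightarrow> nsq (\<lambda>t. chi (0, x) t * h t - h t) < e / 4"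
    unfolding eventually_at by (auto simp: dist_norm)
  \<comment> \<open>The filter \<open>at 0\<close> leaves out the point 0 itself.\<close>
  have "nsq (\<lambda>t. chi (0, 0) t * h t - h t) < e / 4" using \<open>e>0\<close> by (simp add: chi_def nsq_def)
  then have d1': "\<And>x. norm x < d1 \<Longrightarrow> nsq (\<lambda>t. chi (0, x) t * h t - h t) < e / 4"
    using d1 by (metis)
  obtain d2 where d2: "d2 > 0" "\<And>u. norm u < d2 \<Longrightarrow> nsq (\<lambda>t. h (t - u) - h t) < e / 4"
    using nsq_translation_continuous[OF h, of "e/4"] \<open>e>0\<close> by auto
  have "nsq (\<lambda>t. tf_shift z h t - h t) < e" if z: "norm z < min d1 d2" for z
  proof -
    have n: "norm (fst z) < d2" "norm (snd z) < d1"
      using z norm_fst_le[of "fst z" "snd z"] norm_snd_le[of "snd z" "fst z"] by auto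
    have sh: "(\<lambda>t. h (t - fst z)) \<in> L2b"
      using L2b_tf_shift[OF h, of "(fst z, 0)"] by (simp add: tf_shift_translation)
    have ch: "(\<lambda>t. chi z t * f t) \<in> L2b" if "f \<in> L2b" for f
      using L2b_tf_shift[OF that, of "(0, snd z)"] by (simp add: tf_shift_def chi_def)
    have chz: "chi (0, snd z) = chi z" by (simp add: chi_def fun_eq_iff)
    have "nsq (\<lambda>t. tf_shift z h t - h t) = nsq (\<lambda>t. chi z t * (h (t - fst z) - h t) + (chi z t * h t - h t))"
      by (simp add: tf_shift_chi algebra_simps)
    also have "\<dots> \<le> 2 * nsq (\<lambda>t. chi z t * (h (t - fst z) - h t)) + 2 * nsq (\<lambda>t. chi z t * h t - h t)"
      by (intro nsq_add_le ch L2b_diff sh h)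
    also have "nsq (\<lambda>t. chi z t * (h (t - fst z) - h t)) = nsq (\<lambda>t. h (t - fst z) - h t)"
      by (simp add: nsq_def norm_mult)
    finally show ?thesis using d2(2)[OF n(1)] d1'[OF n(2)] by (simp add: chz)
  qed
  then show ?thesis using d1(1) d2(1) by (intro exI[of _ "min d1 d2"]) auto
qed

section \<open>Gaussians and a regularised Parseval identity\<close>

lemma borel_measurable_cis[measurable]: "cis \<in> borel_measurable borel"
  by (intro borel_measurable_continuous_onI continuous_intros)

lemma integral_lborel_scale:
  fixes F :: "'a::euclidean_space \<Rightarrow> 'b::{banach, second_countable_topology}"
  assumes [measurable]: "F \<in> borel_measurable borel" and "s > 0"
  shows "(LINT t|lborel. F t) = (s ^ DIM('a)) *\<^sub>R (LINT t|lborel. F (s *\<^sub>R t))"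
proof -
  have "(LINT t|lborel. F t) = (LINT t|density (distr lborel borel (\<lambda>x. 0 + s *\<^sub>R x)) (\<lambda>_. ennreal (\<bar>s\<bar> ^ DIM('a))). F t)"
    using assms by (subst lborel_affine[of s 0]) auto
  also have "\<dots> = (LINT t|distr lborel borel (\<lambda>x. 0 + s *\<^sub>R x). (s ^ DIM('a)) *\<^sub>R F t)"
    using assms by (subst integral_density) auto
  also have "\<dots> = (LINT t|lborel. (s ^ DIM('a)) *\<^sub>R F (s *\<^sub>R t))"
    by (subst integral_distr) auto
  finally show ?thesis by simp
qed

lemma
  fixes f :: "'a::euclidean_space \<Rightarrow> real \<Rightarrow> 'b::{real_normed_field, banach, second_countable_topology}"
  assumes f: "\<And>b. b \<in> Basis \<Longrightarrow> integrable lborel (f b)"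
  shows integrable_lborel_prod: "integrable lborel (\<lambda>x. \<Prod>b\<in>Basis. f b (x \<bullet> b))"
    and integral_lborel_prod: "(LINT x|lborel. (\<Prod>b\<in>Basis. f b (x \<bullet> b))) = (\<Prod>b\<in>Basis. (LINT x|lborel. f b x))"
proof -
  interpret product_sigma_finite "\<lambda>_::'a. lborel :: real measure" ..
  let ?T = "\<lambda>g. \<Sum>b\<in>Basis. g b *\<^sub>R b :: 'a"
  have L: "lborel = distr (\<Pi>\<^sub>M b\<in>(Basis::'a set). lborel :: real measure) borel ?T"
    by (simp add: lborel_def[where 'a='a] lborel_eq_real)
  have f_meas[measurable]: "\<And>b. b \<in> Basis \<Longrightarrow> f b \<in> borel_measurable borel" using f by auto
  have c: "(\<Prod>b\<in>Basis. f b (?T g \<bullet> b)) = (\<Prod>b\<in>Basis. f b (g b))" for g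
    by (intro prod.cong) (auto simp: inner_sum_left inner_Basis if_distrib cong: if_cong)
  have Tm: "?T \<in> measurable (\<Pi>\<^sub>M b\<in>(Basis::'a set). lborel) borel" by measurable
  have m: "(\<lambda>x. \<Prod>b\<in>Basis. f b (x \<bullet> b)) \<in> borel_measurable borel" by measurable
  have "integrable (\<Pi>\<^sub>M b\<in>(Basis::'a set). lborel) (\<lambda>g. \<Prod>b\<in>Basis. f b (g b))"
    by (rule product_integrable_prod) (auto intro: f)
  then show "integrable lborel (\<lambda>x. \<Prod>b\<in>Basis. f b (x \<bullet> b))"
    by (subst L, subst integrable_distr_eq[OF Tm m]) (simp only: c)
  have "(LINT x|lborel. (\<Prod>b\<in>Basis. f b (x \<bullet> b))) = (LINT g|(\<Pi>\<^sub>M b\<in>(Basis::'a set). lborel). (\<Prod>b\<in>Basis. f b (g b)))"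
    by (subst L, subst integral_distr[OF Tm m]) (simp only: c)
  also have "\<dots> = (\<Prod>b\<in>Basis. (LINT x|lborel. f b x))"
    by (rule product_integral_prod) (auto intro: f)
  finally show "(LINT x|lborel. (\<Prod>b\<in>Basis. f b (x \<bullet> b))) = (\<Prod>b\<in>Basis. (LINT x|lborel. f b x))" .
qed

lemma cis_sum: "finite A \<Longrightarrow> cis (\<Sum>x\<in>A. f x) = (\<Prod>x\<in>A. cis (f x))"
  by (induction A rule: finite_induct) (auto simp: cis_mult[symmetric])

text \<open>Both the Gaussian and the character factorise over the coordinates. In one dimension the
  integral is, up to normalisation, the characteristic function of the standard normal
  distribution.\<close>

lemma
  fixes v :: "'a::euclidean_space"
  shows integrable_gaussian_cis: "integrable lborel (\<lambda>x::'a. of_real (exp (- (norm x)\<^sup>2 / 2)) * cis (x \<bullet> v))"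
    and integral_gaussian_cis: "(LINT x|lborel. of_real (exp (- (norm x)\<^sup>2 / 2)) * cis (x \<bullet> v))
      = of_real (sqrt (2 * pi) ^ DIM('a) * exp (- (norm v)\<^sup>2 / 2))"
proof -
  define f where "f = (\<lambda>(b::'a) (x::real). complex_of_real (exp (- x\<^sup>2 / 2)) * cis (x * (v \<bullet> b)))"
  have sq: "(\<Sum>b\<in>Basis. (x \<bullet> b)\<^sup>2) = (norm x)\<^sup>2" for x :: 'a
    by (subst power2_norm_eq_inner, subst euclidean_inner) (simp add: power2_eq_square)
  have eq: "(\<Prod>b\<in>Basis. f b (x \<bullet> b)) = of_real (exp (- (norm x)\<^sup>2 / 2)) * cis (x \<bullet> v)" for x
    unfolding f_def prod.distrib of_real_prod[symmetric] exp_sum[OF finite_Basis, symmetric]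
      cis_sum[OF finite_Basis, symmetric] euclidean_inner[of x v, symmetric]
    by (simp add: sum_negf sum_divide_distrib[symmetric] sq)
  have n0: "integrable lborel std_normal_density"
    using integrable_normal_density by simp
  have fd: "f b x = of_real (sqrt (2 * pi)) * (of_real (std_normal_density x) * cis (x * (v \<bullet> b)))" for b x
    unfolding f_def std_normal_density_def by simp
  have fi: "integrable lborel (f b)" for b
    unfolding fd
  proof (intro integrable_mult_right)
    show "integrable lborel (\<lambda>x. complex_of_real (std_normal_density x) * cis (x * (v \<bullet> b)))"
      by (rule Bochner_Integration.integrable_bound[OF n0]) (auto simp: norm_mult)
  qed
  have fI: "(LINT x|lborel. f b x) = of_real (sqrt (2 * pi) * exp (- (v \<bullet> b)\<^sup>2 / 2))" for b
  proof -
    have "(LINT x|lborel. complex_of_real (std_normal_density x) * cis (x * (v \<bullet> b))) = char std_normal_distribution (v \<bullet> b)"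
      unfolding char_def by (subst integral_density) (auto simp: cis_conv_exp mult_ac scaleR_conv_of_real)
    then show ?thesis unfolding fd by (simp add: char_std_normal_distribution)
  qed
  show "integrable lborel (\<lambda>x::'a. of_real (exp (- (norm x)\<^sup>2 / 2)) * cis (x \<bullet> v))"
    using integrable_lborel_prod[of f, OF fi] unfolding eq .
  have "(LINT x|lborel. of_real (exp (- (norm x)\<^sup>2 / 2)) * cis (x \<bullet> v)) = (\<Prod>b\<in>Basis. (LINT x|lborel. f b x))"
    using integral_lborel_prod[of f, OF fi] unfolding eq .
  also have "\<dots> = of_real (\<Prod>b\<in>(Basis::'a set). sqrt (2 * pi) * exp (- (v \<bullet> b)\<^sup>2 / 2))"
    unfolding fI by (simp only: of_real_prod)
  also have "(\<Prod>b\<in>(Basis::'a set). sqrt (2 * pi) * exp (- (v \<bullet> b)\<^sup>2 / 2)) = sqrt (2 * pi) ^ DIM('a) * exp (- (norm v)\<^sup>2 / 2)"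
    unfolding prod.distrib exp_sum[OF finite_Basis, symmetric]
    by (simp add: sum_negf sum_divide_distrib[symmetric] sq)
  finally show "(LINT x|lborel. of_real (exp (- (norm x)\<^sup>2 / 2)) * cis (x \<bullet> v))
      = of_real (sqrt (2 * pi) ^ DIM('a) * exp (- (norm v)\<^sup>2 / 2))" .
qed

lemma
  shows integrable_gaussian: "integrable lborel (\<lambda>x::'a::euclidean_space. exp (- (norm x)\<^sup>2 / 2))"
    and integral_gaussian: "(LINT x|lborel. exp (- (norm (x::'a))\<^sup>2 / 2)) = sqrt (2 * pi) ^ DIM('a)"
proof -
  have "complex_of_real (exp (- (norm x)\<^sup>2 / 2)) * cis (x \<bullet> 0) = of_real (exp (- (norm x)\<^sup>2 / 2))" for x :: 'a by simp
  then show "integrable lborel (\<lambda>x::'a. exp (- (norm x)\<^sup>2 / 2))"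
    using integrable_Re[OF integrable_gaussian_cis[of "0::'a"]] by simp
  have "complex_of_real (LINT x|lborel. exp (- (norm (x::'a))\<^sup>2 / 2)) = of_real (sqrt (2 * pi) ^ DIM('a))"
    using integral_gaussian_cis[of "0::'a"] by (subst integral_complex_of_real[symmetric]) simp
  then show "(LINT x|lborel. exp (- (norm (x::'a))\<^sup>2 / 2)) = sqrt (2 * pi) ^ DIM('a)"
    by (simp only: of_real_eq_iff)
qed

lemma integrable_lborel_tensor:
  fixes a :: "'a::euclidean_space \<Rightarrow> complex" and b :: "'b::euclidean_space \<Rightarrow> complex"
  assumes a: "integrable lborel a" and b: "integrable lborel b"
  shows "integrable (lborel \<Otimes>\<^sub>M lborel) (\<lambda>(t, s). a t * b s)"
proof -
  have [measurable]: "a \<in> borel_measurable borel" "b \<in> borel_measurable borel" using a b by auto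
  show ?thesis
  proof (rule lborel_pair.Fubini_integrable)
    show "integrable lborel (\<lambda>t. LINT s|lborel. norm (case (t, s) of (t, s) \<Rightarrow> a t * b s))"
      using a by (simp add: norm_mult)
    show "AE t in lborel. integrable lborel (\<lambda>s. case (t, s) of (t, s) \<Rightarrow> a t * b s)"
      using b by simp
  qed measurable
qed

text \<open>Fubini's theorem, with an arbitrary kernel of modulus one in place of the Fourier
  kernel: \<open>regularised_parseval\<close> uses it with both signs of the phase.\<close>

lemma multiplication_formula:
  fixes a :: "'a::euclidean_space \<Rightarrow> complex" and b :: "'b::euclidean_space \<Rightarrow> complex"
  assumes a: "integrable lborel a" and b: "integrable lborel b"
    and e: "(\<lambda>(t, s). e t s) \<in> borel_measurable (borel \<Otimes>\<^sub>M borel)" and e1: "\<And>t s. cmod (e t s) = 1"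
  shows "(LINT t|lborel. a t * (LINT s|lborel. b s * e t s)) = (LINT s|lborel. b s * (LINT t|lborel. a t * e t s))"
proof -
  have [measurable]: "a \<in> borel_measurable borel" "b \<in> borel_measurable borel" using a b by auto
  note e[measurable]
  have "integrable (lborel \<Otimes>\<^sub>M lborel) (\<lambda>(t, s). a t * b s * e t s)"
    by (rule Bochner_Integration.integrable_bound[OF integrable_lborel_tensor[OF a b]]) (auto simp: norm_mult e1)
  from lborel_pair.Fubini_integral[OF this]
  have "(LINT s|lborel. LINT t|lborel. a t * b s * e t s) = (LINT t|lborel. LINT s|lborel. a t * b s * e t s)" by simp
  moreover have "(LINT s|lborel. a t * b s * e t s) = a t * (LINT s|lborel. b s * e t s)" for t
    by (simp add: mult.assoc)
  moreover have "(LINT t|lborel. a t * b s * e t s) = b s * (LINT t|lborel. a t * e t s)" for s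
    by (subst integral_mult_right_zero[symmetric]) (simp add: ac_simps)
  ultimately show ?thesis by simp
qed

definition ft :: "('a::euclidean_space \<Rightarrow> complex) \<Rightarrow> 'a \<Rightarrow> complex" where
  "ft F \<xi> = (LINT t|lborel. F t * cis (- (2 * pi * (\<xi> \<bullet> t))))"

lemma ft_measurable_param:
  assumes [measurable]: "(\<lambda>(x, t). F x t) \<in> borel_measurable (borel \<Otimes>\<^sub>M borel)"
  shows "(\<lambda>(x::'b::euclidean_space, \<xi>::'a::euclidean_space). ft (F x) \<xi>) \<in> borel_measurable (borel \<Otimes>\<^sub>M borel)"
proof -
  have "(\<lambda>p. LINT t|lborel. F (fst p) t * cis (- (2 * pi * (snd p \<bullet> t)))) \<in> borel_measurable (borel \<Otimes>\<^sub>M borel)"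
    by measurable
  then show ?thesis by (simp add: ft_def case_prod_beta')
qed

lemma ft_measurable:
  assumes [measurable]: "F \<in> borel_measurable borel"
  shows "ft F \<in> borel_measurable borel"
proof -
  have "(\<lambda>\<xi>. LINT t|lborel. F t * cis (- (2 * pi * (\<xi> \<bullet> t)))) \<in> borel_measurable borel"
    by measurable
  then show ?thesis by (simp add: ft_def[abs_def])
qed

lemma norm_ft_le: "norm (ft F \<xi>) \<le> (LINT t|lborel. norm (F t))"
  unfolding ft_def using integral_norm_bound[of lborel "\<lambda>t. F t * cis (- (2 * pi * (\<xi> \<bullet> t)))"]
  by (simp add: norm_mult)

text \<open>The density of the centred normal distribution with standard deviation
  \<open>s / (2 * pi)\<close> in each coordinate. It is the Fourier transform of the Gaussian
  \<open>exp (- (norm (s *\<^sub>R x))\<^sup>2 / 2)\<close> and an approximate identity as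
  \<open>s\<close> tends to 0.\<close>

definition gk :: "real \<Rightarrow> 'a::euclidean_space \<Rightarrow> real" where
  "gk s u = (sqrt (2 * pi) / s) ^ DIM('a) * exp (- (norm ((2 * pi / s) *\<^sub>R u))\<^sup>2 / 2)"

lemma gk_measurable[measurable]: "gk s \<in> borel_measurable borel"
  unfolding gk_def by measurable

lemma gk_pos: "s > 0 \<Longrightarrow> gk s u > 0" by (simp add: gk_def)

lemma
  assumes s: "s > 0"
  shows integrable_gaussian_scaled: "integrable lborel (\<lambda>x::'a::euclidean_space. exp (- (norm (s *\<^sub>R x))\<^sup>2 / 2))"
    and integral_gaussian_scaled: "(LINT x|lborel. exp (- (norm (s *\<^sub>R (x::'a)))\<^sup>2 / 2)) = (sqrt (2 * pi) / s) ^ DIM('a)"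
proof -
  have "s ^ DIM('a) *\<^sub>R (LINT x|lborel. exp (- (norm (s *\<^sub>R (x::'a)))\<^sup>2 / 2)) = sqrt (2 * pi) ^ DIM('a)"
    by (subst integral_lborel_scale[OF _ s, symmetric]) (simp_all only: integral_gaussian, measurable)
  then show eq: "(LINT x|lborel. exp (- (norm (s *\<^sub>R (x::'a)))\<^sup>2 / 2)) = (sqrt (2 * pi) / s) ^ DIM('a)"
    using s by (simp add: power_divide field_simps)
  show "integrable lborel (\<lambda>x::'a. exp (- (norm (s *\<^sub>R x))\<^sup>2 / 2))"
    \<comment> \<open>A non-integrable function has integral 0 by convention, whereas the value just
      computed is positive.\<close>
    by (rule ccontr) (use eq s in \<open>simp add: not_integrable_integral_eq\<close>)
qed

lemma
  assumes s: "s > 0"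
  shows integrable_gk: "integrable lborel (gk s :: 'a::euclidean_space \<Rightarrow> real)"
    and integral_gk: "(LINT u|lborel. gk s (u::'a)) = 1"
proof -
  have p: "2 * pi / s > 0" using s by simp
  show "integrable lborel (gk s :: 'a \<Rightarrow> real)"
    unfolding gk_def by (intro integrable_mult_right integrable_gaussian_scaled[OF p])
  have "(LINT u|lborel. gk s (u::'a)) = (sqrt (2 * pi) / s) ^ DIM('a) * (sqrt (2 * pi) / (2 * pi / s)) ^ DIM('a)"
    unfolding gk_def integral_mult_right_zero integral_gaussian_scaled[OF p] ..
  also have "\<dots> = ((sqrt (2 * pi) / s) * (sqrt (2 * pi) / (2 * pi / s))) ^ DIM('a)"
    by (rule power_mult_distrib[symmetric])
  also have "(sqrt (2 * pi) / s) * (sqrt (2 * pi) / (2 * pi / s)) = 1" using s by simp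
  finally show "(LINT u|lborel. gk s (u::'a)) = 1" by simp
qed

lemma gk_fourier:
  fixes u :: "'a::euclidean_space"
  assumes s: "s > 0"
  shows "(LINT x|lborel. of_real (exp (- (norm (s *\<^sub>R x))\<^sup>2 / 2)) * cis (- (2 * pi * (x \<bullet> u)))) = of_real (gk s u)"
proof -
  define v where "v = - (2 * pi / s) *\<^sub>R u"
  have "of_real (sqrt (2 * pi) ^ DIM('a) * exp (- (norm v)\<^sup>2 / 2))
    = s ^ DIM('a) *\<^sub>R (LINT x|lborel. complex_of_real (exp (- (norm (s *\<^sub>R x))\<^sup>2 / 2)) * cis ((s *\<^sub>R x) \<bullet> v))"
    unfolding integral_gaussian_cis[symmetric] by (subst integral_lborel_scale[OF _ s]) auto
  moreover have "(s *\<^sub>R x) \<bullet> v = - (2 * pi * (x \<bullet> u))" for x using s by (simp add: v_def)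
  ultimately have "s ^ DIM('a) *\<^sub>R (LINT x|lborel. complex_of_real (exp (- (norm (s *\<^sub>R x))\<^sup>2 / 2)) * cis (- (2 * pi * (x \<bullet> u))))
     = of_real (sqrt (2 * pi) ^ DIM('a) * exp (- (norm v)\<^sup>2 / 2))" (is "_ *\<^sub>R ?I = _") by simp
  then have "?I = of_real (sqrt (2 * pi) ^ DIM('a) * exp (- (norm v)\<^sup>2 / 2)) / of_real (s ^ DIM('a))"
    using s by (simp add: scaleR_conv_of_real field_simps)
  also have "\<dots> = of_real (gk s u)" by (simp add: gk_def v_def power_divide)
  finally show ?thesis .
qed

text \<open>Since \<open>F\<close> and \<open>H\<close> are only integrable, their transforms need
  not be square-integrable. The Gaussian factor restores absolute convergence at the price of a
  convolution with \<open>gk s\<close>. The multiplication formula takes the transform off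
  \<open>F\<close> and then off \<open>H\<close>, so that in the end it falls on the
  Gaussian.\<close>

lemma regularised_parseval:
  fixes F H :: "'a::euclidean_space \<Rightarrow> complex"
  assumes F: "integrable lborel F" and H: "integrable lborel H" and s: "s > 0"
  shows "(LINT x|lborel. ft F x * cnj (ft H x) * of_real (exp (- (norm (s *\<^sub>R x))\<^sup>2 / 2)))
    = (LINT t|lborel. F t * (LINT r|lborel. cnj (H r) * of_real (gk s (t - r))))"
proof -
  have [measurable]: "F \<in> borel_measurable borel" "H \<in> borel_measurable borel" using F H by auto
  have ftm[measurable]: "ft H \<in> borel_measurable borel" by (rule ft_measurable) measurable
  define m where "m = (\<lambda>x::'a. exp (- (norm (s *\<^sub>R x))\<^sup>2 / 2))"
  have m: "integrable lborel m" unfolding m_def by (rule integrable_gaussian_scaled[OF s])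
  then have [measurable]: "m \<in> borel_measurable borel" by auto
  define a where "a = (\<lambda>x. cnj (ft H x) * of_real (m x))"
  have a: "integrable lborel a"
  proof (rule Bochner_Integration.integrable_bound)
    show "integrable lborel (\<lambda>x. (LINT t|lborel. norm (H t)) * m x)" using m by simp
    show "AE x in lborel. norm (a x) \<le> norm ((LINT t|lborel. norm (H t)) * m x)"
      by (auto simp: a_def norm_mult abs_mult intro!: mult_right_mono order_trans[OF norm_ft_le])
  qed (simp add: a_def)
  have "(LINT x|lborel. ft F x * cnj (ft H x) * of_real (m x)) =
    (LINT x|lborel. a x * (LINT t|lborel. F t * cis (- (2 * pi * (x \<bullet> t)))))"
    by (simp add: a_def ft_def[of F] mult_ac)
  also have "\<dots> = (LINT t|lborel. F t * (LINT x|lborel. a x * cis (- (2 * pi * (x \<bullet> t)))))"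
    by (rule multiplication_formula[OF a F]) auto
  finally have *: "(LINT x|lborel. ft F x * cnj (ft H x) * of_real (m x)) =
    (LINT t|lborel. F t * (LINT x|lborel. a x * cis (- (2 * pi * (x \<bullet> t)))))" .
  have "(LINT x|lborel. a x * cis (- (2 * pi * (x \<bullet> t)))) = (LINT r|lborel. cnj (H r) * of_real (gk s (t - r)))" for t
  proof -
    define b where "b = (\<lambda>x. of_real (m x) * cis (- (2 * pi * (x \<bullet> t))))"
    have b: "integrable lborel b"
      by (rule Bochner_Integration.integrable_bound[OF m]) (auto simp: b_def norm_mult)
    have cH: "integrable lborel (\<lambda>r. cnj (H r))" using H by simp
    have "cnj (ft H x) = (LINT r|lborel. cnj (H r) * cis (2 * pi * (x \<bullet> r)))" for x
      unfolding ft_def by (subst Bochner_Integration.integral_cnj[symmetric]) (simp add: cis_cnj)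
    then have "(LINT x|lborel. a x * cis (- (2 * pi * (x \<bullet> t)))) =
       (LINT x|lborel. b x * (LINT r|lborel. cnj (H r) * cis (2 * pi * (x \<bullet> r))))"
      by (simp add: a_def b_def mult_ac)
    also have "\<dots> = (LINT r|lborel. cnj (H r) * (LINT x|lborel. b x * cis (2 * pi * (x \<bullet> r))))"
      by (rule multiplication_formula[OF b cH]) auto
    finally have *: "(LINT x|lborel. a x * cis (- (2 * pi * (x \<bullet> t)))) =
      (LINT r|lborel. cnj (H r) * (LINT x|lborel. b x * cis (2 * pi * (x \<bullet> r))))" .
    have "(LINT x|lborel. b x * cis (2 * pi * (x \<bullet> r))) = of_real (gk s (t - r))" for r
      unfolding gk_fourier[OF s, symmetric] b_def m_def
      by (intro Bochner_Integration.integral_cong) (auto simp: mult.assoc cis_mult algebra_simps)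
    then show ?thesis unfolding * by simp
  qed
  then show ?thesis unfolding *[unfolded m_def] by simp
qed

section \<open>Moyal's inequality\<close>

lemma ip_tf_shift_eq_ft: "ip f (tf_shift (x, \<xi>) c) = ft (\<lambda>t. f t * cnj (c (t - x))) \<xi>"
  unfolding ip_def ft_def tf_shift_chi by (simp add: chi_cis cis_cnj mult_ac)

lemma stft_measurable:
  assumes "f \<in> L2b" "c \<in> L2b"
  shows "(\<lambda>z. ip f (tf_shift z c)) \<in> borel_measurable borel"
proof -
  have [measurable]: "f \<in> borel_measurable borel" "c \<in> borel_measurable borel"
    using assms by (auto intro: L2b_measurable)
  have "(\<lambda>(x, \<xi>). ft (\<lambda>t. f t * cnj (c (t - x))) \<xi>) \<in> borel_measurable (borel \<Otimes>\<^sub>M borel)"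
    by (rule ft_measurable_param) measurable
  then have "(\<lambda>z. case z of (x, \<xi>) \<Rightarrow> ip f (tf_shift (x, \<xi>) c)) \<in> borel_measurable borel"
    unfolding ip_tf_shift_eq_ft borel_prod .
  then show ?thesis by (simp add: case_prod_beta')
qed

lemma L2b_translate: "f \<in> L2b \<Longrightarrow> (\<lambda>t. f (t - u)) \<in> L2b"
  using L2b_tf_shift[of f "(u, 0)"] by (simp add: tf_shift_translation)

text \<open>If \<open>F\<close> is not integrable, its integral is 0 by convention. Iterated
  integrals can thus be bounded slice by slice.\<close>

lemma ennreal_norm_integral_le: "ennreal (norm (LINT x|M. F x)) \<le> (\<integral>\<^sup>+ x. ennreal (norm (F x)) \<partial>M)"
  by (cases "integrable M F") (simp_all add: integral_norm_bound_ennreal not_integrable_integral_eq)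

context
  fixes f1 f2 c1 c2 :: "'d::finite signal"
  assumes L2: "f1 \<in> L2b" "f2 \<in> L2b" "c1 \<in> L2b" "c2 \<in> L2b"
begin

text \<open>With \<open>p = (t, x)\<close> this is \<open>F t * cnj (H (t - u))\<close> for the
  products \<open>F t = f1 t * cnj (c1 (t - x))\<close> and
  \<open>H t = f2 t * cnj (c2 (t - x))\<close>: the integrand on the right of
  \<open>regularised_parseval\<close> after the substitution \<open>r = t - u\<close>, without the
  kernel.\<close>

private definition W :: "real ^ 'd \<Rightarrow> 'd phase_space \<Rightarrow> complex" where
  "W u p = f1 (fst p) * cnj (c1 (fst p - snd p)) * cnj (f2 (fst p - u)) * c2 (fst p - u - snd p)"

private lemma meas[measurable]:
  "f1 \<in> borel_measurable borel" "f2 \<in> borel_measurable borel"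
  "c1 \<in> borel_measurable borel" "c2 \<in> borel_measurable borel"
  using L2 by (auto intro: L2b_measurable)

private lemma W_meas: "(\<lambda>(u, p). W u p) \<in> borel_measurable (borel \<Otimes>\<^sub>M borel)"
  unfolding W_def borel_prod[symmetric] by measurable

private lemma W_meas1: "W u \<in> borel_measurable borel"
  unfolding W_def[abs_def] borel_prod[symmetric] by measurable

text \<open>Pairing \<open>f1\<close> with \<open>f2\<close> and \<open>c1\<close> with
  \<open>c2\<close>, the inequality between geometric and arithmetic means separates the variables
  into \<open>A t * B (t - x)\<close>. The bound does not depend on \<open>u\<close>, so
  \<open>gk s u * W u p\<close> is jointly integrable because \<open>gk s\<close> has integral
  1.\<close>

private lemma W_bound:
  "(\<integral>\<^sup>+ p. ennreal (cmod (W u p)) \<partial>lborel) \<le> ennreal ((nsq f1 + nsq f2) / 2 * ((nsq c1 + nsq c2) / 2))"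
proof -
  define A where "A = (\<lambda>t. ((cmod (f1 t))\<^sup>2 + (cmod (f2 (t - u)))\<^sup>2) / 2)"
  define B where "B = (\<lambda>t. ((cmod (c1 t))\<^sup>2 + (cmod (c2 (t - u)))\<^sup>2) / 2)"
  have [measurable]: "A \<in> borel_measurable borel" "B \<in> borel_measurable borel"
    unfolding A_def B_def by measurable
  have pos: "A t \<ge> 0" "B t \<ge> 0" for t by (auto simp: A_def B_def)
  have i: "(\<integral>\<^sup>+ t. ennreal (((cmod (f t))\<^sup>2 + (cmod (h (t - u)))\<^sup>2) / 2) \<partial>lborel) = ennreal ((nsq f + nsq h) / 2)"
    if "f \<in> L2b" "h \<in> L2b" for f h :: "'d signal"
  proof -
    have "integrable lborel (\<lambda>t. ((cmod (f t))\<^sup>2 + (cmod (h (t - u)))\<^sup>2) / 2)"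
      using that L2b_translate[of h u] by (auto intro!: L2b_integrable)
    moreover have "(LINT t|lborel. ((cmod (f t))\<^sup>2 + (cmod (h (t - u)))\<^sup>2) / 2) = (nsq f + nsq h) / 2"
      using that L2b_integrable[OF L2b_translate[of h u]] nsq_tf_shift[of h "(u, 0)"]
      by (simp add: Bochner_Integration.integral_add[OF L2b_integrable L2b_integrable] nsq_def tf_shift_translation L2b_integrable)
    ultimately show ?thesis by (subst nn_integral_eq_integral) auto
  qed
  have iA: "(\<integral>\<^sup>+ t. ennreal (A t) \<partial>lborel) = ennreal ((nsq f1 + nsq f2) / 2)" unfolding A_def by (intro i L2)
  have iB: "(\<integral>\<^sup>+ x. ennreal (B (t - x)) \<partial>lborel) = ennreal ((nsq c1 + nsq c2) / 2)" for t
    using i[OF L2(3,4)] nn_integral_lborel_reflect[of "\<lambda>x. ennreal (B x)" t] by (simp add: B_def)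
  have amgm: "x * y \<le> (x\<^sup>2 + y\<^sup>2) / 2" for x y :: real using sum_squares_bound[of x y] by simp
  have "cmod (W u (t, x)) \<le> A t * B (t - x)" for t x
  proof -
    have "cmod (W u (t, x)) = (cmod (f1 t) * cmod (f2 (t - u))) * (cmod (c1 (t - x)) * cmod (c2 (t - x - u)))"
      by (simp add: W_def norm_mult algebra_simps)
    also have "\<dots> \<le> A t * B (t - x)" unfolding A_def B_def by (intro mult_mono amgm) auto
    finally show ?thesis .
  qed
  then have le: "ennreal (cmod (W u (t, x))) \<le> ennreal (A t) * ennreal (B (t - x))" for t x
    using pos by (simp add: ennreal_mult[symmetric] ennreal_leI)
  have "(\<integral>\<^sup>+ p. ennreal (cmod (W u p)) \<partial>lborel) = (\<integral>\<^sup>+ p. ennreal (cmod (W u p)) \<partial>(lborel \<Otimes>\<^sub>M lborel))"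
    by (simp add: lborel_prod)
  also have "\<dots> = (\<integral>\<^sup>+ t. \<integral>\<^sup>+ x. ennreal (cmod (W u (t, x))) \<partial>lborel \<partial>lborel)"
    using W_meas1 by (subst lborel.nn_integral_fst[symmetric]) (auto simp: lborel_prod)
  also have "\<dots> \<le> (\<integral>\<^sup>+ t. \<integral>\<^sup>+ x. ennreal (A t) * ennreal (B (t - x)) \<partial>lborel \<partial>lborel)"
    by (intro nn_integral_mono le)
  also have "\<dots> = (\<integral>\<^sup>+ t. ennreal (A t) * ennreal ((nsq c1 + nsq c2) / 2) \<partial>lborel)"
    by (simp add: nn_integral_cmult iB)
  also have "\<dots> = ennreal ((nsq f1 + nsq f2) / 2) * ennreal ((nsq c1 + nsq c2) / 2)"
    by (simp add: nn_integral_multc iA)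
  also have "\<dots> = ennreal ((nsq f1 + nsq f2) / 2 * ((nsq c1 + nsq c2) / 2))"
    by (rule ennreal_mult[symmetric]) (simp_all add: add_nonneg_nonneg)
  finally show ?thesis .
qed

private lemma W_integrable: "integrable lborel (W u)"
  using W_meas1[of u] W_bound[of u] by (intro integrableI_bounded) (auto intro: le_less_trans)

private lemma W_integral: "(LINT p|lborel. W u p) = ip f1 (tf_shift (u, 0) f2) * cnj (ip c1 (tf_shift (u, 0) c2))"
proof -
  have "(LINT p|lborel. W u p) = (LINT p|(lborel \<Otimes>\<^sub>M lborel). W u p)" by (simp add: lborel_prod)
  also have "\<dots> = (LINT t|lborel. LINT x|lborel. W u (t, x))"
    using W_integrable[of u] by (subst lborel_pair.integral_fst') (auto simp: lborel_prod)
  also have "\<dots> = (LINT t|lborel. f1 t * cnj (f2 (t - u)) * cnj (ip c1 (tf_shift (u, 0) c2)))"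
  proof (rule Bochner_Integration.integral_cong[OF refl])
    fix t
    define G where "G = (\<lambda>y. cnj (c1 y) * c2 (y - u))"
    have [measurable]: "G \<in> borel_measurable borel" unfolding G_def by measurable
    have "(LINT x|lborel. W u (t, x)) = (LINT x|lborel. f1 t * cnj (f2 (t - u)) * G (t - x))"
      by (intro Bochner_Integration.integral_cong) (auto simp: W_def G_def algebra_simps)
    also have "\<dots> = f1 t * cnj (f2 (t - u)) * (LINT x|lborel. G (t - x))" by simp
    also have "(LINT x|lborel. G (t - x)) = (LINT y|lborel. G y)" by (rule integral_lborel_reflect) measurable
    also have "\<dots> = cnj (ip c1 (tf_shift (u, 0) c2))"
      unfolding ip_def by (subst Bochner_Integration.integral_cnj[symmetric]) (simp add: G_def tf_shift_translation)
    finally show "(LINT x|lborel. W u (t, x)) = f1 t * cnj (f2 (t - u)) * cnj (ip c1 (tf_shift (u, 0) c2))" .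
  qed
  also have "\<dots> = ip f1 (tf_shift (u, 0) f2) * cnj (ip c1 (tf_shift (u, 0) c2))"
    by (simp add: ip_def tf_shift_translation)
  finally show ?thesis .
qed

text \<open>For fixed \<open>x\<close> the inner integral is an instance of
  \<open>regularised_parseval\<close>, because a product of two square-integrable functions is
  integrable. Fubini's theorem then moves the integral over \<open>u\<close> outside, where
  \<open>W_integral\<close> evaluates the rest. Only the frequency variable needs the
  Gaussian.\<close>

lemma regularised_moyal:
  assumes s: "s > 0"
  shows "(LINT x|lborel. LINT \<xi>|lborel. ip f1 (tf_shift (x, \<xi>) c1) * cnj (ip f2 (tf_shift (x, \<xi>) c2))
              * of_real (exp (- (norm (s *\<^sub>R \<xi>))\<^sup>2 / 2)))
    = (LINT u|lborel. of_real (gk s u) * (ip f1 (tf_shift (u, 0) f2) * cnj (ip c1 (tf_shift (u, 0) c2))))"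
proof -
  define T where "T = (\<lambda>u p. of_real (gk s u) * W u p)"
  have T_meas: "(\<lambda>(u, p). T u p) \<in> borel_measurable (borel \<Otimes>\<^sub>M borel)"
    unfolding T_def using W_meas by measurable
  have int: "integrable (lborel \<Otimes>\<^sub>M lborel) (\<lambda>(u, p). T u p)"
  proof (rule integrableI_bounded)
    show "(\<lambda>(u, p). T u p) \<in> borel_measurable (lborel \<Otimes>\<^sub>M lborel)" using T_meas by simp
    let ?C = "(nsq f1 + nsq f2) / 2 * ((nsq c1 + nsq c2) / 2)"
    have "(\<integral>\<^sup>+ z. ennreal (cmod (case z of (u, p) \<Rightarrow> T u p)) \<partial>(lborel \<Otimes>\<^sub>M lborel))
      = (\<integral>\<^sup>+ u. \<integral>\<^sup>+ p. ennreal (cmod (T u p)) \<partial>lborel \<partial>lborel)"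
      using T_meas by (subst lborel.nn_integral_fst[symmetric]) auto
    also have "\<dots> = (\<integral>\<^sup>+ u. ennreal (gk s u) * (\<integral>\<^sup>+ p. ennreal (cmod (W u p)) \<partial>lborel) \<partial>lborel)"
      using W_meas1 less_imp_le[OF gk_pos[OF s, where 'a="real^'d"]]
      by (subst nn_integral_cmult[symmetric]) (auto simp: T_def norm_mult ennreal_mult abs_of_nonneg)
    also have "\<dots> \<le> (\<integral>\<^sup>+ u. ennreal (gk s (u::real^'d)) * ennreal ?C \<partial>lborel)"
      by (intro nn_integral_mono mult_left_mono W_bound) auto
    also have "\<dots> = (\<integral>\<^sup>+ u. ennreal (gk s (u::real^'d)) \<partial>lborel) * ennreal ?C" by (rule nn_integral_multc) measurable
    also have "(\<integral>\<^sup>+ u. ennreal (gk s (u::real^'d)) \<partial>lborel) = ennreal 1"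
      using integrable_gk[OF s, where 'a="real^'d"] integral_gk[OF s, where 'a="real^'d"]
      by (subst nn_integral_eq_integral) (auto intro!: less_imp_le gk_pos[OF s])
    also have "ennreal 1 * ennreal ?C < \<infinity>" by (simp add: ennreal_mult_less_top)
    finally show "(\<integral>\<^sup>+ z. ennreal (norm (case z of (u, p) \<Rightarrow> T u p)) \<partial>(lborel \<Otimes>\<^sub>M lborel)) < \<infinity>" .
  qed
  have slice: "(LINT \<xi>|lborel. ip f1 (tf_shift (x, \<xi>) c1) * cnj (ip f2 (tf_shift (x, \<xi>) c2))
              * of_real (exp (- (norm (s *\<^sub>R \<xi>))\<^sup>2 / 2))) = (LINT t|lborel. LINT u|lborel. T u (t, x))" for x
  proof -
    define F where "F = (\<lambda>t. f1 t * cnj (c1 (t - x)))"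
    define H where "H = (\<lambda>t. f2 t * cnj (c2 (t - x)))"
    have [measurable]: "F \<in> borel_measurable borel" "H \<in> borel_measurable borel"
      unfolding F_def H_def by measurable
    have "integrable lborel F" "integrable lborel H"
      unfolding F_def H_def by (intro L2b_integrable_prod L2 L2b_translate)+
    note regularised_parseval[OF this s]
    moreover have "F t * (LINT r|lborel. cnj (H r) * of_real (gk s (t - r))) = (LINT u|lborel. T u (t, x))" for t
    proof -
      define K where "K = (\<lambda>r. cnj (H r) * of_real (gk s (t - r)) :: complex)"
      have [measurable]: "K \<in> borel_measurable borel" unfolding K_def by measurable
      have "(LINT r|lborel. K r) = (LINT u|lborel. K (t - u))"
        by (rule integral_lborel_reflect[symmetric]) measurable
      also have "F t * \<dots> = (LINT u|lborel. F t * K (t - u))" by simp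
      also have "\<dots> = (LINT u|lborel. T u (t, x))"
        by (intro Bochner_Integration.integral_cong) (auto simp: T_def W_def F_def K_def H_def mult_ac)
      finally show ?thesis by (simp add: K_def)
    qed
    ultimately show ?thesis unfolding ip_tf_shift_eq_ft F_def[symmetric] H_def[symmetric] by simp
  qed
  have int2: "integrable lborel (\<lambda>p. LINT u|lborel. T u p)"
    using lborel_pair.integrable_snd[OF int] by simp
  have uncurry: "(\<lambda>(t, x). LINT u|lborel. T u (t, x)) = (\<lambda>p. LINT u|lborel. T u p)" by auto
  have "(LINT x|lborel. LINT t|lborel. LINT u|lborel. T u (t, x)) = (LINT p|lborel. LINT u|lborel. T u p)"
    using lborel_pair.integral_snd[of "\<lambda>t x. LINT u|lborel. T u (t, x)"] int2
    by (simp add: lborel_prod uncurry)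
  also have "\<dots> = (LINT u|lborel. LINT p|lborel. T u p)"
    by (rule lborel_pair.Fubini_integral[OF int])
  also have "\<dots> = (LINT u|lborel. of_real (gk s u) * (ip f1 (tf_shift (u, 0) f2) * cnj (ip c1 (tf_shift (u, 0) c2))))"
    by (simp add: T_def W_integral)
  finally show ?thesis unfolding slice .
qed

end

theorem moyal_inequality:
  fixes f1 f2 c1 c2 :: "'d::finite signal"
  assumes L2: "f1 \<in> L2b" "f2 \<in> L2b" "c1 \<in> L2b" "c2 \<in> L2b"
  shows "ennreal (cmod (ip f1 f2) * cmod (ip c1 c2))
    \<le> (\<integral>\<^sup>+ z. ennreal (cmod (ip f1 (tf_shift z c1)) * cmod (ip f2 (tf_shift z c2))) \<partial>lborel)"
    (is "_ \<le> ?R")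
proof -
  define Psi where "Psi = (\<lambda>u. ip f1 (tf_shift (u, 0) f2) * cnj (ip c1 (tf_shift (u, 0) c2)))"
  define V where "V = (\<lambda>z. ip f1 (tf_shift z c1) * cnj (ip f2 (tf_shift z c2)))"
  have [measurable]: "V \<in> borel_measurable borel"
    unfolding V_def using stft_measurable[OF L2(1,3)] stft_measurable[OF L2(2,4)] by measurable
  have "(\<lambda>u. ip f (tf_shift (u, 0) h)) \<in> borel_measurable borel" if "f \<in> L2b" "h \<in> L2b" for f h :: "'d signal"
    using measurable_compose[OF _ stft_measurable[OF that], of "\<lambda>u. (u, 0)" borel]
    by (simp add: borel_prod[symmetric])
  from this[OF L2(1,2)] this[OF L2(3,4)] have Psi_meas[measurable]: "Psi \<in> borel_measurable borel"
    unfolding Psi_def by measurable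
  define C where "C = (sqrt (nsq f1) * sqrt (nsq f2)) * (sqrt (nsq c1) * sqrt (nsq c2))"
  have Psi_bd: "cmod (Psi u) \<le> C" for u
  proof -
    have "cmod (ip f (tf_shift (u, 0) h)) \<le> sqrt (nsq f) * sqrt (nsq h)" if "f \<in> L2b" "h \<in> L2b" for f h :: "'d signal"
      using ip_Cauchy_Schwarz[OF that(1) L2b_tf_shift[OF that(2)]] that by simp
    from this[OF L2(1,2)] this[OF L2(3,4)] show ?thesis
      unfolding Psi_def C_def norm_mult complex_mod_cnj by (intro mult_mono) auto
  qed
  have bound: "ennreal (cmod (LINT u|lborel. of_real (gk s u) * Psi u)) \<le> ?R" if s: "s > 0" for s
  proof -
    define m where "m = (\<lambda>x::real^'d. exp (- (norm (s *\<^sub>R x))\<^sup>2 / 2))"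
    have m1: "m x \<le> 1" "m x \<ge> 0" for x by (auto simp: m_def)
    have "(LINT u|lborel. of_real (gk s u) * Psi u) = (LINT x|lborel. LINT \<xi>|lborel. V (x, \<xi>) * of_real (m \<xi>))"
      using regularised_moyal[OF L2 s] by (simp add: Psi_def V_def m_def)
    then have "ennreal (cmod (LINT u|lborel. of_real (gk s u) * Psi u))
       \<le> (\<integral>\<^sup>+ x. ennreal (cmod (LINT \<xi>|lborel. V (x, \<xi>) * of_real (m \<xi>))) \<partial>lborel)"
      by (simp only: ennreal_norm_integral_le)
    also have "\<dots> \<le> (\<integral>\<^sup>+ x. \<integral>\<^sup>+ \<xi>. ennreal (cmod (V (x, \<xi>) * of_real (m \<xi>))) \<partial>lborel \<partial>lborel)"
      by (intro nn_integral_mono ennreal_norm_integral_le)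
    also have "\<dots> \<le> (\<integral>\<^sup>+ x. \<integral>\<^sup>+ \<xi>. ennreal (cmod (V (x, \<xi>))) \<partial>lborel \<partial>lborel)"
      using m1 by (intro nn_integral_mono ennreal_leI) (simp add: norm_mult mult_left_le)
    also have "\<dots> = (\<integral>\<^sup>+ z. ennreal (cmod (V z)) \<partial>(lborel \<Otimes>\<^sub>M lborel))"
      by (subst lborel.nn_integral_fst[symmetric]) (auto simp: lborel_prod)
    also have "\<dots> = ?R" by (simp add: lborel_prod V_def norm_mult)
    finally show ?thesis .
  qed
  define S where "S = (\<lambda>n::nat. 1 / (real n + 1))"
  have S: "S n > 0" for n by (simp add: S_def)
  have S0: "S \<longlonglongrightarrow> 0" using LIMSEQ_inverse_real_of_nat by (simp add: S_def inverse_eq_divide add.commute)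
  \<comment> \<open>The substitution \<open>u = s *\<^sub>R v\<close> moves the parameter from the
    kernel into \<open>Psi\<close>, so that the integrands have a common majorant.\<close>
  have rescale: "(LINT u|lborel. of_real (gk s u) * Psi u) = (LINT v|lborel. of_real (gk 1 v) * Psi (s *\<^sub>R v))" if s: "s > 0" for s
  proof -
    have k: "s ^ DIM(real^'d) * gk s (s *\<^sub>R v) = gk 1 v" for v :: "real^'d"
      using s by (simp add: gk_def power_divide del: DIM_cart)
    have "(LINT u|lborel. of_real (gk s u) * Psi u) = (s ^ DIM(real^'d)) *\<^sub>R (LINT v|lborel. of_real (gk s (s *\<^sub>R v)) * Psi (s *\<^sub>R v))"
      by (rule integral_lborel_scale[OF _ s]) measurable
    also have "\<dots> = (LINT v|lborel. of_real (s ^ DIM(real^'d) * gk s (s *\<^sub>R v)) * Psi (s *\<^sub>R v))"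
      unfolding integral_scaleR_right[symmetric] by (simp add: scaleR_conv_of_real mult.assoc)
    finally show ?thesis unfolding k .
  qed
  have "(\<lambda>n. LINT v|lborel. of_real (gk 1 v) * Psi (S n *\<^sub>R v)) \<longlonglongrightarrow> (LINT v|lborel. of_real (gk 1 (v::real^'d)) * Psi 0)"
  proof (rule integral_dominated_convergence[where w="\<lambda>v::real^'d. gk 1 v * C"])
    show "integrable lborel (\<lambda>v::real^'d. gk 1 v * C)" by (intro integrable_mult_left integrable_gk) auto
    have "(Psi \<longlongrightarrow> Psi 0) (at 0)"
      unfolding Psi_def using L2 ip_translation_tendsto[of f1 f2] ip_translation_tendsto[of c1 c2]
      by (auto intro!: tendsto_intros simp: tf_shift_0[unfolded zero_prod_def])
    then have "isCont Psi 0" by (simp add: isCont_def)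
    moreover have "(\<lambda>n. S n *\<^sub>R v) \<longlonglongrightarrow> 0" for v :: "real^'d" using tendsto_scaleR[OF S0 tendsto_const, of v] by simp
    ultimately show "AE v in lborel. (\<lambda>n. of_real (gk 1 v) * Psi (S n *\<^sub>R v)) \<longlonglongrightarrow> of_real (gk 1 v) * Psi 0"
      by (intro always_eventually allI tendsto_intros) (rule isCont_tendsto_compose)
    show "AE v in lborel. norm (of_real (gk 1 v) * Psi (S n *\<^sub>R v)) \<le> gk 1 v * C" for n
      using gk_pos[of 1, where 'a="real^'d"] Psi_bd by (auto simp: norm_mult abs_of_pos intro!: mult_left_mono less_imp_le)
  qed measurable
  moreover have "(LINT v|lborel. of_real (gk 1 (v::real^'d)) * Psi 0) = Psi 0"
    using integral_gk[of 1, where 'a="real^'d"] by (simp add: integral_complex_of_real)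
  ultimately have "(\<lambda>n. LINT u|lborel. of_real (gk (S n) u) * Psi u) \<longlonglongrightarrow> Psi 0"
    by (simp only: rescale[OF S])
  then have "(\<lambda>n. ennreal (cmod (LINT u|lborel. of_real (gk (S n) u) * Psi u))) \<longlonglongrightarrow> ennreal (cmod (Psi 0))"
    by (intro tendsto_ennrealI tendsto_norm)
  then have "ennreal (cmod (Psi 0)) \<le> ?R"
    by (rule LIMSEQ_le_const2) (use bound[OF S] in auto)
  moreover have "cmod (Psi 0) = cmod (ip f1 f2) * cmod (ip c1 c2)"
    by (simp add: Psi_def norm_mult tf_shift_0[unfolded zero_prod_def])
  ultimately show ?thesis by simp
qed

section \<open>Summability of the short-time Fourier transform over separated sets\<close>

text \<open>Relatively separated sets with an explicit count. Constants below depend on the set only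
  through \<open>N\<close>, and so serve \<open>\<Lambda>\<close> and its late deformations at
  once.\<close>

definition nsep :: "nat \<Rightarrow> 'a::metric_space set \<Rightarrow> bool" where
  "nsep N \<Gamma> \<longleftrightarrow> (\<forall>x. finite (\<Gamma> \<inter> ball x 1) \<and> card (\<Gamma> \<inter> ball x 1) \<le> N)"

lemma nsep_subset: "nsep N \<Gamma> \<Longrightarrow> \<Delta> \<subseteq> \<Gamma> \<Longrightarrow> nsep N \<Delta>"
  unfolding nsep_def
proof (intro allI conjI)
  fix x
  assume a: "\<forall>x. finite (\<Gamma> \<inter> ball x 1) \<and> card (\<Gamma> \<inter> ball x 1) \<le> N" and "\<Delta> \<subseteq> \<Gamma>"
  then have sub: "\<Delta> \<inter> ball x 1 \<subseteq> \<Gamma> \<inter> ball x 1" by auto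
  then show "finite (\<Delta> \<inter> ball x 1)" using a finite_subset by blast
  show "card (\<Delta> \<inter> ball x 1) \<le> N" using card_mono[OF _ sub] a order_trans by blast
qed

lemma nsep_isometric_image:
  assumes "nsep N \<Gamma>" and b: "\<And>x y. dist (f x) (f y) = dist x y" and "surj f"
  shows "nsep N (f ` \<Gamma>)"
  unfolding nsep_def
proof
  fix x
  obtain y where y: "x = f y" using \<open>surj f\<close> by (metis surjD)
  have "f ` \<Gamma> \<inter> ball x 1 = f ` (\<Gamma> \<inter> ball y 1)" by (auto simp: y b)
  moreover have "finite (\<Gamma> \<inter> ball y 1)" "card (\<Gamma> \<inter> ball y 1) \<le> N" using assms(1) by (auto simp: nsep_def)
  ultimately show "finite (f ` \<Gamma> \<inter> ball x 1) \<and> card (f ` \<Gamma> \<inter> ball x 1) \<le> N"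
    using card_image_le[of "\<Gamma> \<inter> ball y 1" f] by simp
qed

lemma nsep_translate:
  fixes \<Gamma> :: "'a::real_normed_vector set"
  assumes "nsep N \<Gamma>" shows "nsep N ((\<lambda>z. z - u) ` \<Gamma>)"
  by (rule nsep_isometric_image[OF assms]) (auto simp: dist_norm intro: surjI[of _ "\<lambda>z. z + u"])

lemma nsep_reflect:
  fixes \<Gamma> :: "'a::real_normed_vector set"
  assumes "nsep N \<Gamma>" shows "nsep N ((\<lambda>z. u - z) ` \<Gamma>)"
  by (rule nsep_isometric_image[OF assms]) (auto simp: dist_norm norm_minus_commute intro: surjI[of _ "\<lambda>z. u - z"])

text \<open>This plays the role of membership in the Wiener amalgam space \<open>W(L\<^sup>\<infinity>, \<ell>\<^sup>1)\<close>.\<close>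

definition wiener :: "('a::euclidean_space \<Rightarrow> real) \<Rightarrow> bool" where
  "wiener F \<longleftrightarrow> (\<forall>z. F z \<ge> 0) \<and>
     (\<forall>N. \<exists>C\<ge>0. \<forall>\<Gamma>. finite \<Gamma> \<longrightarrow> nsep N \<Gamma> \<longrightarrow> sum F \<Gamma> \<le> C) \<and>
     (\<forall>N. \<forall>e>0. \<exists>R>0. \<forall>\<Gamma>. finite \<Gamma> \<longrightarrow> nsep N \<Gamma> \<longrightarrow> (\<forall>z\<in>\<Gamma>. norm z > R) \<longrightarrow> sum F \<Gamma> \<le> e)"

lemma wiener_nonneg: "wiener F \<Longrightarrow> F z \<ge> 0"
  by (simp add: wiener_def)

lemma wiener_bound:
  assumes "wiener F" obtains C where "C \<ge> 0" "\<And>\<Gamma>. finite \<Gamma> \<Longrightarrow> nsep N \<Gamma> \<Longrightarrow> sum F \<Gamma> \<le> C"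
proof -
  have "\<exists>C\<ge>0. \<forall>\<Gamma>. finite \<Gamma> \<longrightarrow> nsep N \<Gamma> \<longrightarrow> sum F \<Gamma> \<le> C"
    using assms unfolding wiener_def by (elim conjE) (erule spec)
  then show ?thesis using that by blast
qed

lemma wiener_tail:
  assumes "wiener F" "e > 0"
  obtains R where "R > 0" "\<And>\<Gamma>. finite \<Gamma> \<Longrightarrow> nsep N \<Gamma> \<Longrightarrow> (\<And>z. z \<in> \<Gamma> \<Longrightarrow> norm z > R) \<Longrightarrow> sum F \<Gamma> \<le> e"
proof -
  have "\<forall>e>0. \<exists>R>0. \<forall>\<Gamma>. finite \<Gamma> \<longrightarrow> nsep N \<Gamma> \<longrightarrow> (\<forall>z\<in>\<Gamma>. norm z > R) \<longrightarrow> sum F \<Gamma> \<le> e"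
    using assms(1) unfolding wiener_def by (elim conjE) (erule spec)
  then obtain R where "R > 0" "\<forall>\<Gamma>. finite \<Gamma> \<longrightarrow> nsep N \<Gamma> \<longrightarrow> (\<forall>z\<in>\<Gamma>. norm z > R) \<longrightarrow> sum F \<Gamma> \<le> e"
    using assms(2) by blast
  then show ?thesis using that[of R] by simp
qed

lemma wiener_reflect:
  assumes F: "wiener F" shows "wiener (\<lambda>z. F (- z))"
  unfolding wiener_def
proof (intro conjI allI impI)
  have eq: "(\<Sum>z\<in>\<Gamma>. F (- z)) = sum F (uminus ` \<Gamma>)" for \<Gamma> :: "'a set"
    by (subst sum.reindex) (auto simp: inj_on_def)
  fix N
  have refl: "nsep N (uminus ` \<Gamma>)" if "nsep N \<Gamma>" for \<Gamma> :: "'a set"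
    using nsep_reflect[OF that, of 0] by simp
  obtain C where "C \<ge> 0" "\<And>\<Gamma>. finite \<Gamma> \<Longrightarrow> nsep N \<Gamma> \<Longrightarrow> sum F \<Gamma> \<le> C" using wiener_bound[OF F] by blast
  then show "\<exists>C\<ge>0. \<forall>\<Gamma>. finite \<Gamma> \<longrightarrow> nsep N \<Gamma> \<longrightarrow> (\<Sum>z\<in>\<Gamma>. F (- z)) \<le> C"
    unfolding eq by (intro exI[of _ C]) (auto intro: refl)
  fix e :: real assume "e > 0"
  obtain R where R: "R > 0" "\<And>\<Gamma>. finite \<Gamma> \<Longrightarrow> nsep N \<Gamma> \<Longrightarrow> (\<And>z. z \<in> \<Gamma> \<Longrightarrow> norm z > R) \<Longrightarrow> sum F \<Gamma> \<le> e"
    using wiener_tail[OF F \<open>e>0\<close>, where N=N] by blast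
  show "\<exists>R>0. \<forall>\<Gamma>. finite \<Gamma> \<longrightarrow> nsep N \<Gamma> \<longrightarrow> (\<forall>z\<in>\<Gamma>. norm z > R) \<longrightarrow> (\<Sum>z\<in>\<Gamma>. F (- z)) \<le> e"
  proof (intro exI[of _ R] conjI allI impI)
    fix \<Gamma> :: "'a set" assume "finite \<Gamma>" "nsep N \<Gamma>" "\<forall>z\<in>\<Gamma>. norm z > R"
    then show "(\<Sum>z\<in>\<Gamma>. F (- z)) \<le> e" unfolding eq using refl[of \<Gamma>] by (intro R(2)) auto
  qed (rule R(1))
qed (use wiener_nonneg[OF F] in auto)

lemma wiener_indicator_ball: "wiener (indicator (ball (0::'a::euclidean_space) 1))"
  unfolding wiener_def
proof (intro conjI allI impI)
  fix N
  have eq: "sum (indicator (ball (0::'a) 1)) \<Gamma> = real (card (\<Gamma> \<inter> ball 0 1))" if "finite \<Gamma>" for \<Gamma>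
    using that by (simp add: indicator_def of_bool_def sum.If_cases) (auto intro!: arg_cong[where f=card])
  show "\<exists>C\<ge>0. \<forall>\<Gamma>. finite \<Gamma> \<longrightarrow> nsep N \<Gamma> \<longrightarrow> sum (indicator (ball (0::'a) 1)) \<Gamma> \<le> (C::real)"
    by (intro exI[of _ "real N"]) (auto simp: eq nsep_def)
  fix e :: real assume "e > 0"
  show "\<exists>R>0. \<forall>\<Gamma>. finite \<Gamma> \<longrightarrow> nsep N \<Gamma> \<longrightarrow> (\<forall>z\<in>\<Gamma>. norm z > R) \<longrightarrow> sum (indicator (ball (0::'a) 1)) \<Gamma> \<le> e"
  proof (intro exI[of _ 1] conjI allI impI)
    fix \<Gamma> :: "'a set" assume "\<forall>z\<in>\<Gamma>. norm z > 1"
    then have "sum (indicator (ball (0::'a) 1)) \<Gamma> = (0::real)" by (intro sum.neutral) (auto simp: indicator_def)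
    then show "sum (indicator (ball (0::'a) 1)) \<Gamma> \<le> e" using \<open>e>0\<close> by simp
  qed simp
qed auto

lemma nn_integral_tail_small:
  fixes H :: "'a::euclidean_space \<Rightarrow> real"
  assumes H: "integrable lborel H" "\<And>z. H z \<ge> 0" and "e > 0"
  shows "\<exists>r>0. (\<integral>\<^sup>+ u. ennreal (H u) * indicator {u. norm u > r} u \<partial>lborel) \<le> ennreal e"
proof -
  have [measurable]: "H \<in> borel_measurable borel" using H by auto
  have "(\<lambda>n::nat. LINT u|lborel. H u * indicator {u. norm u > real n} u) \<longlonglongrightarrow> (LINT u|(lborel :: 'a measure). 0)"
  proof (rule integral_dominated_convergence[OF _ _ H(1)])
    show "AE u in lborel. (\<lambda>n. H u * indicator {u. norm u > real n} u) \<longlonglongrightarrow> 0"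
    proof (rule AE_I2)
      fix u :: 'a
      obtain k where k: "norm u \<le> real k" using real_arch_simple by blast
      have "\<forall>\<^sub>F n in sequentially. H u * indicator {u. norm u > real n} u = 0"
        using eventually_ge_at_top[of k]
      proof eventually_elim
        case (elim n)
        have "real k \<le> real n" using elim by simp
        then show ?case using k by auto
      qed
      then show "(\<lambda>n. H u * indicator {u. norm u > real n} u) \<longlonglongrightarrow> 0" by (rule tendsto_eventually)
    qed
  qed (auto simp: indicator_def H(2))
  then have "\<forall>\<^sub>F n in sequentially. (LINT u|lborel. H u * indicator {u. norm u > real n} u) < e"
    using \<open>e>0\<close> by (intro order_tendstoD) auto
  then have "\<forall>\<^sub>F n in sequentially. (LINT u|lborel. H u * indicator {u. norm u > real n} u) < e \<and> n > 0"
    using eventually_gt_at_top[of 0] by (rule eventually_conj)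
  then obtain n where n: "(LINT u|lborel. H u * indicator {u. norm u > real n} u) < e" "n > 0"
    using eventually_happens by force
  have "integrable lborel (\<lambda>u. H u * indicator {u. norm u > real n} u)"
    by (rule Bochner_Integration.integrable_bound[OF H(1)]) (auto simp: indicator_def)
  then have "(\<integral>\<^sup>+ u. ennreal (H u * indicator {u. norm u > real n} u) \<partial>lborel) = ennreal (LINT u|lborel. H u * indicator {u. norm u > real n} u)"
    by (rule nn_integral_eq_integral) (auto simp: H(2))
  also have "\<dots> \<le> ennreal e" using n by (intro ennreal_leI) auto
  also have "(\<lambda>u. ennreal (H u * indicator {u. norm u > real n} u)) = (\<lambda>u. ennreal (H u) * indicator {u. norm u > real n} u)"
    by (auto simp: indicator_def fun_eq_iff)
  finally show ?thesis using n(2) by (intro exI[of _ "real n"]) auto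
qed

text \<open>Summing the convolution over \<open>\<Gamma>\<close> produces sums of \<open>K\<close>
  over the translates of \<open>\<Gamma>\<close> by \<open>-u\<close>, which have the same count
  \<open>N\<close>. They are bounded uniformly in \<open>u\<close>. If \<open>\<Gamma>\<close> is
  far from 0, they are even small, except for large \<open>u\<close>, where \<open>H\<close> has
  little mass.\<close>

lemma wiener_convolution:
  fixes F H K :: "'a::euclidean_space \<Rightarrow> real"
  assumes K: "wiener K" "K \<in> borel_measurable borel"
    and H: "H \<in> borel_measurable borel" "\<And>z. H z \<ge> 0" "(\<integral>\<^sup>+ u. ennreal (H u) \<partial>lborel) < \<infinity>"
    and F: "\<And>z. F z \<ge> 0" and a: "a > 0"
    and le: "\<And>z. ennreal (F z * a) \<le> (\<integral>\<^sup>+ u. ennreal (H u * K (z - u)) \<partial>lborel)"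
  shows "wiener F"
proof -
  note [measurable] = K(2) H(1)
  have intH: "integrable lborel H" using H by (intro integrableI_bounded) auto
  define h where "h = (LINT u|lborel. H u)"
  have h: "h \<ge> 0" "(\<integral>\<^sup>+ u. ennreal (H u) \<partial>lborel) = ennreal h"
    using H intH by (auto simp: h_def nn_integral_eq_integral)
  \<comment> \<open>The constant \<open>c2\<close> bounds the sum of \<open>K\<close> over the
    translate for every \<open>u\<close>, up to an excess \<open>c1\<close> allowed for
    \<open>norm u > r\<close>, where \<open>H\<close> has mass at most \<open>t\<close>.\<close>
  have key: "a * sum F \<Gamma> \<le> c1 * t + c2 * h"
    if fin: "finite \<Gamma>" and nn: "c1 \<ge> 0" "c2 \<ge> 0" "t \<ge> 0" and t: "(\<integral>\<^sup>+ u. ennreal (H u) * indicator {u. norm u > r} u \<partial>lborel) \<le> ennreal t"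
      and S: "\<And>u. sum K ((\<lambda>z. z - u) ` \<Gamma>) \<le> c1 * indicator {u. norm u > r} u + c2" for \<Gamma> c1 c2 t r
  proof -
    have "ennreal (a * sum F \<Gamma>) = (\<Sum>z\<in>\<Gamma>. ennreal (F z * a))"
      using F a by (subst sum_ennreal) (auto simp: sum_distrib_left mult.commute)
    also have "\<dots> \<le> (\<Sum>z\<in>\<Gamma>. \<integral>\<^sup>+ u. ennreal (H u * K (z - u)) \<partial>lborel)" by (intro sum_mono le)
    also have "\<dots> = (\<integral>\<^sup>+ u. (\<Sum>z\<in>\<Gamma>. ennreal (H u * K (z - u))) \<partial>lborel)" by (rule nn_integral_sum[symmetric]) measurable
    also have "\<dots> \<le> (\<integral>\<^sup>+ u. ennreal c1 * (ennreal (H u) * indicator {u. norm u > r} u) + ennreal c2 * ennreal (H u) \<partial>lborel)"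
    proof (rule nn_integral_mono)
      fix u
      have "(\<Sum>z\<in>\<Gamma>. ennreal (H u * K (z - u))) = ennreal (H u * sum K ((\<lambda>z. z - u) ` \<Gamma>))"
        using H(2) wiener_nonneg[OF K(1)]
        by (subst sum_ennreal) (auto simp: sum.reindex inj_on_def sum_distrib_left)
      also have "\<dots> \<le> ennreal (H u * (c1 * indicator {u. norm u > r} u + c2))"
        by (intro ennreal_leI mult_left_mono S H)
      also have "\<dots> = ennreal c1 * (ennreal (H u) * indicator {u. norm u > r} u) + ennreal c2 * ennreal (H u)"
        using H(2) nn by (auto simp: indicator_def ennreal_mult[symmetric] ennreal_plus[symmetric] algebra_simps simp del: ennreal_plus)
      finally show "(\<Sum>z\<in>\<Gamma>. ennreal (H u * K (z - u))) \<le> \<dots>" .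
    qed
    also have "\<dots> = ennreal c1 * (\<integral>\<^sup>+ u. ennreal (H u) * indicator {u. norm u > r} u \<partial>lborel) + ennreal c2 * ennreal h"
      by (subst nn_integral_add) (auto simp: nn_integral_cmult h)
    also have "\<dots> \<le> ennreal c1 * ennreal t + ennreal c2 * ennreal h"
      by (intro add_right_mono mult_left_mono t) auto
    also have "\<dots> = ennreal (c1 * t + c2 * h)" using nn h by (simp add: ennreal_mult)
    finally show ?thesis using nn h by (subst (asm) ennreal_le_iff) auto
  qed
  show ?thesis unfolding wiener_def
  proof (intro conjI allI impI F)
    fix N
    obtain C where C: "C \<ge> 0" "\<And>\<Gamma>. finite \<Gamma> \<Longrightarrow> nsep N \<Gamma> \<Longrightarrow> sum K \<Gamma> \<le> C" using wiener_bound[OF K(1)] by blast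
    show "\<exists>C\<ge>0. \<forall>\<Gamma>. finite \<Gamma> \<longrightarrow> nsep N \<Gamma> \<longrightarrow> sum F \<Gamma> \<le> C"
    proof (intro exI[of _ "C * h / a"] conjI allI impI)
      fix \<Gamma> :: "'a set" assume G: "finite \<Gamma>" "nsep N \<Gamma>"
      \<comment> \<open>The uniform bound needs no splitting: \<open>c1 = 0\<close> and
        \<open>c2 = C\<close>.\<close>
      have "a * sum F \<Gamma> \<le> 0 * h + C * h"
      proof (rule key[where r=0])
        show "(\<integral>\<^sup>+ u. ennreal (H u) * indicator {u. norm u > 0} u \<partial>lborel) \<le> ennreal h"
          unfolding h(2)[symmetric] by (intro nn_integral_mono) (auto simp: indicator_def)
      qed (use G h C nsep_translate in auto)
      then show "sum F \<Gamma> \<le> C * h / a" using a by (simp add: field_simps)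
    qed (use C h a in auto)
    fix e :: real assume "e > 0"
    \<comment> \<open>Large shifts will contribute at most \<open>C * e1\<close> and the others at
      most \<open>e2 * h\<close>; both are at most \<open>a * e / 2\<close>.\<close>
    define e1 where "e1 = a * e / (2 * (C + 1))"
    define e2 where "e2 = a * e / (2 * (h + 1))"
    have e12: "e1 > 0" "e2 > 0" using \<open>e>0\<close> a C h by (auto simp: e1_def e2_def)
    obtain r where r: "r > 0" "(\<integral>\<^sup>+ u. ennreal (H u) * indicator {u. norm u > r} u \<partial>lborel) \<le> ennreal e1"
      using nn_integral_tail_small[OF intH H(2) e12(1)] by blast
    obtain R where R: "R > 0" "\<And>\<Gamma>. finite \<Gamma> \<Longrightarrow> nsep N \<Gamma> \<Longrightarrow> (\<And>z. z \<in> \<Gamma> \<Longrightarrow> norm z > R) \<Longrightarrow> sum K \<Gamma> \<le> e2"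
      using wiener_tail[OF K(1) e12(2), where N=N] by blast
    show "\<exists>R>0. \<forall>\<Gamma>. finite \<Gamma> \<longrightarrow> nsep N \<Gamma> \<longrightarrow> (\<forall>z\<in>\<Gamma>. norm z > R) \<longrightarrow> sum F \<Gamma> \<le> e"
    \<comment> \<open>A shift by \<open>u\<close> with \<open>norm u \<le> r\<close> leaves points
      of norm above \<open>R + r\<close> outside the ball of radius \<open>R\<close>.\<close>
    proof (intro exI[of _ "R + r"] conjI allI impI)
      fix \<Gamma> :: "'a set" assume G: "finite \<Gamma>" "nsep N \<Gamma>" "\<forall>z\<in>\<Gamma>. norm z > R + r"
      have "a * sum F \<Gamma> \<le> C * e1 + e2 * h"
      proof (rule key[OF G(1) _ _ _ r(2)])
        fix u
        show "sum K ((\<lambda>z. z - u) ` \<Gamma>) \<le> C * indicator {u. norm u > r} u + e2"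
        proof (cases "norm u > r")
          case True
          have "sum K ((\<lambda>z. z - u) ` \<Gamma>) \<le> C" using G by (intro C nsep_translate) auto
          then show ?thesis using True e12 by simp
        next
          case False
          have "norm (z - u) > R" if "z \<in> \<Gamma>" for z
          proof -
            have "norm z > R + r" using G(3) that by blast
            moreover have "norm z \<le> norm (z - u) + norm u" using norm_triangle_ineq[of "z - u" u] by simp
            ultimately show ?thesis using False by linarith
          qed
          then have "sum K ((\<lambda>z. z - u) ` \<Gamma>) \<le> e2" using G by (intro R nsep_translate) auto
          then show ?thesis using False by simp
        qed
      qed (use C e12 in auto)
      also have "\<dots> \<le> a * e / 2 + a * e / 2"
      proof (rule add_mono)
        have "a * e * C \<le> a * e * (C + 1)" using a \<open>e>0\<close> by (intro mult_left_mono) auto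
        then show "C * e1 \<le> a * e / 2" using C by (simp add: e1_def field_simps)
        have "a * e * h \<le> a * e * (h + 1)" using a \<open>e>0\<close> by (intro mult_left_mono) auto
        then show "e2 * h \<le> a * e / 2" using h by (simp add: e2_def field_simps)
      qed
      finally show "sum F \<Gamma> \<le> e" using a by simp
    qed (use R r in auto)
  qed
qed

section \<open>Amalgam bounds for the Gaussian window, then for a general window\<close>

lemma cmod_ip_tf_shift_compose:
  "cmod (ip f (tf_shift v (tf_shift w h))) = cmod (ip f (tf_shift (v + w) h))"
proof -
  have "tf_shift v (tf_shift w h) = (\<lambda>t. cis (- (2 * pi * (snd w \<bullet> fst v))) * tf_shift (v + w) h t)"
  proof
    fix t
    have "chi v t * chi w (t - fst v) = cis (- (2 * pi * (snd w \<bullet> fst v))) * chi (v + w) t"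
      by (simp add: chi_cis cis_mult) (simp add: algebra_simps inner_diff_left inner_diff_right inner_add_left)
    then show "tf_shift v (tf_shift w h) t = cis (- (2 * pi * (snd w \<bullet> fst v))) * tf_shift (v + w) h t"
      by (simp add: tf_shift_chi diff_diff_eq mult.assoc[symmetric])
  qed
  then show ?thesis by (simp add: ip_scale_right norm_mult)
qed

text \<open>The exponent is chosen so that the square is the Gaussian integrated in
  \<open>integral_gaussian\<close>.\<close>

definition gauss :: "'d::finite signal" where
  "gauss t = of_real (exp (- (norm t)\<^sup>2 / 4))"

lemma gauss_sq: "(cmod (gauss t))\<^sup>2 = exp (- (norm t)\<^sup>2 / 2)"
  by (simp add: gauss_def exp_double[symmetric])

lemma gauss_L2b: "(gauss :: 'd::finite signal) \<in> L2b"
proof -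
  have "(gauss :: 'd signal) \<in> borel_measurable borel" unfolding gauss_def[abs_def] by measurable
  then show ?thesis unfolding L2b_def mem_Collect_eq gauss_sq using integrable_gaussian by auto
qed

lemma nsq_gauss_pos: "nsq (gauss :: 'd::finite signal) > 0"
  unfolding nsq_def gauss_sq integral_gaussian by simp

text \<open>Completing the square about the midpoint of 0 and \<open>x\<close> leaves a Gaussian
  centred at \<open>(1/2) *\<^sub>R x\<close>, whose Fourier transform is known.\<close>

lemma stft_gauss:
  fixes x \<xi> :: "real ^ 'd::finite"
  shows "cmod (ip gauss (tf_shift (x, \<xi>) gauss)) = sqrt (2 * pi) ^ DIM(real^'d) * exp (- (norm x)\<^sup>2 / 8) * exp (- 2 * pi\<^sup>2 * (norm \<xi>)\<^sup>2)"
proof -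
  define v where "v = (- 2 * pi) *\<^sub>R \<xi>"
  define G where "G = (\<lambda>t. complex_of_real (exp (- (norm t)\<^sup>2 / 2)) * cis (t \<bullet> v))"
  have [measurable]: "G \<in> borel_measurable borel" unfolding G_def by measurable
  have "ip gauss (tf_shift (x, \<xi>) gauss) = (LINT t|lborel. (of_real (exp (- (norm x)\<^sup>2 / 8)) * cis (((1/2) *\<^sub>R x) \<bullet> v)) * G (t - (1/2) *\<^sub>R x))"
    unfolding ip_def
  proof (rule Bochner_Integration.integral_cong[OF refl])
    fix t
    have "- (norm t)\<^sup>2 / 4 + - (norm (t - x))\<^sup>2 / 4 = - (norm x)\<^sup>2 / 8 + - (norm (t - (1/2) *\<^sub>R x))\<^sup>2 / 2"
      unfolding power2_norm_eq_inner by (simp add: inner_diff_left inner_diff_right inner_commute field_simps)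
    then have e: "exp (- (norm t)\<^sup>2 / 4) * exp (- (norm (t - x))\<^sup>2 / 4) = exp (- (norm x)\<^sup>2 / 8) * exp (- (norm (t - (1/2) *\<^sub>R x))\<^sup>2 / 2)"
      unfolding exp_add[symmetric] by simp
    have c: "cnj (chi (x, \<xi>) t) = cis (((1/2) *\<^sub>R x) \<bullet> v) * cis ((t - (1/2) *\<^sub>R x) \<bullet> v)"
      by (simp add: chi_cis cis_cnj cis_mult v_def) (simp add: inner_diff_left inner_diff_right inner_commute algebra_simps)
    have "gauss t * cnj (tf_shift (x, \<xi>) gauss t) = of_real (exp (- (norm t)\<^sup>2 / 4) * exp (- (norm (t - x))\<^sup>2 / 4)) * cnj (chi (x, \<xi>) t)"
      by (simp add: tf_shift_chi gauss_def)
    then show "gauss t * cnj (tf_shift (x, \<xi>) gauss t) = (of_real (exp (- (norm x)\<^sup>2 / 8)) * cis (((1/2) *\<^sub>R x) \<bullet> v)) * G (t - (1/2) *\<^sub>R x)"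
      unfolding e c G_def by (simp add: mult_ac)
  qed
  also have "\<dots> = (of_real (exp (- (norm x)\<^sup>2 / 8)) * cis (((1/2) *\<^sub>R x) \<bullet> v)) * (LINT t|lborel. G t)"
    by (simp add: integral_lborel_translate)
  finally have "cmod (ip gauss (tf_shift (x, \<xi>) gauss)) = exp (- (norm x)\<^sup>2 / 8) * (sqrt (2 * pi) ^ DIM(real^'d) * exp (- (norm v)\<^sup>2 / 2))"
    unfolding G_def integral_gaussian_cis by (simp add: norm_mult norm_power)
  moreover have "- (norm v)\<^sup>2 / 2 = - 2 * pi\<^sup>2 * (norm \<xi>)\<^sup>2" by (simp add: v_def power_mult_distrib)
  ultimately show ?thesis by (simp add: mult_ac)
qed

text \<open>The seed is the indicator of the unit ball, for which the amalgam condition is pure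
  counting. A Gaussian is dominated by the convolution of that indicator with a wider
  Gaussian.\<close>

lemma wiener_stft_gauss: "wiener (\<lambda>z. cmod (ip gauss (tf_shift z (gauss :: 'd::finite signal))))"
proof (rule wiener_convolution[OF wiener_indicator_ball])
  have [measurable]: "ball (0::'d phase_space) 1 \<in> sets borel" by simp
  define D where "D = sqrt (2 * pi) ^ DIM(real^'d)"
  have D: "D > 0" by (simp add: D_def)
  define s :: real where "s = sqrt (1 / 8)"
  \<comment> \<open>For \<open>norm (z - u) < 1\<close> one has
    \<open>(norm u)\<^sup>2 \<le> 2 * (norm z)\<^sup>2 + 2\<close>. Halving the rate 1/8 of decay to
    1/16 absorbs the factor 2, and \<open>exp (1/8)\<close> absorbs the constant.\<close>
  define H where "H = (\<lambda>u::'d phase_space. D * exp (1/8) * exp (- (norm (s *\<^sub>R u))\<^sup>2 / 2))"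
  have s: "s > 0" "s\<^sup>2 = 1/8" by (auto simp: s_def)
  show "H \<in> borel_measurable borel" unfolding H_def by measurable
  show H0: "H z \<ge> 0" for z using D by (simp add: H_def)
  have "integrable lborel H" unfolding H_def by (intro integrable_mult_right integrable_gaussian_scaled s)
  then have "(\<integral>\<^sup>+ u. ennreal (norm (H u)) \<partial>lborel) < \<infinity>" unfolding integrable_iff_bounded by blast
  then show "(\<integral>\<^sup>+ u. ennreal (H u) \<partial>lborel) < \<infinity>" using H0 by simp
  define a where "a = measure lborel (ball (0::'d phase_space) 1)"
  show "a > 0" unfolding a_def using content_ball_pos[of 1 "0::'d phase_space"] by (simp add: measure_completion)
  fix z :: "'d phase_space"
  have gz: "cmod (ip gauss (tf_shift z gauss)) \<le> D * exp (- (norm z)\<^sup>2 / 8)"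
  proof (cases z)
    case (Pair x \<xi>)
    have "1 / 8 \<le> 2 * pi\<^sup>2" using pi_ge_two mult_mono[of 2 pi 2 pi] by (simp add: power2_eq_square)
    then have "(1/8) * (norm \<xi>)\<^sup>2 \<le> (2 * pi\<^sup>2) * (norm \<xi>)\<^sup>2" by (intro mult_right_mono) auto
    then have "exp (- (norm x)\<^sup>2 / 8) * exp (- 2 * pi\<^sup>2 * (norm \<xi>)\<^sup>2) \<le> exp (- (norm z)\<^sup>2 / 8)"
      unfolding exp_add[symmetric] by (simp add: Pair norm_Pair add_divide_distrib)
    then show ?thesis using D unfolding Pair stft_gauss D_def[symmetric] by (simp add: mult.assoc)
  qed
  have "ennreal (cmod (ip gauss (tf_shift z gauss)) * a) \<le> ennreal (D * exp (- (norm z)\<^sup>2 / 8) * a)"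
    using gz by (intro ennreal_leI mult_right_mono) (auto simp: a_def)
  also have "\<dots> = ennreal (D * exp (- (norm z)\<^sup>2 / 8)) * ennreal a" using D by (simp add: ennreal_mult a_def)
  also have "ennreal a = emeasure lborel (ball (0::'d phase_space) 1)"
    unfolding a_def using emeasure_bounded_finite[of "ball (0::'d phase_space) 1"]
    by (intro emeasure_eq_ennreal_measure[symmetric]) auto
  also have "\<dots> = (\<integral>\<^sup>+ u. indicator (ball (0::'d phase_space) 1) u \<partial>lborel)" by simp
  also have "\<dots> = (\<integral>\<^sup>+ u. indicator (ball (0::'d phase_space) 1) (z - u) \<partial>lborel)"
    by (rule nn_integral_lborel_reflect[symmetric]) measurable
  also have "ennreal (D * exp (- (norm z)\<^sup>2 / 8)) * \<dots> = (\<integral>\<^sup>+ u. ennreal (D * exp (- (norm z)\<^sup>2 / 8)) * indicator (ball (0::'d phase_space) 1) (z - u) \<partial>lborel)"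
    by (rule nn_integral_cmult[symmetric]) measurable
  also have "\<dots> \<le> (\<integral>\<^sup>+ u. ennreal (H u * indicator (ball 0 1) (z - u)) \<partial>lborel)"
  proof (rule nn_integral_mono)
    fix u :: "'d phase_space"
    have "D * exp (- (norm z)\<^sup>2 / 8) \<le> H u" if "norm (z - u) < 1"
    proof -
      have "norm u \<le> norm z + 1" using norm_triangle_ineq2[of u z] that by (simp add: norm_minus_commute)
      then have "(norm u)\<^sup>2 \<le> (norm z + 1)\<^sup>2" by (intro power_mono) auto
      also have "\<dots> \<le> 2 * (norm z)\<^sup>2 + 2" using sum_squares_bound[of "norm z" 1] by (simp add: power2_sum)
      finally have "- (norm z)\<^sup>2 / 8 \<le> 1/8 + - (norm (s *\<^sub>R u))\<^sup>2 / 2"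
        unfolding norm_scaleR power_mult_distrib power2_abs s(2) by simp
      then have "exp (- (norm z)\<^sup>2 / 8) \<le> exp (1/8) * exp (- (norm (s *\<^sub>R u))\<^sup>2 / 2)"
        unfolding exp_add[symmetric] by simp
      then show ?thesis using D by (simp add: H_def mult.assoc)
    qed
    then show "ennreal (D * exp (- (norm z)\<^sup>2 / 8)) * indicator (ball (0::'d phase_space) 1) (z - u) \<le> ennreal (H u * indicator (ball 0 1) (z - u))"
      by (auto simp: indicator_def intro!: ennreal_leI)
  qed
  finally show "ennreal (cmod (ip gauss (tf_shift z gauss)) * a) \<le> (\<integral>\<^sup>+ u. ennreal (H u * indicator (ball 0 1) (z - u)) \<partial>lborel)" .
qed (auto intro!: borel_measurable_indicator)

text \<open>Two applications of \<open>moyal_inequality\<close>, each followed by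
  \<open>wiener_convolution\<close> with the integrable function \<open>Hg\<close>. The first pairs
  \<open>g\<close> with shifted Gaussians and carries the amalgam bound from the Gaussian to the
  mixed transform \<open>V\<close>. The second pairs \<open>g\<close> with its own shifts and
  carries it from the reflection of \<open>V\<close> to \<open>Hg\<close>. The point
  \<open>z0\<close> makes the constant factor \<open>a\<close> on the left nonzero.\<close>

theorem wiener_stft:
  fixes g :: "'d::finite signal"
  assumes g: "g \<in> L2b" "nsq g > 0" and fin: "(\<integral>\<^sup>+ z. ennreal (cmod (ip g (tf_shift z g))) \<partial>lborel) < \<infinity>"
  shows "wiener (\<lambda>z. cmod (ip g (tf_shift z g)))"
proof -
  note G = gauss_L2b[where 'd='d]
  \<comment> \<open>Otherwise the right side of Moyal's inequality would vanish, although both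
    windows have positive norm.\<close>
  have "\<exists>z. ip g (tf_shift z gauss) \<noteq> 0"
  proof (rule ccontr)
    assume "\<not> ?thesis"
    then have "ip g (tf_shift z gauss) = 0" for z by blast
    then have "ennreal (nsq g * nsq (gauss :: 'd signal)) \<le> 0"
      using moyal_inequality[OF g(1) g(1) G G] by (simp add: ip_self)
    then show False using g(2) nsq_gauss_pos[where 'd='d] by (simp add: mult_le_0_iff)
  qed
  then obtain z0 where z0: "ip g (tf_shift z0 gauss) \<noteq> 0" by blast
  define a where "a = cmod (ip g (tf_shift z0 gauss))"
  have a: "a > 0" using z0 by (simp add: a_def)
  define V where "V = (\<lambda>z. cmod (ip g (tf_shift (z + z0) gauss)))"
  define Hg where "Hg = (\<lambda>z. cmod (ip g (tf_shift z g)))"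
  have Hm: "Hg \<in> borel_measurable borel" unfolding Hg_def using stft_measurable[OF g(1) g(1)] by measurable
  have Vm: "V \<in> borel_measurable borel"
    unfolding V_def using measurable_compose[OF _ stft_measurable[OF g(1) G], of "\<lambda>z. z + z0" borel] by measurable
  have wV: "wiener V"
  proof (rule wiener_convolution[OF wiener_stft_gauss _ Hm _ _ _ a])
    show "(\<lambda>z. cmod (ip gauss (tf_shift z (gauss :: 'd signal)))) \<in> borel_measurable borel"
      using stft_measurable[OF G G] by measurable
    fix z
    show "ennreal (V z * a) \<le> (\<integral>\<^sup>+ u. ennreal (Hg u * cmod (ip gauss (tf_shift (z - u) gauss))) \<partial>lborel)"
    proof -
      have "cmod (ip (tf_shift (z + z0) gauss) (tf_shift u (tf_shift z0 gauss))) = cmod (ip gauss (tf_shift (z - u) (gauss :: 'd signal)))" for u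
        using cmod_ip_tf_shift_swap[OF G G, of "z - u"]
        by (simp add: cmod_ip_tf_shift_compose cmod_ip_tf_shift[OF G G])
      then show ?thesis
        using moyal_inequality[OF g(1) L2b_tf_shift[OF G] g(1) L2b_tf_shift[OF G], of "z + z0" z0]
        by (simp add: V_def a_def Hg_def)
    qed
  qed (use fin in \<open>auto simp: V_def Hg_def\<close>)
  have "wiener Hg"
  proof (rule wiener_convolution[OF wiener_reflect[OF wV] _ Hm _ _ _ a])
    show "(\<lambda>z. V (- z)) \<in> borel_measurable borel" using Vm by measurable
    fix z
    show "ennreal (Hg z * a) \<le> (\<integral>\<^sup>+ u. ennreal (Hg u * V (- (z - u))) \<partial>lborel)"
    proof -
      have "cmod (ip (tf_shift z g) (tf_shift u (tf_shift z0 gauss))) = V (- (z - u))" for u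
        by (simp add: cmod_ip_tf_shift_compose cmod_ip_tf_shift[OF g(1) G] V_def algebra_simps)
      then show ?thesis
        using moyal_inequality[OF g(1) L2b_tf_shift[OF g(1)] g(1) L2b_tf_shift[OF G], of z z0]
        by (simp add: a_def Hg_def)
    qed
  qed (use fin in \<open>auto simp: V_def Hg_def\<close>)
  then show ?thesis by (simp add: Hg_def)
qed

section \<open>Counting, the Schur test, and approximate expansions\<close>

text \<open>The centres are given as offsets from \<open>x\<close>, so the number of small balls is
  the same for all \<open>x\<close>.\<close>

lemma cball_finite_cover:
  fixes R r :: real
  assumes "r > 0"
  obtains C :: "'a::euclidean_space set" where "finite C" "\<And>x. cball x R \<subseteq> (\<Union>c\<in>C. ball (x + c) r)"
proof -
  have cov: "cball (0::'a) R \<subseteq> (\<Union>c\<in>cball 0 R. ball c r)" using assms by force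
  obtain C where C: "finite C" "cball (0::'a) R \<subseteq> (\<Union>c\<in>C. ball c r)"
    by (rule compactE_image[OF compact_cball _ cov]) auto
  have "cball x R \<subseteq> (\<Union>c\<in>C. ball (x + c) r)" for x
  proof
    fix y assume "y \<in> cball x R"
    then have "y - x \<in> cball 0 R" by (simp add: dist_norm norm_minus_commute)
    then obtain c where "c \<in> C" "y - x \<in> ball c r" using C(2) by blast
    then show "y \<in> (\<Union>c\<in>C. ball (x + c) r)" by (auto simp: dist_norm algebra_simps)
  qed
  then show ?thesis using C(1) that by blast
qed

lemma card_le_of_cover:
  assumes "finite C" and "\<And>c. c \<in> C \<Longrightarrow> finite (S \<inter> B c) \<and> card (S \<inter> B c) \<le> N" and "T \<subseteq> (\<Union>c\<in>C. B c)"
  shows "finite (S \<inter> T)" "card (S \<inter> T) \<le> card C * N"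
proof -
  have sub: "S \<inter> T \<subseteq> (\<Union>c\<in>C. S \<inter> B c)" using assms(3) by blast
  have fin: "finite (\<Union>c\<in>C. S \<inter> B c)" using assms(1,2) by blast
  show "finite (S \<inter> T)" by (rule finite_subset[OF sub fin])
  have "card (S \<inter> T) \<le> card (\<Union>c\<in>C. S \<inter> B c)" by (rule card_mono[OF fin sub])
  also have "\<dots> \<le> (\<Sum>c\<in>C. card (S \<inter> B c))" by (rule card_UN_le[OF assms(1)])
  also have "\<dots> \<le> (\<Sum>c\<in>C. N)" using assms(2) by (intro sum_mono) auto
  finally show "card (S \<inter> T) \<le> card C * N" by simp
qed

lemma nsep_card_cball:
  obtains M where "\<And>(\<Gamma> :: 'a::euclidean_space set) x. nsep N \<Gamma> \<Longrightarrow> finite (\<Gamma> \<inter> cball x R) \<and> card (\<Gamma> \<inter> cball x R) \<le> M"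
proof -
  obtain C :: "'a set" where C: "finite C" "\<And>x. cball x R \<subseteq> (\<Union>c\<in>C. ball (x + c) 1)"
    using cball_finite_cover[of 1 R] by auto
  have "finite (\<Gamma> \<inter> cball x R) \<and> card (\<Gamma> \<inter> cball x R) \<le> card C * N" if "nsep N \<Gamma>" for \<Gamma> and x :: 'a
    using card_le_of_cover[OF C(1) _ C(2), of \<Gamma> x N] that unfolding nsep_def by blast
  then show ?thesis using that by blast
qed

lemma nsep_of_small_balls:
  fixes \<Gamma> :: "'a::euclidean_space set"
  assumes r: "r > 0" and "\<And>x. finite (\<Gamma> \<inter> ball x r) \<and> card (\<Gamma> \<inter> ball x r) \<le> k"
  shows "\<exists>N. nsep N \<Gamma>"
proof -
  obtain C :: "'a set" where C: "finite C" "\<And>x. cball x 1 \<subseteq> (\<Union>c\<in>C. ball (x + c) r)"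
    using cball_finite_cover[OF r, of 1] by auto
  have "ball x 1 \<subseteq> (\<Union>c\<in>C. ball (x + c) r)" for x using C(2)[of x] by auto
  note cover = this
  have "nsep (card C * k) \<Gamma>"
    unfolding nsep_def
  proof (rule allI)
    fix x
    show "finite (\<Gamma> \<inter> ball x 1) \<and> card (\<Gamma> \<inter> ball x 1) \<le> card C * k"
      using card_le_of_cover[OF C(1), of \<Gamma> "\<lambda>c. ball (x + c) r" k "ball x 1"] assms(2) cover
      by simp
  qed
  then show ?thesis by blast
qed

text \<open>Scaling by \<open>R\<close> turns a cover of a ball of radius 2 by balls of radius 1/2
  into one by balls of radius \<open>R/2\<close>, each with at most one point of \<open>Y\<close>.
  Hence \<open>P\<close> is chosen before \<open>R\<close>, which matters because \<open>R\<close>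
  is later taken large in terms of \<open>P\<close>.\<close>

lemma separated_card_cball:
  obtains P where "\<And>(Y :: 'a::euclidean_space set) R z. R > 0 \<Longrightarrow> (\<And>y y'. y \<in> Y \<Longrightarrow> y' \<in> Y \<Longrightarrow> y \<noteq> y' \<Longrightarrow> dist y y' \<ge> R)
    \<Longrightarrow> finite (Y \<inter> cball z (2 * R)) \<and> card (Y \<inter> cball z (2 * R)) \<le> P"
proof -
  obtain C :: "'a set" where C: "finite C" "\<And>x. cball x 2 \<subseteq> (\<Union>c\<in>C. ball (x + c) (1/2))"
    using cball_finite_cover[of "1/2" 2] by auto
  have "finite (Y \<inter> cball z (2 * R)) \<and> card (Y \<inter> cball z (2 * R)) \<le> card C * 1"
    if R: "R > 0" and sep: "\<And>y y'. y \<in> Y \<Longrightarrow> y' \<in> Y \<Longrightarrow> y \<noteq> y' \<Longrightarrow> dist y y' \<ge> R" for Y R and z :: 'a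
  proof -
    have one: "finite (Y \<inter> ball x (R/2)) \<and> card (Y \<inter> ball x (R/2)) \<le> 1" for x
    proof -
      have "y = y'" if "y \<in> Y \<inter> ball x (R/2)" "y' \<in> Y \<inter> ball x (R/2)" for y y'
      proof (rule ccontr)
        assume "y \<noteq> y'"
        then have "R \<le> dist y y'" using that sep by blast
        also have "\<dots> \<le> dist x y + dist x y'" using dist_triangle[of y y' x] by (simp add: dist_commute)
        also have "\<dots> < R" using that by simp
        finally show False by simp
      qed
      then have "\<exists>a. Y \<inter> ball x (R/2) \<subseteq> {a}" by blast
      then obtain a where "Y \<inter> ball x (R/2) \<subseteq> {a}" by blast
      then show ?thesis using card_mono[of "{a}" "Y \<inter> ball x (R/2)"] finite_subset[of _ "{a}"] by simp
    qed
    have "cball z (2 * R) \<subseteq> (\<Union>c\<in>C. ball (z + R *\<^sub>R c) (R/2))"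
    proof
      fix y assume "y \<in> cball z (2 * R)"
      then have "norm (y - z) \<le> 2 * R" by (simp add: dist_norm norm_minus_commute)
      then have "norm (y - z) / R \<le> 2" using R by (simp add: field_simps)
      moreover have "norm ((1/R) *\<^sub>R (y - z)) = norm (y - z) / R" unfolding norm_scaleR using R by simp
      ultimately have in2: "(1/R) *\<^sub>R (y - z) \<in> cball 0 2" by (simp only: mem_cball dist_0_norm)
      obtain c where c: "c \<in> C" "(1/R) *\<^sub>R (y - z) \<in> ball c (1/2)"
        using subsetD[OF C(2)[of 0] in2] by auto
      have "norm (y - (z + R *\<^sub>R c)) = norm (R *\<^sub>R ((1/R) *\<^sub>R (y - z) - c))"
        using R by (simp add: algebra_simps)
      also have "\<dots> = R * norm ((1/R) *\<^sub>R (y - z) - c)" using R by simp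
      also have "\<dots> < R * (1/2)" using c(2) R by (intro mult_strict_left_mono) (auto simp: dist_norm norm_minus_commute)
      finally show "y \<in> (\<Union>c\<in>C. ball (z + R *\<^sub>R c) (R/2))" using c(1) by (auto simp: dist_norm norm_minus_commute)
    qed
    from card_le_of_cover[OF C(1) one this] show ?thesis by blast
  qed
  then show ?thesis using that by blast
qed

lemma maximal_separated_subset:
  fixes M :: "'a::metric_space set"
  assumes "finite M" "R > 0"
  obtains Y where "Y \<subseteq> M" "\<And>y y'. y \<in> Y \<Longrightarrow> y' \<in> Y \<Longrightarrow> y \<noteq> y' \<Longrightarrow> dist y y' \<ge> R" "\<And>m. m \<in> M \<Longrightarrow> \<exists>y\<in>Y. dist m y < R"
proof -
  have "\<exists>Y\<subseteq>M. (\<forall>y\<in>Y. \<forall>y'\<in>Y. y \<noteq> y' \<longrightarrow> dist y y' \<ge> R) \<and> (\<forall>m\<in>M. \<exists>y\<in>Y. dist m y < R)"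
    using assms(1)
  proof (induction M rule: finite_induct)
    case (insert x M)
    then obtain Y where Y: "Y \<subseteq> M" "\<forall>y\<in>Y. \<forall>y'\<in>Y. y \<noteq> y' \<longrightarrow> dist y y' \<ge> R" "\<forall>m\<in>M. \<exists>y\<in>Y. dist m y < R" by blast
    show ?case
    proof (cases "\<exists>y\<in>Y. dist x y < R")
      case True
      then show ?thesis using Y by (intro exI[of _ Y]) auto
    next
      case False
      then show ?thesis using Y \<open>R>0\<close> by (intro exI[of _ "insert x Y"]) (auto simp: dist_commute not_less)
    qed
  qed auto
  then obtain Y where "Y \<subseteq> M" "\<forall>y\<in>Y. \<forall>y'\<in>Y. y \<noteq> y' \<longrightarrow> dist y y' \<ge> R" "\<forall>m\<in>M. \<exists>y\<in>Y. dist m y < R"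
    by (elim exE conjE)
  then show ?thesis by (intro that[of Y]) simp_all
qed

lemma weighted_Cauchy_Schwarz_sum:
  fixes k c :: "'j \<Rightarrow> real"
  assumes k: "\<And>j. j \<in> J \<Longrightarrow> k j \<ge> 0"
  shows "(\<Sum>j\<in>J. k j * c j)\<^sup>2 \<le> (\<Sum>j\<in>J. k j) * (\<Sum>j\<in>J. k j * (c j)\<^sup>2)"
proof -
  have "(\<Sum>j\<in>J. sqrt (k j) * (sqrt (k j) * c j))\<^sup>2 \<le> (\<Sum>j\<in>J. (sqrt (k j))\<^sup>2) * (\<Sum>j\<in>J. (sqrt (k j) * c j)\<^sup>2)"
    by (rule Cauchy_Schwarz_ineq_sum)
  moreover have "(\<Sum>j\<in>J. sqrt (k j) * (sqrt (k j) * c j)) = (\<Sum>j\<in>J. k j * c j)"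
    using k by (intro sum.cong) (auto simp: mult.assoc[symmetric])
  moreover have "(\<Sum>j\<in>J. (sqrt (k j))\<^sup>2) = (\<Sum>j\<in>J. k j)" using k by (intro sum.cong) auto
  moreover have "(\<Sum>j\<in>J. (sqrt (k j) * c j)\<^sup>2) = (\<Sum>j\<in>J. k j * (c j)\<^sup>2)"
    using k by (intro sum.cong) (auto simp: power_mult_distrib)
  ultimately show ?thesis by simp
qed

lemma schur_test:
  fixes k :: "'i \<Rightarrow> 'j \<Rightarrow> real"
  assumes k: "\<And>i j. i \<in> I \<Longrightarrow> j \<in> J \<Longrightarrow> k i j \<ge> 0"
    and row: "\<And>i. i \<in> I \<Longrightarrow> (\<Sum>j\<in>J. k i j) \<le> a" and col: "\<And>j. j \<in> J \<Longrightarrow> (\<Sum>i\<in>I. k i j) \<le> b" and a: "a \<ge> 0"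
  shows "(\<Sum>i\<in>I. (\<Sum>j\<in>J. k i j * c j)\<^sup>2) \<le> a * b * (\<Sum>j\<in>J. (c j)\<^sup>2)"
proof -
  have "(\<Sum>i\<in>I. (\<Sum>j\<in>J. k i j * c j)\<^sup>2) \<le> (\<Sum>i\<in>I. a * (\<Sum>j\<in>J. k i j * (c j)\<^sup>2))"
  proof (rule sum_mono)
    fix i assume i: "i \<in> I"
    have "(\<Sum>j\<in>J. k i j * c j)\<^sup>2 \<le> (\<Sum>j\<in>J. k i j) * (\<Sum>j\<in>J. k i j * (c j)\<^sup>2)"
      using k i by (intro weighted_Cauchy_Schwarz_sum) auto
    also have "\<dots> \<le> a * (\<Sum>j\<in>J. k i j * (c j)\<^sup>2)"
      using k i row by (intro mult_right_mono sum_nonneg mult_nonneg_nonneg) auto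
    finally show "(\<Sum>j\<in>J. k i j * c j)\<^sup>2 \<le> a * (\<Sum>j\<in>J. k i j * (c j)\<^sup>2)" .
  qed
  also have "\<dots> = a * (\<Sum>j\<in>J. (\<Sum>i\<in>I. k i j) * (c j)\<^sup>2)"
    by (simp add: sum_distrib_left[symmetric] sum_distrib_right sum.swap[of _ I J])
  also have "\<dots> \<le> a * (\<Sum>j\<in>J. b * (c j)\<^sup>2)"
    using col a by (intro mult_left_mono sum_mono mult_right_mono) auto
  finally show ?thesis by (simp add: sum_distrib_left mult.assoc)
qed

section \<open>Frames through finite sums, and approximate expansions\<close>

abbreviation energy :: "'d::finite signal \<Rightarrow> 'd phase_space set \<Rightarrow> 'd signal \<Rightarrow> real" where
  "energy g M f \<equiv> \<Sum>p\<in>M. (cmod (ip f (tf_shift p g)))\<^sup>2"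

abbreviation sqsum :: "('a \<Rightarrow> complex) \<Rightarrow> 'a set \<Rightarrow> real" where
  "sqsum c F \<equiv> \<Sum>p\<in>F. (cmod (c p))\<^sup>2"

definition synth :: "'d::finite signal \<Rightarrow> 'd phase_space set \<Rightarrow> ('d phase_space \<Rightarrow> complex) \<Rightarrow> 'd signal" where
  "synth g F c = (\<lambda>t. \<Sum>p\<in>F. c p * tf_shift p g t)"

text \<open>The frame inequalities on finite index sets. The set in the lower bound may depend on
  \<open>f\<close>; attaining the bound on a finite set costs part of the constant (see
  \<open>gabor_frame_iff_frame_fin\<close>), and all later arguments become finite sums.\<close>

definition frame_fin :: "'d::finite signal \<Rightarrow> 'd phase_space set \<Rightarrow> real \<Rightarrow> real \<Rightarrow> bool" where
  "frame_fin g \<Lambda> A B \<longleftrightarrow> A > 0 \<and> B > 0 \<and>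
     (\<forall>f\<in>L2b. \<forall>M. finite M \<longrightarrow> M \<subseteq> \<Lambda> \<longrightarrow> energy g M f \<le> B * nsq f) \<and>
     (\<forall>f\<in>L2b. \<exists>M. finite M \<and> M \<subseteq> \<Lambda> \<and> A * nsq f \<le> energy g M f)"

context
  fixes g :: "'d::finite signal"
  assumes g: "g \<in> L2b"
begin

lemma synth_L2b: "synth g F c \<in> L2b"
  unfolding synth_def by (intro L2b_sum L2b_scale L2b_tf_shift g)

lemma ip_synth_left: "h \<in> L2b \<Longrightarrow> ip (synth g F c) h = (\<Sum>p\<in>F. c p * ip (tf_shift p g) h)"
  unfolding synth_def by (subst ip_sum_left) (auto simp: ip_scale_left intro!: L2b_scale L2b_tf_shift g)

lemma ip_synth_right: "h \<in> L2b \<Longrightarrow> ip h (synth g F c) = (\<Sum>p\<in>F. cnj (c p) * ip h (tf_shift p g))"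
  unfolding synth_def by (subst ip_sum_right) (auto simp: ip_scale_right intro!: L2b_scale L2b_tf_shift g)

lemma cmod_ip_synth_le:
  "cmod (ip (synth g F c) (tf_shift q g)) \<le> (\<Sum>p\<in>F. cmod (ip g (tf_shift (q - p) g)) * cmod (c p))"
  unfolding ip_synth_left[OF L2b_tf_shift[OF g]]
  by (rule order_trans[OF norm_sum]) (simp add: norm_mult cmod_ip_tf_shift[OF g g] mult.commute)

text \<open>Synthesis and analysis are adjoint to each other and so have the same norm. Expanding
  one factor of \<open>ip h h\<close> and applying Cauchy-Schwarz leaves one power of
  \<open>nsq h\<close> to cancel. The next lemma is the converse.\<close>

lemma synth_bound_of_analysis_bound:
  assumes B: "B \<ge> 0" "\<And>f. f \<in> L2b \<Longrightarrow> energy g F f \<le> B * nsq f"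
  shows "nsq (synth g F c) \<le> B * sqsum c F"
proof -
  define h where "h = synth g F c"
  have h: "h \<in> L2b" unfolding h_def by (rule synth_L2b)
  have "nsq h = cmod (ip h h)" by (simp add: ip_self)
  also have "ip h h = (\<Sum>p\<in>F. cnj (c p) * ip h (tf_shift p g))"
    using ip_synth_right[OF h, of F c] by (simp add: h_def)
  also have "cmod \<dots> \<le> (\<Sum>p\<in>F. cmod (c p) * cmod (ip h (tf_shift p g)))"
    by (rule order_trans[OF norm_sum]) (simp add: norm_mult)
  finally have "(nsq h)\<^sup>2 \<le> (\<Sum>p\<in>F. cmod (c p) * cmod (ip h (tf_shift p g)))\<^sup>2"
    by (intro power_mono) auto
  also have "\<dots> \<le> sqsum c F * energy g F h"
    by (rule Cauchy_Schwarz_ineq_sum)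
  also have "\<dots> \<le> sqsum c F * (B * nsq h)"
    by (intro mult_left_mono B h sum_nonneg) auto
  finally have *: "nsq h * nsq h \<le> nsq h * (B * sqsum c F)"
    by (simp add: power2_eq_square mult_ac)
  show ?thesis
  proof (cases "nsq h = 0")
    case True
    then show ?thesis using B by (simp add: h_def sum_nonneg)
  next
    case False
    then have "nsq h > 0" using nsq_nonneg[of h] by linarith
    then show ?thesis using mult_left_le_imp_le[OF *] by (simp add: h_def)
  qed
qed

lemma analysis_bound_of_synth_bound:
  assumes B: "\<And>c. nsq (synth g F c) \<le> B * sqsum c F" and f: "f \<in> L2b" and "B \<ge> 0"
  shows "energy g F f \<le> B * nsq f"
proof -
  define c where "c = (\<lambda>p. ip f (tf_shift p g))"
  define S where "S = sqsum c F"
  have S0: "S \<ge> 0" by (simp add: S_def sum_nonneg)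
  have "ip f (synth g F c) = of_real S"
    unfolding ip_synth_right[OF f] S_def of_real_sum c_def
    by (intro sum.cong refl) (simp add: complex_norm_square[symmetric] mult.commute)
  then have "S\<^sup>2 = (cmod (ip f (synth g F c)))\<^sup>2" by simp
  also have "\<dots> \<le> nsq f * nsq (synth g F c)" by (rule ip_Cauchy_Schwarz_sq[OF f synth_L2b])
  also have "\<dots> \<le> nsq f * (B * S)" unfolding S_def by (intro mult_left_mono B) auto
  finally have *: "S * S \<le> S * (B * nsq f)" by (simp add: power2_eq_square mult_ac)
  have "S \<le> B * nsq f"
  proof (cases "S = 0")
    case False
    then show ?thesis using S0 by (intro mult_left_le_imp_le[OF *]) auto
  qed (use \<open>B\<ge>0\<close> in auto)
  then show ?thesis by (simp add: S_def c_def)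
qed

text \<open>One step of the Richardson iteration for the frame operator. Truncating the operator to a finite
  set \<open>F\<close> avoids infinite series in \<open>L\<^sup>2\<close> and thus the completeness of \<open>L\<^sup>2\<close>.\<close>

lemma frame_fin_approx_step:
  assumes fr: "frame_fin g \<Lambda> A B" and f: "f \<in> L2b"
  shows "\<exists>F c. finite F \<and> F \<subseteq> \<Lambda> \<and> nsq (\<lambda>t. f t - synth g F c t) \<le> (1 - A / B) * nsq f
     \<and> sqsum c F \<le> (1 / B) * nsq f"
proof -
  have AB: "A > 0" "B > 0" using fr by (auto simp: frame_fin_def)
  obtain M where M: "finite M" "M \<subseteq> \<Lambda>" "A * nsq f \<le> energy g M f"
    using fr f unfolding frame_fin_def by blast
  have up: "energy g M f \<le> B * nsq f" if "f \<in> L2b" for f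
    using fr that M unfolding frame_fin_def by blast
  define S where "S = energy g M f"
  \<comment> \<open>With the relaxation parameter \<open>1 / B\<close>, the cross term gains
    \<open>2 * S / B\<close>, and the synthesis bound returns at most \<open>S / B\<close> of
    it.\<close>
  define c where "c = (\<lambda>p. of_real (1 / B) * ip f (tf_shift p g))"
  have cS: "sqsum c M = (1 / B)\<^sup>2 * S"
    using AB unfolding c_def S_def norm_mult power_mult_distrib by (simp add: sum_distrib_left norm_divide)
  have "ip f (synth g M c) = of_real (1 / B * S)"
    unfolding ip_synth_right[OF f] S_def of_real_sum of_real_mult sum_distrib_left c_def
    by (intro sum.cong refl) (simp add: complex_norm_square[symmetric] mult_ac)
  then have "nsq (\<lambda>t. f t - synth g M c t) = nsq f - 2 * (1 / B * S) + nsq (synth g M c)"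
    using nsq_diff_expand[OF f synth_L2b, of M c] by simp
  also have "nsq (synth g M c) \<le> B * ((1 / B)\<^sup>2 * S)"
    unfolding cS[symmetric] using AB up by (intro synth_bound_of_analysis_bound) auto
  also have "nsq f - 2 * (1 / B * S) + B * ((1 / B)\<^sup>2 * S) = nsq f - S / B"
    using AB by (simp add: power2_eq_square field_simps)
  also have "\<dots> \<le> (1 - A / B) * nsq f"
    using M(3) AB unfolding S_def[symmetric] by (simp add: field_simps)
  finally have 1: "nsq (\<lambda>t. f t - synth g M c t) \<le> (1 - A / B) * nsq f" by simp
  have "(1 / B)\<^sup>2 * S \<le> (1 / B)\<^sup>2 * (B * nsq f)" using up[OF f] by (intro mult_left_mono) (auto simp: S_def)
  then have "sqsum c M \<le> (1 / B) * nsq f"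
    unfolding cS using AB by (simp add: power2_eq_square field_simps)
  then show ?thesis using 1 M by blast
qed

lemma synth_mono_neutral:
  assumes "finite F'" "F \<subseteq> F'"
  shows "synth g F c = synth g F' (\<lambda>p. if p \<in> F then c p else 0)"
  unfolding synth_def
  by (rule ext, rule sum.mono_neutral_cong_left) (use assms in auto)

text \<open>Repeating the step on the remainder multiplies the error by \<open>1 - A / B\<close>
  each time. The bound for the coefficients grows from \<open>K\<close> to
  \<open>2 * K + 2 / B\<close>; this is harmless, since \<open>k\<close> is fixed before
  \<open>f\<close>.\<close>

lemma frame_fin_approx_pow:
  assumes fr: "frame_fin g \<Lambda> A B" and AB: "A \<le> B"
  shows "\<exists>K>0. \<forall>f\<in>L2b. \<exists>F c. finite F \<and> F \<subseteq> \<Lambda> \<and> nsq (\<lambda>t. f t - synth g F c t) \<le> (1 - A / B) ^ k * nsq f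
     \<and> sqsum c F \<le> K * nsq f"
proof (induction k)
  case 0
  then show ?case by (intro exI[of _ 1]) (auto intro!: exI[of _ "{}"] simp: synth_def)
next
  case (Suc k)
  then obtain K where K: "K > 0" and ap: "\<And>f. f \<in> L2b \<Longrightarrow> \<exists>F c. finite F \<and> F \<subseteq> \<Lambda> \<and> nsq (\<lambda>t. f t - synth g F c t) \<le> (1 - A / B) ^ k * nsq f
     \<and> sqsum c F \<le> K * nsq f" by blast
  have pos: "A > 0" "B > 0" using fr by (auto simp: frame_fin_def)
  have th: "0 \<le> 1 - A / B" "1 - A / B \<le> 1" using pos AB by auto
  show ?case
  proof (intro exI[of _ "2 * K + 2 * (1 / B)"] conjI ballI)
    fix f :: "'d signal" assume f: "f \<in> L2b"
    obtain F c where F: "finite F" "F \<subseteq> \<Lambda>" "nsq (\<lambda>t. f t - synth g F c t) \<le> (1 - A / B) ^ k * nsq f" "sqsum c F \<le> K * nsq f"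
      using ap[OF f] by blast
    define f' where "f' = (\<lambda>t. f t - synth g F c t)"
    have f': "f' \<in> L2b" unfolding f'_def by (intro L2b_diff f synth_L2b)
    obtain F' c' where F': "finite F'" "F' \<subseteq> \<Lambda>" "nsq (\<lambda>t. f' t - synth g F' c' t) \<le> (1 - A / B) * nsq f'" "sqsum c' F' \<le> (1 / B) * nsq f'"
      using frame_fin_approx_step[OF fr f'] by blast
    define d where "d = (\<lambda>p. if p \<in> F then c p else 0)"
    define d' where "d' = (\<lambda>p. if p \<in> F' then c' p else 0)"
    have s: "synth g F c = synth g (F \<union> F') d" "synth g F' c' = synth g (F \<union> F') d'"
      unfolding d_def d'_def using F F' by (auto intro!: synth_mono_neutral)
    have "f' t - synth g F' c' t = f t - synth g (F \<union> F') (\<lambda>p. d p + d' p) t" for t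
      unfolding f'_def s by (simp add: synth_def distrib_right sum.distrib)
    then have "nsq (\<lambda>t. f t - synth g (F \<union> F') (\<lambda>p. d p + d' p) t) \<le> (1 - A / B) * nsq f'" using F'(3) by simp
    also have "\<dots> \<le> (1 - A / B) * ((1 - A / B) ^ k * nsq f)" using F(3) th unfolding f'_def by (intro mult_left_mono) auto
    finally have 1: "nsq (\<lambda>t. f t - synth g (F \<union> F') (\<lambda>p. d p + d' p) t) \<le> (1 - A / B) ^ Suc k * nsq f" by (simp add: mult.assoc)
    have "nsq f' \<le> 1 * nsq f"
      using F(3) mult_right_mono[OF power_le_one[OF th, of k] nsq_nonneg[of f]] unfolding f'_def by linarith
    then have f'f: "(1 / B) * nsq f' \<le> (1 / B) * nsq f" using pos by (intro mult_left_mono) auto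
    have "(\<Sum>p\<in>F \<union> F'. (cmod (d p + d' p))\<^sup>2) \<le> (\<Sum>p\<in>F \<union> F'. 2 * (cmod (d p))\<^sup>2 + 2 * (cmod (d' p))\<^sup>2)"
      by (intro sum_mono cmod_add_square_le)
    also have "\<dots> = 2 * sqsum d (F \<union> F') + 2 * sqsum d' (F \<union> F')"
      by (simp add: sum.distrib sum_distrib_left)
    also have "sqsum d (F \<union> F') = sqsum c F"
      by (rule sum.mono_neutral_cong_right) (use F F' in \<open>auto simp: d_def\<close>)
    also have "sqsum d' (F \<union> F') = sqsum c' F'"
      by (rule sum.mono_neutral_cong_right) (use F F' in \<open>auto simp: d'_def\<close>)
    finally have "(\<Sum>p\<in>F \<union> F'. (cmod (d p + d' p))\<^sup>2) \<le> (2 * K + 2 * (1 / B)) * nsq f"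
      using F(4) F'(4) f'f unfolding distrib_right by linarith
    then show "\<exists>F c. finite F \<and> F \<subseteq> \<Lambda> \<and> nsq (\<lambda>t. f t - synth g F c t) \<le> (1 - A / B) ^ Suc k * nsq f
       \<and> sqsum c F \<le> (2 * K + 2 * (1 / B)) * nsq f"
      using 1 F F' by (intro exI[of _ "F \<union> F'"] exI[of _ "\<lambda>p. d p + d' p"]) auto
  qed (use K pos in \<open>auto intro!: add_pos_pos\<close>)
qed

lemma frame_fin_approx:
  assumes fr: "frame_fin g \<Lambda> A B" and AB: "A \<le> B" and e: "e > 0"
  shows "\<exists>K>0. \<forall>f\<in>L2b. \<exists>F c. finite F \<and> F \<subseteq> \<Lambda> \<and> nsq (\<lambda>t. f t - synth g F c t) \<le> e * nsq f
     \<and> sqsum c F \<le> K * nsq f"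
proof -
  have pos: "A > 0" "B > 0" using fr by (auto simp: frame_fin_def)
  have th: "0 \<le> 1 - A / B" "1 - A / B < 1" using pos AB by auto
  obtain k where k: "(1 - A / B) ^ k < e" using real_arch_pow_inv[OF e th(2)] by blast
  have "(1 - A / B) ^ k * nsq f \<le> e * nsq f" for f :: "'d signal" using k by (intro mult_right_mono) auto
  note le = this
  obtain K where "K > 0" and K: "\<And>f. f \<in> L2b \<Longrightarrow> \<exists>F c. finite F \<and> F \<subseteq> \<Lambda> \<and>
     nsq (\<lambda>t. f t - synth g F c t) \<le> (1 - A / B) ^ k * nsq f \<and> sqsum c F \<le> K * nsq f"
    using frame_fin_approx_pow[OF fr AB, of k] by blast
  show ?thesis
  proof (intro exI[of _ K] conjI ballI)
    fix f :: "'d signal" assume "f \<in> L2b"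
    then obtain F c where F: "finite F" "F \<subseteq> \<Lambda>" "nsq (\<lambda>t. f t - synth g F c t) \<le> (1 - A / B) ^ k * nsq f"
      "sqsum c F \<le> K * nsq f" using K by blast
    then show "\<exists>F c. finite F \<and> F \<subseteq> \<Lambda> \<and> nsq (\<lambda>t. f t - synth g F c t) \<le> e * nsq f \<and> sqsum c F \<le> K * nsq f"
      using le[of f] by (intro exI[of _ F] exI[of _ c]) auto
  qed fact
qed

end

section \<open>Localisation of the frame inequality\<close>

lemma cmod_diff_square_le: "(cmod x)\<^sup>2 \<le> 2 * (cmod y)\<^sup>2 + 2 * (cmod (x - y))\<^sup>2"
  using cmod_add_square_le[of y "x - y"] by simp

definition cutoff :: "real \<Rightarrow> 'a::metric_space \<Rightarrow> 'a \<Rightarrow> real" where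
  "cutoff R y z = max 0 (min 1 (2 - dist z y / R))"

lemma cutoff_range: "0 \<le> cutoff R y z" "cutoff R y z \<le> 1"
  by (auto simp: cutoff_def)

lemma cutoff_sq_le: "(cutoff R y z)\<^sup>2 \<le> 1"
  using cutoff_range[of R y z] by (simp add: power_le_one)

lemma cutoff_outside: "R > 0 \<Longrightarrow> dist z y > 2 * R \<Longrightarrow> cutoff R y z = 0"
  by (simp add: cutoff_def field_simps)

lemma cutoff_inside: "R > 0 \<Longrightarrow> dist z y < R \<Longrightarrow> cutoff R y z = 1"
  by (simp add: cutoff_def field_simps)

lemma cutoff_lipschitz:
  assumes R: "R > 0" shows "\<bar>cutoff R y a - cutoff R y b\<bar> \<le> min 1 (dist a b / R)"
proof -
  have "\<bar>dist a y / R - dist b y / R\<bar> = \<bar>dist a y - dist b y\<bar> / R"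
    using R by (simp add: diff_divide_distrib[symmetric])
  also have "\<dots> \<le> dist a b / R"
    using R dist_triangle[of a y b] dist_triangle[of b y a] by (intro divide_right_mono) (auto simp: dist_commute abs_if)
  finally have "\<bar>dist a y / R - dist b y / R\<bar> \<le> dist a b / R" .
  then show ?thesis by (auto simp: cutoff_def max_def min_def abs_if split: if_splits)
qed

lemma sum_indicator_real_card: "finite A \<Longrightarrow> (\<Sum>x\<in>A. indicator B x :: real) = card (A \<inter> B)"
  by (simp add: indicator_def of_bool_def sum.If_cases)

lemma sum_rotate: "(\<Sum>a\<in>A. \<Sum>b\<in>B. \<Sum>c\<in>C. u a b c) = (\<Sum>b\<in>B. \<Sum>c\<in>C. \<Sum>a\<in>A. u a b c)"
  by (subst sum.swap, intro sum.cong refl sum.swap)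

text \<open>A deformation may map several points to one, while the frame sum over the image counts
  that point once. The passage from indices to the image costs the multiplicity.\<close>

lemma sum_image_le_mult:
  fixes u :: "'b \<Rightarrow> real"
  assumes "finite D" and u: "\<And>q. u q \<ge> 0" and m: "\<And>q. card {p \<in> D. \<tau> p = q} \<le> m"
  shows "(\<Sum>p\<in>D. u (\<tau> p)) \<le> m * (\<Sum>q\<in>\<tau> ` D. u q)"
proof -
  have "(\<Sum>p\<in>D. u (\<tau> p)) = (\<Sum>q\<in>\<tau> ` D. \<Sum>p\<in>{p \<in> D. \<tau> p = q}. u (\<tau> p))"
    by (rule sum.image_gen[OF assms(1)])
  also have "\<dots> = (\<Sum>q\<in>\<tau> ` D. real (card {p \<in> D. \<tau> p = q}) * u q)" by simp
  also have "\<dots> \<le> (\<Sum>q\<in>\<tau> ` D. m * u q)" using m u by (intro sum_mono mult_right_mono) auto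
  finally show ?thesis by (simp add: sum_distrib_left)
qed

locale wiener_window =
  fixes g :: "'d::finite signal"
  assumes g: "g \<in> L2b" and wiener: "wiener (\<lambda>z. cmod (ip g (tf_shift z g)))"
begin

abbreviation gram :: "'d phase_space \<Rightarrow> real" where
  "gram z \<equiv> cmod (ip g (tf_shift z g))"

lemma row_sum: "(\<Sum>p\<in>F. k (q - p)) = sum k ((\<lambda>p. q - p) ` F)" for k :: "'d phase_space \<Rightarrow> real"
  by (subst sum.reindex) (auto simp: inj_on_def)

lemma col_sum: "(\<Sum>q\<in>G. k (q - p)) = sum k ((\<lambda>q. q - p) ` G)" for k :: "'d phase_space \<Rightarrow> real"
  by (subst sum.reindex) (auto simp: inj_on_def)

text \<open>The Schur test for the Gram matrix bounds the synthesis operator, and duality gives the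
  analysis bound. The constant depends on \<open>N\<close> only, so it is a common upper frame bound
  for all late deformations.\<close>

lemma bessel:
  "\<exists>B>0. \<forall>F. finite F \<longrightarrow> nsep N F \<longrightarrow> (\<forall>f\<in>L2b. energy g F f \<le> B * nsq f)"
proof -
  obtain C where C: "C \<ge> 0" "\<And>\<Gamma>. finite \<Gamma> \<Longrightarrow> nsep N \<Gamma> \<Longrightarrow> sum gram \<Gamma> \<le> C"
    using wiener_bound[OF wiener] by blast
  show ?thesis
  proof (intro exI[of _ "C + 1"] conjI allI impI ballI)
    fix F :: "'d phase_space set" and f :: "'d signal" assume F: "finite F" "nsep N F" and f: "f \<in> L2b"
    show "energy g F f \<le> (C + 1) * nsq f"
    proof (rule analysis_bound_of_synth_bound[OF g _ f])
      fix c
      define S where "S = sqsum c F"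
      have S0: "S \<ge> 0" by (simp add: S_def sum_nonneg)
      define h where "h = synth g F c"
      have h: "h \<in> L2b" unfolding h_def by (rule synth_L2b[OF g])
      have "nsq h = cmod (ip h h)" by (simp add: ip_self)
      also have "ip h h = (\<Sum>p\<in>F. cnj (c p) * ip h (tf_shift p g))"
        using ip_synth_right[OF g h, of F c] by (simp add: h_def)
      also have "cmod \<dots> \<le> (\<Sum>q\<in>F. cmod (c q) * (\<Sum>p\<in>F. gram (q - p) * cmod (c p)))"
        unfolding h_def
        by (rule order_trans[OF norm_sum]) (auto simp: norm_mult intro!: sum_mono mult_left_mono cmod_ip_synth_le[OF g])
      finally have "(nsq h)\<^sup>2 \<le> (\<Sum>q\<in>F. cmod (c q) * (\<Sum>p\<in>F. gram (q - p) * cmod (c p)))\<^sup>2"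
        by (intro power_mono) auto
      also have "\<dots> \<le> S * (\<Sum>q\<in>F. (\<Sum>p\<in>F. gram (q - p) * cmod (c p))\<^sup>2)"
        unfolding S_def by (rule Cauchy_Schwarz_ineq_sum)
      also have "\<dots> \<le> S * (C * C * S)"
        unfolding S_def
      proof (intro mult_left_mono schur_test)
        show "(\<Sum>p\<in>F. gram (q - p)) \<le> C" for q
          unfolding row_sum[of gram] using F by (intro C nsep_reflect) auto
        show "(\<Sum>q\<in>F. gram (q - p)) \<le> C" for p
          unfolding col_sum[of gram] using F by (intro C nsep_translate) auto
      qed (use C(1) in \<open>auto simp: sum_nonneg\<close>)
      also have "\<dots> = (C * S)\<^sup>2" by (simp add: power2_eq_square mult_ac)
      finally have sq: "(nsq h)\<^sup>2 \<le> (C * S)\<^sup>2" .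
      have "nsq h \<le> C * S" by (rule power2_le_imp_le[OF sq]) (use C(1) S0 in simp)
      then show "nsq (synth g F c) \<le> (C + 1) * sqsum c F"
        using S0 by (simp add: h_def S_def distrib_right)
    qed (use C(1) in auto)
  qed (use C(1) in auto)
qed

text \<open>The commutator of a cutoff with the Gram matrix has entries of size at most
  \<open>min 1 (norm (q - p) / R) * gram (q - p)\<close>, because the cutoff has Lipschitz constant
  \<open>1 / R\<close>. The row and column sums are at most \<open>\<delta>\<close>, which is small
  for large \<open>R\<close>. The sets \<open>F\<close> and \<open>G\<close> are independent, so the
  estimate serves for testing on \<open>\<Lambda>\<close> and on its deformation.\<close>

lemma commutator_bound:
  assumes F: "finite F" "nsep N F" and G: "finite G" "nsep N G" and R: "R > 0"
    and Y: "finite Y" "\<And>z. card (Y \<inter> cball z (2 * R)) \<le> P"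
    and delta: "\<And>\<Gamma>. finite \<Gamma> \<Longrightarrow> nsep N \<Gamma> \<Longrightarrow> (\<Sum>z\<in>\<Gamma>. min 1 (norm z / R) * gram z) \<le> \<delta>" and "\<delta> \<ge> 0"
  shows "(\<Sum>y\<in>Y. \<Sum>q\<in>G. (cmod (of_real (cutoff R y q) * ip (synth g F c) (tf_shift q g)
            - ip (synth g F (\<lambda>p. of_real (cutoff R y p) * c p)) (tf_shift q g)))\<^sup>2)
         \<le> 2 * real P * \<delta>\<^sup>2 * sqsum c F"
proof -
  define m where "m = (\<lambda>z::'d phase_space. min 1 (norm z / R) * gram z)"
  have m0: "m z \<ge> 0" for z using R by (simp add: m_def)
  \<comment> \<open>An entry vanishes unless \<open>y\<close> is within \<open>2 * R\<close> of
    \<open>p\<close> or of \<open>q\<close>, so summing over the net costs at most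
    \<open>2 * P\<close> and not \<open>card Y\<close>. Having values 0 and 1, the marker survives
    the squaring in the Cauchy-Schwarz step.\<close>
  define I where "I = (\<lambda>y p q :: 'd phase_space. if y \<in> cball p (2 * R) \<or> y \<in> cball q (2 * R) then 1 else 0 :: real)"
  have I0: "I y p q \<ge> 0" "(I y p q)\<^sup>2 = I y p q" for y p q by (auto simp: I_def)
  have I_sum: "(\<Sum>y\<in>Y. I y p q) \<le> 2 * real P" for p q
  proof -
    have "(\<Sum>y\<in>Y. I y p q) \<le> (\<Sum>y\<in>Y. indicator (cball p (2 * R)) y + indicator (cball q (2 * R)) y)"
      by (intro sum_mono) (auto simp: I_def indicator_def)
    also have "\<dots> = real (card (Y \<inter> cball p (2 * R))) + real (card (Y \<inter> cball q (2 * R)))"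
      using Y(1) by (simp add: sum.distrib sum_indicator_real_card)
    also have "\<dots> \<le> real P + real P" using Y(2) by (intro add_mono) auto
    finally show ?thesis by simp
  qed
  have row: "(\<Sum>p\<in>F. m (q - p)) \<le> \<delta>" for q
    unfolding row_sum[of m] unfolding m_def using F by (intro delta nsep_reflect) auto
  have col: "(\<Sum>q\<in>G. m (q - p)) \<le> \<delta>" for p
    unfolding col_sum[of m] unfolding m_def using G by (intro delta nsep_translate) auto
  have summand: "(cmod (of_real (cutoff R y q) * ip (synth g F c) (tf_shift q g)
            - ip (synth g F (\<lambda>p. of_real (cutoff R y p) * c p)) (tf_shift q g)))\<^sup>2
       \<le> \<delta> * (\<Sum>p\<in>F. m (q - p) * ((cmod (c p))\<^sup>2 * I y p q))" for y q
  proof -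
    have "of_real (cutoff R y q) * ip (synth g F c) (tf_shift q g) - ip (synth g F (\<lambda>p. of_real (cutoff R y p) * c p)) (tf_shift q g)
      = (\<Sum>p\<in>F. of_real (cutoff R y q - cutoff R y p) * (c p * ip (tf_shift p g) (tf_shift q g)))"
      unfolding ip_synth_left[OF g L2b_tf_shift[OF g]]
      by (simp add: sum_distrib_left sum_subtractf[symmetric] algebra_simps)
    also have "cmod \<dots> \<le> (\<Sum>p\<in>F. m (q - p) * (cmod (c p) * I y p q))"
    proof (rule order_trans[OF norm_sum], rule sum_mono)
      fix p
      have "\<bar>cutoff R y q - cutoff R y p\<bar> \<le> min 1 (norm (q - p) / R) * I y p q"
      proof (cases "I y p q = 0")
        case True
        then have "dist p y > 2 * R" "dist q y > 2 * R" by (auto simp: I_def split: if_splits)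
        then show ?thesis using True by (simp add: cutoff_outside[OF R])
      next
        case False
        then show ?thesis using cutoff_lipschitz[OF R, of y q p] by (auto simp: I_def dist_norm split: if_splits)
      qed
      then have "\<bar>cutoff R y q - cutoff R y p\<bar> * (cmod (c p) * gram (q - p)) \<le> (min 1 (norm (q - p) / R) * I y p q) * (cmod (c p) * gram (q - p))"
        by (intro mult_right_mono) auto
      then show "cmod (of_real (cutoff R y q - cutoff R y p) * (c p * ip (tf_shift p g) (tf_shift q g))) \<le> m (q - p) * (cmod (c p) * I y p q)"
        unfolding norm_mult norm_of_real cmod_ip_tf_shift[OF g g] m_def by (simp add: mult_ac)
    qed
    finally have "(cmod (of_real (cutoff R y q) * ip (synth g F c) (tf_shift q g)
            - ip (synth g F (\<lambda>p. of_real (cutoff R y p) * c p)) (tf_shift q g)))\<^sup>2 \<le> (\<Sum>p\<in>F. m (q - p) * (cmod (c p) * I y p q))\<^sup>2"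
      by (intro power_mono) auto
    also have "\<dots> \<le> (\<Sum>p\<in>F. m (q - p)) * (\<Sum>p\<in>F. m (q - p) * (cmod (c p) * I y p q)\<^sup>2)"
      by (rule weighted_Cauchy_Schwarz_sum[OF m0])
    also have "\<dots> \<le> \<delta> * (\<Sum>p\<in>F. m (q - p) * (cmod (c p) * I y p q)\<^sup>2)"
      using m0 by (intro mult_right_mono row sum_nonneg) auto
    finally show ?thesis by (simp add: power_mult_distrib I0)
  qed
  have "(\<Sum>y\<in>Y. \<Sum>q\<in>G. (cmod (of_real (cutoff R y q) * ip (synth g F c) (tf_shift q g)
            - ip (synth g F (\<lambda>p. of_real (cutoff R y p) * c p)) (tf_shift q g)))\<^sup>2)
     \<le> (\<Sum>y\<in>Y. \<Sum>q\<in>G. \<delta> * (\<Sum>p\<in>F. m (q - p) * ((cmod (c p))\<^sup>2 * I y p q)))"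
    by (intro sum_mono summand)
  also have "\<dots> = \<delta> * (\<Sum>q\<in>G. \<Sum>p\<in>F. m (q - p) * (cmod (c p))\<^sup>2 * (\<Sum>y\<in>Y. I y p q))"
    unfolding sum_distrib_left by (subst sum_rotate) (simp add: mult_ac)
  also have "\<dots> \<le> \<delta> * (\<Sum>q\<in>G. \<Sum>p\<in>F. m (q - p) * (cmod (c p))\<^sup>2 * (2 * real P))"
    using m0 \<open>\<delta> \<ge> 0\<close> by (intro mult_left_mono sum_mono I_sum) auto
  also have "\<dots> = \<delta> * (2 * real P) * (\<Sum>p\<in>F. (\<Sum>q\<in>G. m (q - p)) * (cmod (c p))\<^sup>2)"
    by (simp add: sum_distrib_left sum_distrib_right sum.swap[of _ G] mult_ac)
  also have "\<dots> \<le> \<delta> * (2 * real P) * (\<Sum>p\<in>F. \<delta> * (cmod (c p))\<^sup>2)"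
    using \<open>\<delta> \<ge> 0\<close> by (intro mult_left_mono sum_mono mult_right_mono col) auto
  also have "\<dots> = 2 * real P * \<delta>\<^sup>2 * sqsum c F"
    by (simp add: sum_distrib_left power2_eq_square mult_ac)
  finally show ?thesis .
qed

text \<open>The comparison goes through the composed shift of \<open>g\<close>, first by
  \<open>u\<close> and then by \<open>z\<close>: it differs from \<open>tf_shift z g\<close> by a
  vector whose norm does not depend on \<open>z\<close>. For \<open>tf_shift (z + u) g\<close>
  itself a phase depending on \<open>z\<close> would spoil this; absolute values do not see the
  phase.\<close>

lemma ip_tf_shift_perturb:
  assumes h: "h \<in> L2b"
  shows "(cmod (ip h (tf_shift z g)))\<^sup>2 \<le> 2 * (cmod (ip h (tf_shift (z + u) g)))\<^sup>2 + 2 * (nsq h * nsq (\<lambda>t. tf_shift u g t - g t))"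
proof -
  have "tf_shift z (\<lambda>t. tf_shift u g t - g t) = (\<lambda>t. tf_shift z (tf_shift u g) t - tf_shift z g t)"
    by (simp add: tf_shift_chi right_diff_distrib)
  then have e: "ip h (tf_shift z (tf_shift u g)) - ip h (tf_shift z g) = ip h (tf_shift z (\<lambda>t. tf_shift u g t - g t))"
    using h by (simp add: ip_diff_right L2b_tf_shift g)
  have "(cmod (ip h (tf_shift z (\<lambda>t. tf_shift u g t - g t))))\<^sup>2 \<le> nsq h * nsq (\<lambda>t. tf_shift u g t - g t)"
    using ip_Cauchy_Schwarz_sq[OF h L2b_tf_shift[OF L2b_diff[OF L2b_tf_shift[OF g] g]], of z u]
    by (simp add: L2b_diff L2b_tf_shift g)
  then have "(cmod (ip h (tf_shift z g) - ip h (tf_shift z (tf_shift u g))))\<^sup>2 \<le> nsq h * nsq (\<lambda>t. tf_shift u g t - g t)"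
    unfolding e[symmetric] by (simp add: norm_minus_commute)
  then show ?thesis
    using cmod_diff_square_le[of "ip h (tf_shift z g)" "ip h (tf_shift z (tf_shift u g))"]
    by (simp add: cmod_ip_tf_shift_compose)
qed

text \<open>Near \<open>y\<close>, the deformed set is almost the translate of \<open>\<Lambda>\<close> by \<open>w = \<tau> p0 - p0\<close>.\<close>

lemma local_lower_bound:
  assumes fr: "frame_fin g \<Lambda> A B" and sep: "nsep N \<Lambda>"
    and F: "finite F" "F \<subseteq> \<Lambda>" and d: "\<And>p. p \<in> F \<Longrightarrow> dist p y > 2 * R \<Longrightarrow> d p = 0"
    and p0: "p0 \<in> \<Lambda>" "dist (\<tau> p0) y \<le> \<rho>"
    and tail: "\<And>\<Gamma>. finite \<Gamma> \<Longrightarrow> nsep N \<Gamma> \<Longrightarrow> (\<And>z. z \<in> \<Gamma> \<Longrightarrow> norm z > R2 - \<rho> - 2 * R) \<Longrightarrow> sum gram \<Gamma> \<le> s" and "s \<ge> 0"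
    and M2: "\<And>x. card (\<Lambda> \<inter> cball x R2) \<le> M2"
    and near: "\<And>p. p \<in> \<Lambda> \<Longrightarrow> norm (p - p0) \<le> R2 \<Longrightarrow> nsq (\<lambda>t. tf_shift ((\<tau> p - \<tau> p0) - (p - p0)) g t - g t) \<le> \<omega>"
    and "\<omega> \<ge> 0" and small: "2 * real M2 * \<omega> \<le> A / 2"
  shows "\<exists>D. finite D \<and> D \<subseteq> \<Lambda> \<and> A / 2 * nsq (synth g F d)
    \<le> 2 * (\<Sum>p\<in>D. (cmod (ip (synth g F d) (tf_shift (\<tau> p) g)))\<^sup>2) + s\<^sup>2 * sqsum d F"
proof -
  define h where "h = synth g F d"
  have h: "h \<in> L2b" unfolding h_def by (rule synth_L2b[OF g])
  define w where "w = \<tau> p0 - p0"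
  have "tf_shift (- w) h \<in> L2b" by (rule L2b_tf_shift[OF h])
  then obtain M where M: "finite M" "M \<subseteq> \<Lambda>"
    and low: "A * nsq (tf_shift (- w) h) \<le> (\<Sum>p\<in>M. (cmod (ip (tf_shift (- w) h) (tf_shift p g)))\<^sup>2)"
    using fr unfolding frame_fin_def by blast
  define D where "D = M \<inter> cball p0 R2"
  have D: "finite D" "D \<subseteq> \<Lambda>" using M by (auto simp: D_def)
  have finL: "D \<subseteq> \<Lambda> \<inter> cball p0 R2" using M by (auto simp: D_def)
  \<comment> \<open>\<open>M2\<close> bounds a cardinality, which is 0 for infinite sets; finiteness
    has to come from \<open>nsep\<close>.\<close>
  have cD: "real (card D) \<le> M2"
  proof (cases "finite (\<Lambda> \<inter> cball p0 R2)")
    case True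
    then show ?thesis using card_mono[OF True finL] M2[of p0] by linarith
  next
    case False
    obtain M' where "finite (\<Lambda> \<inter> cball p0 R2)"
      using nsep_card_cball[of N R2] sep by metis
    then show ?thesis using False by simp
  qed
  \<comment> \<open>Testing \<open>\<Lambda>\<close> on the signal shifted by \<open>- w\<close>
    amounts to testing the translate of \<open>\<Lambda>\<close> by \<open>w\<close> on
    \<open>h\<close>: the frame bounds are invariant under translation.\<close>
  have split: "A * nsq h \<le> (\<Sum>p\<in>D. (cmod (ip h (tf_shift (p + w) g)))\<^sup>2) + (\<Sum>p\<in>M - D. (cmod (ip h (tf_shift (p + w) g)))\<^sup>2)"
    using low M(1) sum.subset_diff[of D M "\<lambda>p. (cmod (ip h (tf_shift (p + w) g)))\<^sup>2"]
    by (simp add: cmod_ip_tf_shift[OF h g] h D_def)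
  have n: "(\<Sum>p\<in>D. (cmod (ip h (tf_shift (p + w) g)))\<^sup>2) \<le> 2 * (\<Sum>p\<in>D. (cmod (ip h (tf_shift (\<tau> p) g)))\<^sup>2) + A / 2 * nsq h"
  proof -
    have "(\<Sum>p\<in>D. (cmod (ip h (tf_shift (p + w) g)))\<^sup>2) \<le> (\<Sum>p\<in>D. 2 * (cmod (ip h (tf_shift (\<tau> p) g)))\<^sup>2 + 2 * (nsq h * \<omega>))"
    proof (rule sum_mono)
      fix p assume p: "p \<in> D"
      have "norm (p - p0) \<le> R2" "p \<in> \<Lambda>" using p D by (auto simp: D_def dist_norm norm_minus_commute)
      then have "nsq h * nsq (\<lambda>t. tf_shift ((\<tau> p - \<tau> p0) - (p - p0)) g t - g t) \<le> nsq h * \<omega>"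
        using near by (intro mult_left_mono) auto
      then show "(cmod (ip h (tf_shift (p + w) g)))\<^sup>2 \<le> 2 * (cmod (ip h (tf_shift (\<tau> p) g)))\<^sup>2 + 2 * (nsq h * \<omega>)"
        using ip_tf_shift_perturb[OF h, of "p + w" "(\<tau> p - \<tau> p0) - (p - p0)"] by (simp add: w_def)
    qed
    also have "\<dots> = 2 * (\<Sum>p\<in>D. (cmod (ip h (tf_shift (\<tau> p) g)))\<^sup>2) + real (card D) * (2 * (nsq h * \<omega>))"
      by (simp add: sum.distrib sum_distrib_left)
    also have "real (card D) * (2 * (nsq h * \<omega>)) \<le> real M2 * (2 * (nsq h * \<omega>))"
      using cD \<open>\<omega> \<ge> 0\<close> by (intro mult_right_mono) auto
    also have "\<dots> = (2 * real M2 * \<omega>) * nsq h" by simp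
    also have "\<dots> \<le> A / 2 * nsq h" using small by (intro mult_right_mono) auto
    finally show ?thesis by simp
  qed
  have f: "(\<Sum>p\<in>M - D. (cmod (ip h (tf_shift (p + w) g)))\<^sup>2) \<le> s\<^sup>2 * sqsum d F"
  proof -
    \<comment> \<open>Restricting to the points where \<open>d\<close> can be nonzero keeps all of
      them within \<open>2 * R\<close> of \<open>y\<close>, which makes the remaining interactions
      far ones.\<close>
    define F' where "F' = {p \<in> F. dist p y \<le> 2 * R}"
    have F': "finite F'" "F' \<subseteq> \<Lambda>" using F by (auto simp: F'_def)
    have hF': "h = synth g F' d"
      unfolding h_def synth_def using F d
      by (intro ext sum.mono_neutral_right) (auto simp: F'_def not_le)
    \<comment> \<open>The translated point \<open>q + w\<close> is farther than \<open>R2\<close>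
      from \<open>\<tau> p0 = p0 + w\<close>, while \<open>p\<close> is within \<open>2 * R\<close>
      of \<open>y\<close>, which is within \<open>\<rho>\<close> of
      \<open>\<tau> p0\<close>.\<close>
    have far: "norm ((q + w) - p) > R2 - \<rho> - 2 * R" if "q \<in> M - D" "p \<in> F'" for p q
    proof -
      have 1: "norm (q - p0) > R2" using that(1) by (auto simp: D_def dist_norm norm_minus_commute)
      have 2: "norm (p - y) \<le> 2 * R" using that(2) by (auto simp: F'_def dist_norm)
      have 3: "norm (y - \<tau> p0) \<le> \<rho>" using p0(2) by (simp add: dist_norm norm_minus_commute)
      have "q - p0 = ((q + w) - p) + ((p - y) + (y - \<tau> p0))" by (simp add: w_def)
      then have "norm (q - p0) \<le> norm ((q + w) - p) + norm ((p - y) + (y - \<tau> p0))" by (metis norm_triangle_ineq)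
      moreover have "norm ((p - y) + (y - \<tau> p0)) \<le> norm (p - y) + norm (y - \<tau> p0)" by (rule norm_triangle_ineq)
      ultimately show ?thesis using 1 2 3 by linarith
    qed
    have "(\<Sum>q\<in>M - D. (cmod (ip h (tf_shift (q + w) g)))\<^sup>2) \<le> (\<Sum>q\<in>M - D. (\<Sum>p\<in>F'. gram ((q + w) - p) * cmod (d p))\<^sup>2)"
      unfolding hF' by (intro sum_mono power_mono cmod_ip_synth_le[OF g]) auto
    also have "\<dots> \<le> s * s * sqsum d F'"
    proof (rule schur_test)
      fix q assume q: "q \<in> M - D"
      show "(\<Sum>p\<in>F'. gram ((q + w) - p)) \<le> s"
        unfolding row_sum[of gram]
        using F' far[OF q] by (intro tail nsep_reflect nsep_subset[OF sep]) auto
    next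
      fix p assume p: "p \<in> F'"
      have "(\<Sum>q\<in>M - D. gram ((q + w) - p)) = sum gram ((\<lambda>q. q - (p - w)) ` (M - D))"
        unfolding col_sum[of gram, symmetric] by (simp add: algebra_simps)
      also have "\<dots> \<le> s"
      proof (intro tail nsep_translate nsep_subset[OF sep])
        fix z assume "z \<in> (\<lambda>q. q - (p - w)) ` (M - D)"
        then obtain q where q: "q \<in> M - D" "z = (q + w) - p" by auto
        show "norm z > R2 - \<rho> - 2 * R" unfolding q(2) by (rule far[OF q(1) p])
      qed (use M in auto)
      finally show "(\<Sum>q\<in>M - D. gram ((q + w) - p)) \<le> s" .
    qed (use \<open>s \<ge> 0\<close> in auto)
    also have "\<dots> \<le> s * s * sqsum d F"
      using F by (intro mult_left_mono sum_mono2) (auto simp: F'_def)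
    finally show ?thesis by (simp add: power2_eq_square)
  qed
  show ?thesis
    using split n f D unfolding h_def[symmetric] by (intro exI[of _ D] conjI) auto
qed

text \<open>The quantity \<open>X\<close>, the sum of the \<open>nsq (h y)\<close>, links the two
  sets. The lower bound of \<open>\<Lambda>\<close> for \<open>f\<close>, cut into pieces, and its
  upper bound \<open>B\<close> for each piece give \<open>ineq1\<close>, which bounds
  \<open>nsq f\<close> by \<open>X\<close>. The local lower bounds give \<open>ineq2\<close>, which
  bounds \<open>X\<close> by energies over the deformed set, where undoing the cutoffs
  (\<open>ineq3\<close>) costs the overlap \<open>P\<close>. Eliminating \<open>X\<close> produces
  the factor \<open>4 * B / A\<close>.\<close>

lemma deformed_lower_bound:
  assumes fr: "frame_fin g \<Lambda> A B" and sep: "nsep N \<Lambda>" and sep_tau: "nsep N (\<tau> ` \<Lambda>)"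
    and mult: "\<And>q. finite {p \<in> \<Lambda>. \<tau> p = q} \<and> card {p \<in> \<Lambda>. \<tau> p = q} \<le> m" and R: "R > 0"
    and overlap: "\<And>(Y :: 'd phase_space set) z. finite Y \<Longrightarrow> (\<And>y y'. y \<in> Y \<Longrightarrow> y' \<in> Y \<Longrightarrow> y \<noteq> y' \<Longrightarrow> dist y y' \<ge> R) \<Longrightarrow> card (Y \<inter> cball z (2 * R)) \<le> P"
    and delta: "\<And>\<Gamma>. finite \<Gamma> \<Longrightarrow> nsep N \<Gamma> \<Longrightarrow> (\<Sum>z\<in>\<Gamma>. min 1 (norm z / R) * gram z) \<le> \<delta>" and "\<delta> \<ge> 0"
    and dense: "\<And>y. \<exists>p0\<in>\<Lambda>. dist (\<tau> p0) y \<le> \<rho>"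
    and tail: "\<And>\<Gamma>. finite \<Gamma> \<Longrightarrow> nsep N \<Gamma> \<Longrightarrow> (\<And>z. z \<in> \<Gamma> \<Longrightarrow> norm z > R2 - \<rho> - 2 * R) \<Longrightarrow> sum gram \<Gamma> \<le> s" and "s \<ge> 0"
    and M2: "\<And>x. card (\<Lambda> \<inter> cball x R2) \<le> M2"
    and near: "\<And>p q. p \<in> \<Lambda> \<Longrightarrow> q \<in> \<Lambda> \<Longrightarrow> norm (p - q) \<le> R2 \<Longrightarrow> nsq (\<lambda>t. tf_shift ((\<tau> p - \<tau> q) - (p - q)) g t - g t) \<le> \<omega>"
    and omega: "\<omega> \<ge> 0" "2 * real M2 * \<omega> \<le> A / 2"
    and F: "finite F" "F \<subseteq> \<Lambda>"
  shows "\<exists>G. finite G \<and> G \<subseteq> \<tau> ` \<Lambda> \<and> A * nsq (synth g F c)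
     \<le> (16 * B * real m * real P / A) * energy g G (synth g F c)
       + ((4 * B / A) * (8 * real m * real P * \<delta>\<^sup>2 + real P * s\<^sup>2) + 4 * real P * \<delta>\<^sup>2) * sqsum c F"
proof -
  have A: "A > 0" and B: "B > 0" using fr by (auto simp: frame_fin_def)
  define f where "f = synth g F c"
  have f: "f \<in> L2b" unfolding f_def by (rule synth_L2b[OF g])
  define C where "C = sqsum c F"
  have C0: "C \<ge> 0" by (simp add: C_def sum_nonneg)
  obtain M where M: "finite M" "M \<subseteq> \<Lambda>" and low: "A * nsq f \<le> energy g M f"
    using fr f unfolding frame_fin_def by blast
  \<comment> \<open>The net is taken inside \<open>M\<close>, since only the energy of
    \<open>f\<close> over \<open>M\<close> has to be covered by cutoffs. There are thus finitely
    many pieces.\<close>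
  obtain Y where Y: "Y \<subseteq> M" "\<And>y y'. y \<in> Y \<Longrightarrow> y' \<in> Y \<Longrightarrow> y \<noteq> y' \<Longrightarrow> dist y y' \<ge> R"
    and cov: "\<And>q. q \<in> M \<Longrightarrow> \<exists>y\<in>Y. dist q y < R"
    using maximal_separated_subset[OF M(1) R] by metis
  have finY: "finite Y" using finite_subset[OF Y(1) M(1)] .
  have YP: "card (Y \<inter> cball z (2 * R)) \<le> P" for z
    by (intro overlap finY) (rule Y(2))
  have cutoff_sum: "(\<Sum>y\<in>Y. (cutoff R y z)\<^sup>2) \<le> P" for z
  proof -
    have "(\<Sum>y\<in>Y. (cutoff R y z)\<^sup>2) \<le> (\<Sum>y\<in>Y. indicator (cball z (2 * R)) y)"
      using cutoff_outside[OF R, of z] by (intro sum_mono) (auto simp: indicator_def cutoff_sq_le not_le)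
    also have "\<dots> = real (card (Y \<inter> cball z (2 * R)))" by (rule sum_indicator_real_card[OF finY])
    also have "\<dots> \<le> real P" using YP by simp
    finally show ?thesis .
  qed
  define d where "d = (\<lambda>y p. of_real (cutoff R y p) * c p)"
  define h where "h = (\<lambda>y. synth g F (d y))"
  have h: "h y \<in> L2b" for y unfolding h_def by (rule synth_L2b[OF g])
  define X where "X = (\<Sum>y\<in>Y. nsq (h y))"
  define E where "E = (\<lambda>y q. of_real (cutoff R y q) * ip f (tf_shift q g) - ip (h y) (tf_shift q g))"
  \<comment> \<open>Needed twice: for \<open>M\<close> in \<open>\<Lambda>\<close> and for the set
    \<open>G\<close> in the deformation constructed below.\<close>
  have comm: "(\<Sum>y\<in>Y. \<Sum>q\<in>G. (cmod (E y q))\<^sup>2) \<le> 2 * real P * \<delta>\<^sup>2 * C" if "finite G" "nsep N G" for G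
    unfolding E_def f_def h_def d_def C_def
  proof (rule commutator_bound[OF F(1) nsep_subset[OF sep F(2)] that R finY YP _ \<open>\<delta> \<ge> 0\<close>])
    show "(\<Sum>z\<in>\<Gamma>. min 1 (norm z / R) * gram z) \<le> \<delta>" if "finite \<Gamma>" "nsep N \<Gamma>" for \<Gamma>
      using that by (rule delta)
  qed
  have ineq1: "A * nsq f \<le> 2 * B * X + 4 * real P * \<delta>\<^sup>2 * C"
  proof -
    have "energy g M f \<le> (\<Sum>q\<in>M. \<Sum>y\<in>Y. (cmod (of_real (cutoff R y q) * ip f (tf_shift q g)))\<^sup>2)"
    proof (rule sum_mono)
      fix q assume "q \<in> M"
      then obtain y where y: "y \<in> Y" "dist q y < R" using cov by blast
      have "(cmod (ip f (tf_shift q g)))\<^sup>2 = (cmod (of_real (cutoff R y q) * ip f (tf_shift q g)))\<^sup>2"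
        by (simp add: cutoff_inside[OF R y(2)])
      also have "\<dots> \<le> (\<Sum>y\<in>Y. (cmod (of_real (cutoff R y q) * ip f (tf_shift q g)))\<^sup>2)"
        by (rule member_le_sum[OF y(1) _ finY]) auto
      finally show "(cmod (ip f (tf_shift q g)))\<^sup>2 \<le> \<dots>" .
    qed
    also have "\<dots> = (\<Sum>y\<in>Y. \<Sum>q\<in>M. (cmod (of_real (cutoff R y q) * ip f (tf_shift q g)))\<^sup>2)"
      by (rule sum.swap)
    also have "\<dots> \<le> (\<Sum>y\<in>Y. \<Sum>q\<in>M. 2 * (cmod (ip (h y) (tf_shift q g)))\<^sup>2 + 2 * (cmod (E y q))\<^sup>2)"
      unfolding E_def by (intro sum_mono cmod_diff_square_le)
    also have "\<dots> = 2 * (\<Sum>y\<in>Y. \<Sum>q\<in>M. (cmod (ip (h y) (tf_shift q g)))\<^sup>2) + 2 * (\<Sum>y\<in>Y. \<Sum>q\<in>M. (cmod (E y q))\<^sup>2)"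
      by (simp add: sum.distrib sum_distrib_left)
    also have "\<dots> \<le> 2 * (\<Sum>y\<in>Y. B * nsq (h y)) + 2 * (2 * real P * \<delta>\<^sup>2 * C)"
      using fr h M comm[OF M(1) nsep_subset[OF sep M(2)]] unfolding frame_fin_def
      by (intro add_mono mult_left_mono sum_mono) auto
    finally show ?thesis using low by (simp add: X_def sum_distrib_left[symmetric])
  qed
  have "\<exists>D. finite D \<and> D \<subseteq> \<Lambda> \<and> A / 2 * nsq (h y)
    \<le> 2 * (\<Sum>p\<in>D. (cmod (ip (h y) (tf_shift (\<tau> p) g)))\<^sup>2) + s\<^sup>2 * (\<Sum>p\<in>F. (cmod (d y p))\<^sup>2)" for y
  proof -
    obtain p0 where p0: "p0 \<in> \<Lambda>" "dist (\<tau> p0) y \<le> \<rho>" using dense by blast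
    have d0: "d y p = 0" if "dist p y > 2 * R" for p using cutoff_outside[OF R that] by (simp add: d_def)
    show ?thesis unfolding h_def
    proof (rule local_lower_bound[where \<tau>=\<tau>, OF fr sep F _ p0 _ \<open>s \<ge> 0\<close> M2 _ omega])
      show "sum gram \<Gamma> \<le> s" if "finite \<Gamma>" "nsep N \<Gamma>" "\<And>z. z \<in> \<Gamma> \<Longrightarrow> norm z > R2 - \<rho> - 2 * R" for \<Gamma>
        using that by (rule tail)
    qed (use d0 near p0(1) in auto)
  qed
  then obtain D where D: "\<And>y. finite (D y)" "\<And>y. D y \<subseteq> \<Lambda>"
    and loc: "\<And>y. A / 2 * nsq (h y)
    \<le> 2 * (\<Sum>p\<in>D y. (cmod (ip (h y) (tf_shift (\<tau> p) g)))\<^sup>2) + s\<^sup>2 * (\<Sum>p\<in>F. (cmod (d y p))\<^sup>2)"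
    by metis
  define G where "G = (\<Union>y\<in>Y. \<tau> ` D y)"
  have G: "finite G" "G \<subseteq> \<tau> ` \<Lambda>"
    unfolding G_def by (intro finite_UN_I finY finite_imageI D(1)) (intro UN_least image_mono D(2))
  define S where "S = energy g G f"
  have ineq3: "(\<Sum>y\<in>Y. \<Sum>q\<in>G. (cmod (ip (h y) (tf_shift q g)))\<^sup>2) \<le> 2 * real P * S + 4 * real P * \<delta>\<^sup>2 * C"
  proof -
    have "(\<Sum>y\<in>Y. \<Sum>q\<in>G. (cmod (ip (h y) (tf_shift q g)))\<^sup>2)
       \<le> (\<Sum>y\<in>Y. \<Sum>q\<in>G. 2 * (cmod (of_real (cutoff R y q) * ip f (tf_shift q g)))\<^sup>2 + 2 * (cmod (E y q))\<^sup>2)"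
      unfolding E_def by (intro sum_mono) (metis cmod_diff_square_le norm_minus_commute)
    also have "\<dots> = 2 * (\<Sum>q\<in>G. (\<Sum>y\<in>Y. (cutoff R y q)\<^sup>2) * (cmod (ip f (tf_shift q g)))\<^sup>2) + 2 * (\<Sum>y\<in>Y. \<Sum>q\<in>G. (cmod (E y q))\<^sup>2)"
      by (simp add: sum.distrib sum_distrib_left sum_distrib_right norm_mult power_mult_distrib sum.swap[of _ Y])
    also have "\<dots> \<le> 2 * (\<Sum>q\<in>G. real P * (cmod (ip f (tf_shift q g)))\<^sup>2) + 2 * (2 * real P * \<delta>\<^sup>2 * C)"
      by (intro add_mono mult_left_mono sum_mono mult_right_mono cutoff_sum comm[OF G(1) nsep_subset[OF sep_tau G(2)]]) auto
    finally show ?thesis by (simp add: S_def sum_distrib_left mult.assoc)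
  qed
  have ineq2: "A / 2 * X \<le> 2 * (m * (2 * real P * S + 4 * real P * \<delta>\<^sup>2 * C)) + s\<^sup>2 * (real P * C)"
  proof -
    have "A / 2 * X = (\<Sum>y\<in>Y. A / 2 * nsq (h y))" unfolding X_def by (rule sum_distrib_left)
    also have "\<dots> \<le> (\<Sum>y\<in>Y. 2 * (\<Sum>p\<in>D y. (cmod (ip (h y) (tf_shift (\<tau> p) g)))\<^sup>2) + s\<^sup>2 * (\<Sum>p\<in>F. (cmod (d y p))\<^sup>2))"
      by (intro sum_mono loc)
    also have "\<dots> = 2 * (\<Sum>y\<in>Y. \<Sum>p\<in>D y. (cmod (ip (h y) (tf_shift (\<tau> p) g)))\<^sup>2) + s\<^sup>2 * (\<Sum>y\<in>Y. \<Sum>p\<in>F. (cmod (d y p))\<^sup>2)"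
      by (simp add: sum.distrib sum_distrib_left)
    also have "\<dots> \<le> 2 * (\<Sum>y\<in>Y. m * energy g G (h y)) + s\<^sup>2 * (real P * C)"
    proof (intro add_mono mult_left_mono sum_mono)
      fix y assume y: "y \<in> Y"
      have "card {p \<in> D y. \<tau> p = q} \<le> m" for q
      proof -
        have "{p \<in> D y. \<tau> p = q} \<subseteq> {p \<in> \<Lambda>. \<tau> p = q}" using D by blast
        then show ?thesis using mult[of q] card_mono order_trans by blast
      qed
      then have "(\<Sum>p\<in>D y. (cmod (ip (h y) (tf_shift (\<tau> p) g)))\<^sup>2) \<le> m * (\<Sum>q\<in>\<tau> ` D y. (cmod (ip (h y) (tf_shift q g)))\<^sup>2)"
        by (intro sum_image_le_mult D) auto
      also have "\<dots> \<le> m * energy g G (h y)"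
        using y by (intro mult_left_mono sum_mono2 G) (auto simp: G_def)
      finally show "(\<Sum>p\<in>D y. (cmod (ip (h y) (tf_shift (\<tau> p) g)))\<^sup>2) \<le> \<dots>" .
    next
      have "(\<Sum>y\<in>Y. \<Sum>p\<in>F. (cmod (d y p))\<^sup>2) = (\<Sum>p\<in>F. (\<Sum>y\<in>Y. (cutoff R y p)\<^sup>2) * (cmod (c p))\<^sup>2)"
        by (simp add: d_def norm_mult power_mult_distrib sum_distrib_right sum.swap[of _ Y])
      also have "\<dots> \<le> (\<Sum>p\<in>F. real P * (cmod (c p))\<^sup>2)"
        by (intro sum_mono mult_right_mono cutoff_sum) auto
      finally show "(\<Sum>y\<in>Y. \<Sum>p\<in>F. (cmod (d y p))\<^sup>2) \<le> real P * C" by (simp add: C_def sum_distrib_left)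
    qed auto
    also have "\<dots> \<le> 2 * (m * (2 * real P * S + 4 * real P * \<delta>\<^sup>2 * C)) + s\<^sup>2 * (real P * C)"
      unfolding sum_distrib_left[symmetric] by (intro add_right_mono mult_left_mono ineq3) auto
    finally show ?thesis .
  qed
  \<comment> \<open>Written so that \<open>ineq2\<close> can be inserted into
    \<open>ineq1\<close>.\<close>
  have "2 * B * X = (4 * B / A) * (A / 2 * X)" using A by simp
  also have "\<dots> \<le> (4 * B / A) * (2 * (m * (2 * real P * S + 4 * real P * \<delta>\<^sup>2 * C)) + s\<^sup>2 * (real P * C))"
    using A B by (intro mult_left_mono ineq2) auto
  finally have "A * nsq f \<le> (4 * B / A) * (2 * (m * (2 * real P * S + 4 * real P * \<delta>\<^sup>2 * C)) + s\<^sup>2 * (real P * C)) + 4 * real P * \<delta>\<^sup>2 * C"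
    using ineq1 by linarith
  also have "\<dots> = (16 * B * real m * real P / A) * S + ((4 * B / A) * (8 * real m * real P * \<delta>\<^sup>2 + real P * s\<^sup>2) + 4 * real P * \<delta>\<^sup>2) * C"
    using A by (simp add: field_simps)
  finally show ?thesis using G unfolding f_def S_def C_def by blast
qed

end

section \<open>Density of the frame set and of its deformations\<close>

context wiener_window
begin

text \<open>Beyond a radius \<open>R0\<close> the tail of \<open>gram\<close> is small and the
  weight is at most 1; inside it the weight is at most \<open>R0 / R\<close>.\<close>

lemma wiener_near_diagonal:
  assumes e: "e > 0"
  shows "\<exists>R>0. \<forall>\<Gamma>. finite \<Gamma> \<longrightarrow> nsep N \<Gamma> \<longrightarrow> (\<Sum>z\<in>\<Gamma>. min 1 (norm z / R) * gram z) \<le> e"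
proof -
  obtain C where C: "C \<ge> 0" "\<And>\<Gamma>. finite \<Gamma> \<Longrightarrow> nsep N \<Gamma> \<Longrightarrow> sum gram \<Gamma> \<le> C"
    using wiener_bound[OF wiener] by blast
  have e2: "e / 2 > 0" using e by simp
  obtain R0 where R0: "R0 > 0" "\<And>\<Gamma>. finite \<Gamma> \<Longrightarrow> nsep N \<Gamma> \<Longrightarrow> (\<And>z. z \<in> \<Gamma> \<Longrightarrow> norm z > R0) \<Longrightarrow> sum gram \<Gamma> \<le> e / 2"
    using wiener_tail[OF wiener e2, where N=N] by blast
  \<comment> \<open>This makes \<open>R0 / R * (C + 1)\<close> equal to
    \<open>e / 2\<close>.\<close>
  define R where "R = 2 * R0 * (C + 1) / e"
  have R: "R > 0" using e R0 C(1) by (simp add: R_def)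
  show ?thesis
  proof (intro exI[of _ R] conjI allI impI)
    fix \<Gamma> :: "'d phase_space set" assume G: "finite \<Gamma>" "nsep N \<Gamma>"
    have "(\<Sum>z\<in>\<Gamma>. min 1 (norm z / R) * gram z) \<le> (\<Sum>z\<in>\<Gamma>. R0 / R * gram z + (if norm z > R0 then gram z else 0))"
    proof (rule sum_mono)
      fix z :: "'d phase_space"
      show "min 1 (norm z / R) * gram z \<le> R0 / R * gram z + (if norm z > R0 then gram z else 0)"
      proof (cases "norm z > R0")
        case True
        have "min 1 (norm z / R) * gram z \<le> 1 * gram z" by (intro mult_right_mono) auto
        then show ?thesis using True R R0(1) by (simp add: add_increasing)
      next
        case False
        have "norm z / R \<le> R0 / R" using False R by (intro divide_right_mono) auto
        then have "min 1 (norm z / R) * gram z \<le> R0 / R * gram z" by (intro mult_right_mono) auto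
        then show ?thesis using False by simp
      qed
    qed
    also have "\<dots> = R0 / R * sum gram \<Gamma> + sum gram {z \<in> \<Gamma>. norm z > R0}"
      using G(1) by (simp add: sum.distrib sum_distrib_left sum.inter_filter)
    also have "\<dots> \<le> R0 / R * C + e / 2"
    proof (intro add_mono mult_left_mono)
      show "sum gram {z \<in> \<Gamma>. norm z > R0} \<le> e / 2" using G by (intro R0(2) nsep_subset[OF G(2)]) auto
    qed (use C(2)[OF G] R R0(1) in auto)
    also have "R0 / R * C \<le> e / 2"
    proof -
      have "R0 / R * C \<le> R0 / R * (C + 1)" using R R0(1) by (intro mult_left_mono) auto
      also have "\<dots> = e / 2"
      proof -
        define C' where "C' = C + 1"
        have "C' > 0" using C(1) by (simp add: C'_def)
        then show ?thesis unfolding R_def C'_def[symmetric] using R0(1) e by simp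
      qed
      finally show ?thesis .
    qed
    finally show "(\<Sum>z\<in>\<Gamma>. min 1 (norm z / R) * gram z) \<le> e" by simp
  qed (rule R)
qed

lemma gram_le: "gram z \<le> nsq g"
  using ip_Cauchy_Schwarz[OF g L2b_tf_shift[OF g]] by (simp add: g)

lemma gram_near_0:
  assumes pos: "nsq g > 0"
  shows "\<exists>r>0. \<forall>z. norm z < r \<longrightarrow> gram z \<ge> nsq g / 2"
proof -
  \<comment> \<open>\<open>nsq\<close> is a squared norm: the quarter becomes a half after the root
    in Cauchy-Schwarz.\<close>
  obtain r where r: "r > 0" "\<And>z. norm z < r \<Longrightarrow> nsq (\<lambda>t. tf_shift z g t - g t) < nsq g / 4"
    using nsq_tf_shift_continuous[OF g, of "nsq g / 4"] pos by auto
  have "gram z \<ge> nsq g / 2" if "norm z < r" for z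
  proof -
    have "(cmod (ip g (\<lambda>t. tf_shift z g t - g t)))\<^sup>2 \<le> nsq g * nsq (\<lambda>t. tf_shift z g t - g t)"
      by (intro ip_Cauchy_Schwarz_sq L2b_diff L2b_tf_shift g)
    also have "\<dots> \<le> nsq g * (nsq g / 4)" using r(2)[OF that] by (intro mult_left_mono) auto
    also have "\<dots> = (nsq g / 2)\<^sup>2" by (simp add: power2_eq_square)
    finally have sq: "(cmod (ip g (\<lambda>t. tf_shift z g t - g t)))\<^sup>2 \<le> (nsq g / 2)\<^sup>2" .
    have "cmod (ip g (\<lambda>t. tf_shift z g t - g t)) \<le> nsq g / 2"
      by (rule power2_le_imp_le[OF sq]) (use pos in simp)
    then have "cmod (ip g (tf_shift z g) - of_real (nsq g)) \<le> nsq g / 2"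
      by (simp add: ip_diff_right L2b_tf_shift g ip_self)
    moreover have "nsq g \<le> gram z + cmod (ip g (tf_shift z g) - of_real (nsq g))"
      using norm_triangle_ineq3[of "ip g (tf_shift z g)" "of_real (nsq g)"] by simp
    ultimately show ?thesis by linarith
  qed
  then show ?thesis using r(1) by blast
qed

text \<open>Test the upper bound on the window shifted to \<open>x\<close>: every point within
  \<open>r\<close> of \<open>x\<close> contributes at least \<open>(nsq g / 2)\<^sup>2\<close>, so
  there are at most \<open>4 * B / nsq g\<close> of them.\<close>

lemma frame_fin_nsep:
  assumes pos: "nsq g > 0" and fr: "frame_fin g \<Lambda> A B"
  shows "\<exists>N. nsep N \<Lambda>"
proof -
  have B: "B > 0" using fr by (simp add: frame_fin_def)
  obtain r where r: "r > 0" "\<And>z. norm z < r \<Longrightarrow> gram z \<ge> nsq g / 2" using gram_near_0[OF pos] by blast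
  define k where "k = nat \<lceil>4 * B / nsq g\<rceil>"
  have card: "card M \<le> k" if M: "M \<subseteq> \<Lambda> \<inter> ball x r" "finite M" for M x
  proof -
    have "real (card M) * (nsq g / 2)\<^sup>2 = (\<Sum>p\<in>M. (nsq g / 2)\<^sup>2)" by simp
    also have "\<dots> \<le> (\<Sum>p\<in>M. (cmod (ip (tf_shift x g) (tf_shift p g)))\<^sup>2)"
    proof (intro sum_mono power_mono)
      fix p assume "p \<in> M"
      then have "norm (p - x) < r" using M by (auto simp: dist_norm norm_minus_commute)
      then show "nsq g / 2 \<le> cmod (ip (tf_shift x g) (tf_shift p g))"
        unfolding cmod_ip_tf_shift[OF g g] by (rule r(2))
    qed (use pos in auto)
    also have "\<dots> \<le> B * nsq (tf_shift x g)"
      using fr M L2b_tf_shift[OF g] unfolding frame_fin_def by blast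
    finally have "real (card M) * (nsq g * nsq g) \<le> (4 * B) * nsq g" by (simp add: g power2_eq_square)
    then have "real (card M) * nsq g \<le> 4 * B" using pos by (simp add: mult.assoc[symmetric])
    then have "real (card M) \<le> 4 * B / nsq g" using pos by (simp add: field_simps)
    then show ?thesis unfolding k_def by linarith
  qed
  have "finite (\<Lambda> \<inter> ball x r) \<and> card (\<Lambda> \<inter> ball x r) \<le> k" for x
    by (rule finite_if_finite_subsets_card_bdd) (rule card)
  then show ?thesis using nsep_of_small_balls[OF r(1)] by blast
qed

text \<open>Test the lower bound on the window shifted to \<open>z\<close>: were
  \<open>\<Lambda>\<close> to miss a large ball about \<open>z\<close>, the tail of
  \<open>gram\<close> would leave too little energy.\<close>

lemma frame_fin_relatively_dense:
  assumes pos: "nsq g > 0" and fr: "frame_fin g \<Lambda> A B" and sep: "nsep N \<Lambda>"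
  shows "\<exists>\<rho>>0. \<forall>z. \<exists>p\<in>\<Lambda>. dist p z \<le> \<rho>"
proof -
  have A: "A / 2 > 0" using fr by (simp add: frame_fin_def)
  obtain R where R: "R > 0" "\<And>\<Gamma>. finite \<Gamma> \<Longrightarrow> nsep N \<Gamma> \<Longrightarrow> (\<And>z. z \<in> \<Gamma> \<Longrightarrow> norm z > R) \<Longrightarrow> sum gram \<Gamma> \<le> A / 2"
    using wiener_tail[OF wiener A, where N=N] by blast
  have "\<exists>p\<in>\<Lambda>. dist p z \<le> R" for z
  proof (rule ccontr)
    assume "\<not> ?thesis"
    then have far: "norm (p - z) > R" if "p \<in> \<Lambda>" for p using that by (auto simp: dist_norm not_le)
    obtain M where M: "finite M" "M \<subseteq> \<Lambda>" "A * nsq (tf_shift z g) \<le> (\<Sum>p\<in>M. (cmod (ip (tf_shift z g) (tf_shift p g)))\<^sup>2)"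
      using fr L2b_tf_shift[OF g] unfolding frame_fin_def by blast
    have "A * nsq g \<le> (\<Sum>p\<in>M. (gram (p - z))\<^sup>2)" using M(3) by (simp add: cmod_ip_tf_shift[OF g g] g)
    also have "\<dots> \<le> (\<Sum>p\<in>M. nsq g * gram (p - z))"
      unfolding power2_eq_square by (intro sum_mono mult_right_mono gram_le) auto
    also have "\<dots> = nsq g * sum gram ((\<lambda>p. p - z) ` M)"
      unfolding col_sum[of gram, symmetric] by (simp add: sum_distrib_left)
    also have "\<dots> \<le> nsq g * (A / 2)"
    proof (intro mult_left_mono R(2) nsep_translate nsep_subset[OF sep M(2)])
      fix x assume "x \<in> (\<lambda>p. p - z) ` M"
      then show "norm x > R" using far M(2) by blast
    qed (use M in auto)
    finally show False using pos A by (simp add: mult.commute)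
  qed
  then show ?thesis using R(1) by blast
qed

end

text \<open>A greedy walk: as long as \<open>\<tau> p\<close> is far from \<open>y\<close>, one replaces \<open>p\<close> by a point of \<open>\<Lambda>\<close>
  near \<open>p + c *\<^sub>R (y - \<tau> p) / norm (y - \<tau> p)\<close> and gets closer to \<open>y\<close> by at least \<open>1\<close>.\<close>

lemma deformed_relatively_dense:
  fixes \<Lambda> :: "'a::real_normed_vector set"
  assumes \<rho>: "\<rho> > 0" and dense: "\<And>z. \<exists>p\<in>\<Lambda>. dist p z \<le> \<rho>"
    and lip: "\<And>p q. p \<in> \<Lambda> \<Longrightarrow> q \<in> \<Lambda> \<Longrightarrow> norm (p - q) \<le> 3 * \<rho> + 2 \<Longrightarrow> norm ((\<tau> p - \<tau> q) - (p - q)) \<le> 1"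
  shows "\<exists>p\<in>\<Lambda>. dist (\<tau> p) y \<le> 2 * \<rho> + 2"
proof -
  \<comment> \<open>A jump aims at length \<open>c\<close>, loses at most \<open>\<rho>\<close> to
    the choice of a point of \<open>\<Lambda>\<close> and at most 1 to the deformation, so the gain
    is at least \<open>\<rho> + 1\<close>. The longest jump has length
    \<open>c + \<rho> = 3 * \<rho> + 2\<close>, the range in which \<open>lip\<close> is
    assumed.\<close>
  define c where "c = 2 * \<rho> + 2"
  have c: "c > 0" using \<rho> by (simp add: c_def)
  have "\<exists>p\<in>\<Lambda>. dist (\<tau> p) y \<le> c" if "p \<in> \<Lambda>" "dist (\<tau> p) y \<le> c + real k" for k p
    using that
  proof (induction k arbitrary: p)
    case (Suc k)
    define D where "D = norm (y - \<tau> p)"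
    have D: "D \<le> c + real k + 1" using Suc.prems(2) by (simp add: D_def dist_norm norm_minus_commute)
    show ?case
    proof (cases "D \<le> c")
      case True
      then show ?thesis using Suc.prems(1) by (auto simp: D_def dist_norm norm_minus_commute)
    next
      case False
      then have Dc: "D > c" by simp
      define v where "v = (c / D) *\<^sub>R (y - \<tau> p)"
      have D0: "D > 0" using Dc c by linarith
      have nv: "norm v = c" using D0 c by (simp add: v_def D_def[symmetric])
      obtain q where q: "q \<in> \<Lambda>" "dist q (p + v) \<le> \<rho>" using dense by blast
      have n1: "norm (q - p - v) \<le> \<rho>" using q(2) by (simp add: dist_norm algebra_simps)
      have "norm (q - p) \<le> norm (q - p - v) + norm v" using norm_triangle_ineq[of "q - p - v" v] by simp
      then have "norm (q - p) \<le> 3 * \<rho> + 2" using n1 nv by (simp add: c_def)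
      then have n2: "norm ((\<tau> q - \<tau> p) - (q - p)) \<le> 1" using lip q(1) Suc.prems(1) by blast
      \<comment> \<open>The remaining way after an ideal jump, the error in choosing
        \<open>q\<close>, and the error of the deformation.\<close>
      have "y - \<tau> q = (1 - c / D) *\<^sub>R (y - \<tau> p) - (q - p - v) - ((\<tau> q - \<tau> p) - (q - p))"
        by (simp add: v_def algebra_simps)
      then have "norm (y - \<tau> q) \<le> norm ((1 - c / D) *\<^sub>R (y - \<tau> p)) + norm (q - p - v) + norm ((\<tau> q - \<tau> p) - (q - p))"
        by (metis norm_triangle_ineq4 add_right_mono order_trans)
      also have "norm ((1 - c / D) *\<^sub>R (y - \<tau> p)) = (1 - c / D) * D"
        unfolding norm_scaleR D_def[symmetric] using D0 Dc by simp
      also have "(1 - c / D) * D = D - c" using D0 by (simp add: left_diff_distrib)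
      finally have "norm (y - \<tau> q) \<le> c + real k" using n1 n2 D by (simp add: c_def) (use \<rho> in linarith)
      then show ?thesis using Suc.IH[OF q(1)] by (simp add: dist_norm norm_minus_commute)
    qed
  qed auto
  moreover obtain p where "p \<in> \<Lambda>" using dense by blast
  moreover obtain k where "dist (\<tau> p) y - c \<le> real k" using real_arch_simple by blast
  ultimately show ?thesis unfolding c_def[symmetric] by (smt (verit))
qed

lemma lipschitz_deformation_eventually:
  assumes "lipschitz_deformation \<Lambda> \<Lambda>s \<tau>" "R > 0" "e > 0"
  shows "\<forall>\<^sub>F n in sequentially. \<forall>p\<in>\<Lambda>. \<forall>q\<in>\<Lambda>. norm (p - q) \<le> R \<longrightarrow> norm ((\<tau> n p - \<tau> n q) - (p - q)) < e"
proof -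
  let ?S = "{(p, q). p \<in> \<Lambda> \<and> q \<in> \<Lambda> \<and> norm (p - q) \<le> R}"
  have "(\<lambda>n. SUP (p, q)\<in>?S. ennreal (norm ((\<tau> n p - \<tau> n q) - (p - q)))) \<longlonglongrightarrow> 0"
    using assms unfolding lipschitz_deformation_def by blast
  then have "\<forall>\<^sub>F n in sequentially. (SUP (p, q)\<in>?S. ennreal (norm ((\<tau> n p - \<tau> n q) - (p - q)))) < ennreal e"
    using \<open>e > 0\<close> by (intro order_tendstoD) auto
  then show ?thesis
  proof eventually_elim
    case (elim n)
    show ?case
    proof (intro ballI impI)
      fix p q assume "p \<in> \<Lambda>" "q \<in> \<Lambda>" "norm (p - q) \<le> R"
      then have "(p, q) \<in> ?S" by simp
      from SUP_upper[OF this, of "\<lambda>(p, q). ennreal (norm ((\<tau> n p - \<tau> n q) - (p - q)))"]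
      have "ennreal (norm ((\<tau> n p - \<tau> n q) - (p - q))) < ennreal e" using elim by simp
      then show "norm ((\<tau> n p - \<tau> n q) - (p - q)) < e" using \<open>e > 0\<close> by (simp add: ennreal_less_iff)
    qed
  qed
qed

section \<open>Stability under Lipschitz deformation\<close>

lemma frame_fin_window_nonzero:
  fixes g :: "'d::finite signal"
  assumes g: "g \<in> L2b" and fr: "frame_fin g \<Lambda> A B"
  shows "nsq g > 0"
proof (rule ccontr)
  assume "\<not> nsq g > 0"
  then have 0: "nsq g = 0" using nsq_nonneg[of g] by linarith
  have "ip gauss (tf_shift p g) = 0" for p
    using ip_Cauchy_Schwarz_sq[OF gauss_L2b L2b_tf_shift[OF g], of p] 0 g by simp
  moreover have "\<exists>M. finite M \<and> M \<subseteq> \<Lambda> \<and> A * nsq (gauss :: 'd signal) \<le> energy g M gauss"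
  proof -
    have "\<forall>f\<in>L2b. \<exists>M. finite M \<and> M \<subseteq> \<Lambda> \<and> A * nsq f \<le> energy g M f"
      using fr unfolding frame_fin_def by (elim conjE)
    then show ?thesis using gauss_L2b by (rule bspec)
  qed
  moreover have "A > 0" using fr by (simp add: frame_fin_def)
  ultimately show False using nsq_gauss_pos[where 'd='d] by (simp add: mult_le_0_iff)
qed

context wiener_window
begin

text \<open>The order of the choices is what matters: \<open>N\<close>, \<open>m\<close>,
  \<open>P\<close> and \<open>B'\<close> come from the separation alone; then
  \<open>\<epsilon>\<close> from these and the frame bounds, \<open>K\<close> from
  \<open>\<epsilon>\<close>, the tolerance \<open>s\<close> from \<open>K\<close>, the cutoff radius
  \<open>R\<close> from \<open>s\<close>, the window \<open>R2\<close> from \<open>R\<close>, the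
  permitted distortion \<open>\<omega>\<close> from the count in the window, and only then
  \<open>n\<close>. The resulting frame bounds do not depend on \<open>n\<close>.\<close>

theorem frame_fin_deformation:
  assumes fr: "frame_fin g \<Lambda> A B" and AB: "A \<le> B" and lip: "lipschitz_deformation \<Lambda> \<Lambda>s \<tau>"
  shows "\<forall>\<^sub>F n in sequentially. \<exists>A' B'. frame_fin g (\<Lambda>s n) A' B'"
proof -
  have A: "A > 0" and B: "B > 0" using fr by (auto simp: frame_fin_def)
  have pos: "nsq g > 0" by (rule frame_fin_window_nonzero[OF g fr])
  obtain N0 where N0: "nsep N0 \<Lambda>" using frame_fin_nsep[OF pos fr] by blast
  obtain \<rho>0 where \<rho>0: "\<rho>0 > 0" "\<And>z. \<exists>p\<in>\<Lambda>. dist p z \<le> \<rho>0"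
    using frame_fin_relatively_dense[OF pos fr N0] by blast
  \<comment> \<open>Two points in a unit ball are at distance at most 2. With this radius the second
    Lipschitz condition bounds, uniformly in \<open>n\<close>, the number of points of
    \<open>\<Lambda>\<close> that are sent into one unit ball.\<close>
  obtain R' n0 where n0: "n0 \<ge> 1" "\<And>n p q. n \<ge> n0 \<Longrightarrow> p \<in> \<Lambda> \<Longrightarrow> q \<in> \<Lambda> \<Longrightarrow> norm (\<tau> n p - \<tau> n q) \<le> 2 \<Longrightarrow> norm (p - q) \<le> R'"
  proof -
    have "\<forall>R>0. \<exists>R'>0. \<exists>n\<^sub>0\<ge>1. \<forall>n\<ge>n\<^sub>0. \<forall>p\<in>\<Lambda>. \<forall>q\<in>\<Lambda>. norm (\<tau> n p - \<tau> n q) \<le> R \<longrightarrow> norm (p - q) \<le> R'"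
      using lip unfolding lipschitz_deformation_def by (elim conjE)
    then obtain R' n0 where "n0 \<ge> 1" "\<forall>n\<ge>n0. \<forall>p\<in>\<Lambda>. \<forall>q\<in>\<Lambda>. norm (\<tau> n p - \<tau> n q) \<le> 2 \<longrightarrow> norm (p - q) \<le> R'"
      by (meson zero_less_numeral)
    then show ?thesis by (intro that) auto
  qed
  obtain m where m: "\<And>x. finite (\<Lambda> \<inter> cball x R') \<and> card (\<Lambda> \<inter> cball x R') \<le> m"
    using nsep_card_cball[where 'a="'d phase_space", of N0 R'] N0 by metis
  have cluster: "finite {p \<in> \<Lambda>. \<tau> n p \<in> S} \<and> card {p \<in> \<Lambda>. \<tau> n p \<in> S} \<le> m"
    if n: "n \<ge> n0" and S: "\<And>x y. x \<in> S \<Longrightarrow> y \<in> S \<Longrightarrow> dist x y \<le> 2" for n S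
  proof (cases "{p \<in> \<Lambda>. \<tau> n p \<in> S} = {}")
    case True
    show ?thesis unfolding True by simp
  next
    case False
    then obtain q where q: "q \<in> \<Lambda>" "\<tau> n q \<in> S" by blast
    have sub: "{p \<in> \<Lambda>. \<tau> n p \<in> S} \<subseteq> \<Lambda> \<inter> cball q R'"
    proof
      fix p assume "p \<in> {p \<in> \<Lambda>. \<tau> n p \<in> S}"
      then have p: "p \<in> \<Lambda>" "\<tau> n p \<in> S" by auto
      have "norm (\<tau> n q - \<tau> n p) \<le> 2" using S[OF q(2) p(2)] by (simp add: dist_norm)
      then have "norm (q - p) \<le> R'" by (rule n0(2)[OF n q(1) p(1)])
      then show "p \<in> \<Lambda> \<inter> cball q R'" using p(1) by (simp add: dist_norm)
    qed
    have "card {p \<in> \<Lambda>. \<tau> n p \<in> S} \<le> card (\<Lambda> \<inter> cball q R')" using m by (intro card_mono[OF _ sub]) auto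
    then show ?thesis using finite_subset[OF sub] m[of q] by simp
  qed
  have sep_image: "nsep m (\<tau> n ` \<Lambda>)" if n: "n \<ge> n0" for n
    unfolding nsep_def
  proof
    fix x :: "'d phase_space"
    have S: "dist a b \<le> 2" if "a \<in> ball x 1" "b \<in> ball x 1" for a b
      using that dist_triangle[of a b x] by (simp add: dist_commute)
    have eq: "\<tau> n ` \<Lambda> \<inter> ball x 1 = \<tau> n ` {p \<in> \<Lambda>. \<tau> n p \<in> ball x 1}" by blast
    have "finite {p \<in> \<Lambda>. \<tau> n p \<in> ball x 1} \<and> card {p \<in> \<Lambda>. \<tau> n p \<in> ball x 1} \<le> m"
      by (rule cluster[OF n S])
    then show "finite (\<tau> n ` \<Lambda> \<inter> ball x 1) \<and> card (\<tau> n ` \<Lambda> \<inter> ball x 1) \<le> m"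
      unfolding eq using card_image_le[of "{p \<in> \<Lambda>. \<tau> n p \<in> ball x 1}" "\<tau> n"] by auto
  qed
  have mult: "finite {p \<in> \<Lambda>. \<tau> n p = q} \<and> card {p \<in> \<Lambda>. \<tau> n p = q} \<le> m" if n: "n \<ge> n0" for n q
    using cluster[OF n, of "{q}"] by simp
  \<comment> \<open>One count for \<open>\<Lambda>\<close> and for all its late
    deformations.\<close>
  define N where "N = max N0 m"
  have mono: "nsep N \<Gamma>" if "nsep k \<Gamma>" "k \<le> N" for k and \<Gamma> :: "'d phase_space set"
    using that unfolding nsep_def by (meson order_trans)
  have sep: "nsep N \<Lambda>" using N0 by (rule mono) (simp add: N_def)
  have sepn: "nsep N (\<tau> n ` \<Lambda>)" if "n \<ge> n0" for n using sep_image[OF that] by (rule mono) (simp add: N_def)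
  obtain P where P: "\<And>(Y :: 'd phase_space set) R z. R > 0 \<Longrightarrow> (\<And>y y'. y \<in> Y \<Longrightarrow> y' \<in> Y \<Longrightarrow> y \<noteq> y' \<Longrightarrow> dist y y' \<ge> R)
    \<Longrightarrow> finite (Y \<inter> cball z (2 * R)) \<and> card (Y \<inter> cball z (2 * R)) \<le> P"
    using separated_card_cball[where 'a="'d phase_space"] by blast
  obtain B' where B': "B' > 0" "\<And>F f. finite F \<Longrightarrow> nsep N F \<Longrightarrow> f \<in> L2b \<Longrightarrow> energy g F f \<le> B' * nsq f"
    using bessel[of N] by blast
  define a1 where "a1 = 16 * B * real m * real P / A"
  have a1: "a1 \<ge> 0" using A B by (simp add: a1_def)
  \<comment> \<open>The bound \<open>1/4\<close> lets the norm of \<open>f\<close> be recovered from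
    that of its approximation \<open>h\<close>; the other makes the effect of \<open>f - h\<close>
    on the energy, \<open>8 * a1 * B' * \<epsilon>\<close>, at most \<open>A / 4\<close>.\<close>
  define \<epsilon> where "\<epsilon> = min (1/4) (A / (32 * (a1 * B' + 1)))"
  have \<epsilon>: "\<epsilon> > 0"
    unfolding \<epsilon>_def using A a1 B'(1) by (auto intro!: divide_pos_pos add_nonneg_pos)
  have \<epsilon>_le: "\<epsilon> \<le> 1/4" unfolding \<epsilon>_def by (rule min.cobounded1)
  have \<epsilon>2: "8 * a1 * B' * \<epsilon> \<le> A / 4"
  proof -
    have q: "a1 * B' + 1 > 0" using a1 B'(1) by (simp add: add_nonneg_pos)
    have le: "\<epsilon> \<le> A / (32 * (a1 * B' + 1))" unfolding \<epsilon>_def by (rule min.cobounded2)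
    have "8 * a1 * B' * \<epsilon> = (8 * (a1 * B')) * \<epsilon>" by simp
    also have "\<dots> \<le> (8 * (a1 * B' + 1)) * (A / (32 * (a1 * B' + 1)))"
      using \<epsilon> a1 B'(1) by (intro mult_mono le) auto
    also have "\<dots> = A / 4"
    proof -
      define x where "x = a1 * B' + 1"
      have "x > 0" using q by (simp add: x_def)
      then show ?thesis unfolding x_def[symmetric] by simp
    qed
    finally show ?thesis .
  qed
  obtain K where K: "K > 0" "\<And>f. f \<in> L2b \<Longrightarrow> \<exists>F c. finite F \<and> F \<subseteq> \<Lambda> \<and> nsq (\<lambda>t. f t - synth g F c t) \<le> \<epsilon> * nsq f
     \<and> sqsum c F \<le> K * nsq f"
    using frame_fin_approx[OF g fr AB \<epsilon>] by blast
  \<comment> \<open>The factor of \<open>s\<^sup>2\<close> in the error of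
    \<open>deformed_lower_bound\<close> when the commutator tolerance \<open>\<delta>\<close> is
    also taken to be \<open>s\<close>.\<close>
  define \<kappa> where "\<kappa> = (4 * B / A) * (8 * real m * real P + real P) + 4 * real P"
  have \<kappa>: "\<kappa> \<ge> 0" using A B by (simp add: \<kappa>_def)
  \<comment> \<open>Solves \<open>4 * ((\<kappa> + 1) * s\<^sup>2) * K = A / 4\<close>, so that the
    localisation error is absorbed as well.\<close>
  define s where "s = sqrt (A / (16 * K * (\<kappa> + 1)))"
  have s: "s > 0" using A K(1) \<kappa> by (simp add: s_def)
  have s2: "4 * (\<kappa> * s\<^sup>2) * K \<le> A / 4"
  proof -
    have "s\<^sup>2 = A / (16 * K * (\<kappa> + 1))" using A K(1) \<kappa> by (simp add: s_def)
    then have "s\<^sup>2 * (16 * K * (\<kappa> + 1)) = A" using K(1) \<kappa> by simp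
    then have "4 * ((\<kappa> + 1) * s\<^sup>2) * K = A / 4" by (simp add: algebra_simps)
    moreover have "4 * (\<kappa> * s\<^sup>2) * K \<le> 4 * ((\<kappa> + 1) * s\<^sup>2) * K" using K(1) by (intro mult_right_mono mult_left_mono) auto
    ultimately show ?thesis by simp
  qed
  obtain R where R: "R > 0" "\<And>\<Gamma>. finite \<Gamma> \<Longrightarrow> nsep N \<Gamma> \<Longrightarrow> (\<Sum>z\<in>\<Gamma>. min 1 (norm z / R) * gram z) \<le> s"
    using wiener_near_diagonal[OF s, of N] by blast
  obtain R3 where R3: "R3 > 0" "\<And>\<Gamma>. finite \<Gamma> \<Longrightarrow> nsep N \<Gamma> \<Longrightarrow> (\<And>z. z \<in> \<Gamma> \<Longrightarrow> norm z > R3) \<Longrightarrow> sum gram \<Gamma> \<le> s"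
    using wiener_tail[OF wiener s, where N=N] by blast
  define \<rho> where "\<rho> = 2 * \<rho>0 + 2"
  \<comment> \<open>The distance \<open>R2 - \<rho> - 2 * R\<close> left for far interactions is
    then exactly the tail radius \<open>R3\<close>.\<close>
  define R2 where "R2 = R3 + \<rho> + 2 * R"
  have R2: "R2 > 0" using R3(1) \<rho>0(1) R(1) by (simp add: R2_def \<rho>_def)
  obtain M2 where M2: "\<And>x. card (\<Lambda> \<inter> cball x R2) \<le> M2"
    using nsep_card_cball[where 'a="'d phase_space", of N R2] sep by metis
  define \<omega> where "\<omega> = A / (4 * (real M2 + 1))"
  have \<omega>: "\<omega> > 0" using A by (simp add: \<omega>_def)
  have \<omega>2: "2 * real M2 * \<omega> \<le> A / 2"
  proof -
    have "2 * real M2 * \<omega> \<le> 2 * (real M2 + 1) * \<omega>" using \<omega> by (intro mult_right_mono) auto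
    also have "\<dots> = A / 2"
    proof -
      define q where "q = real M2 + 1"
      have "q > 0" by (simp add: q_def)
      then show ?thesis unfolding \<omega>_def q_def[symmetric] by simp
    qed
    finally show ?thesis .
  qed
  obtain d where d: "d > 0" "\<And>z. norm z < d \<Longrightarrow> nsq (\<lambda>t. tf_shift z g t - g t) < \<omega>"
    using nsq_tf_shift_continuous[OF g \<omega>] by blast
  have L: "3 * \<rho>0 + 2 > 0" using \<rho>0(1) by simp
  have images: "\<Lambda>s n = \<tau> n ` \<Lambda>" if "n \<ge> 1" for n
    using lip that unfolding lipschitz_deformation_def deformation_def by blast
  show ?thesis
    using lipschitz_deformation_eventually[OF lip L zero_less_one] lipschitz_deformation_eventually[OF lip R2 d(1)]
      eventually_ge_at_top[of n0]
  proof eventually_elim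
    case (elim n)
    define T where "T = \<tau> n"
    have n: "n \<ge> n0" by fact
    have dense: "\<exists>p\<in>\<Lambda>. dist (T p) y \<le> \<rho>" for y
      unfolding \<rho>_def
    proof (rule deformed_relatively_dense[OF \<rho>0])
      show "norm ((T p - T q) - (p - q)) \<le> 1" if "p \<in> \<Lambda>" "q \<in> \<Lambda>" "norm (p - q) \<le> 3 * \<rho>0 + 2" for p q
        using elim(1) that unfolding T_def by (meson less_imp_le)
    qed
    have near: "nsq (\<lambda>t. tf_shift ((T p - T q) - (p - q)) g t - g t) \<le> \<omega>" if "p \<in> \<Lambda>" "q \<in> \<Lambda>" "norm (p - q) \<le> R2" for p q
    proof -
      have "norm ((T p - T q) - (p - q)) < d" using elim(2) that unfolding T_def by blast
      then show ?thesis using d(2) less_imp_le by blast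
    qed
    have "frame_fin g (T ` \<Lambda>) (A / (16 * (a1 + 1))) B'"
      unfolding frame_fin_def
    proof (intro conjI ballI allI impI)
      show "A / (16 * (a1 + 1)) > 0" using A a1 by simp
      show "B' > 0" by (rule B'(1))
      fix f :: "'d signal" assume f: "f \<in> L2b"
      show "energy g M f \<le> B' * nsq f" if "finite M" "M \<subseteq> T ` \<Lambda>" for M
        using that sepn[OF n] unfolding T_def by (intro B'(2) f) (auto intro: nsep_subset)
      obtain F c where F: "finite F" "F \<subseteq> \<Lambda>" "nsq (\<lambda>t. f t - synth g F c t) \<le> \<epsilon> * nsq f"
          "sqsum c F \<le> K * nsq f"
        using K(2)[OF f] by blast
      define h where "h = synth g F c"
      have h: "h \<in> L2b" unfolding h_def by (rule synth_L2b[OF g])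
      have "\<exists>G. finite G \<and> G \<subseteq> T ` \<Lambda> \<and> A * nsq (synth g F c)
       \<le> (16 * B * real m * real P / A) * energy g G (synth g F c)
         + ((4 * B / A) * (8 * real m * real P * s\<^sup>2 + real P * s\<^sup>2) + 4 * real P * s\<^sup>2) * sqsum c F"
      proof (rule deformed_lower_bound[OF fr sep sepn[OF n, folded T_def] mult[OF n, folded T_def] R(1) _ _ _ dense _ _ M2 _ less_imp_le[OF \<omega>] \<omega>2 F(1,2)])
        show "card (Y \<inter> cball z (2 * R)) \<le> P"
          if "\<And>y y'. y \<in> Y \<Longrightarrow> y' \<in> Y \<Longrightarrow> y \<noteq> y' \<Longrightarrow> dist y y' \<ge> R" for Y and z :: "'d phase_space"
          using P[OF R(1) that] by blast
        show "sum gram \<Gamma> \<le> s" if "finite \<Gamma>" "nsep N \<Gamma>" "\<And>z. z \<in> \<Gamma> \<Longrightarrow> norm z > R2 - \<rho> - 2 * R" for \<Gamma>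
          using that by (intro R3(2)) (auto simp: R2_def)
      qed (use R(2) s near in auto)
      then obtain G where G: "finite G" "G \<subseteq> T ` \<Lambda>" and low: "A * nsq h
         \<le> a1 * energy g G h + (\<kappa> * s\<^sup>2) * sqsum c F"
        unfolding a1_def \<kappa>_def h_def by (auto simp: algebra_simps)
      define S where "S = energy g G f"
      have S0: "S \<ge> 0" by (simp add: S_def sum_nonneg)
      have fh: "nsq (\<lambda>t. f t - h t) \<le> \<epsilon> * nsq f" using F(3) by (simp add: h_def)
      have SG: "energy g G h \<le> 2 * S + 2 * (B' * (\<epsilon> * nsq f))"
      proof -
        have "energy g G h \<le> (\<Sum>q\<in>G. 2 * (cmod (ip f (tf_shift q g)))\<^sup>2 + 2 * (cmod (ip (\<lambda>t. f t - h t) (tf_shift q g)))\<^sup>2)"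
        proof (rule sum_mono)
          fix q
          show "(cmod (ip h (tf_shift q g)))\<^sup>2 \<le> 2 * (cmod (ip f (tf_shift q g)))\<^sup>2 + 2 * (cmod (ip (\<lambda>t. f t - h t) (tf_shift q g)))\<^sup>2"
            using cmod_diff_square_le[of "ip h (tf_shift q g)" "ip f (tf_shift q g)"]
            by (simp add: ip_diff_left f h L2b_tf_shift g norm_minus_commute)
        qed
        also have "\<dots> = 2 * S + 2 * energy g G (\<lambda>t. f t - h t)"
          by (simp add: S_def sum.distrib sum_distrib_left)
        also have "energy g G (\<lambda>t. f t - h t) \<le> B' * nsq (\<lambda>t. f t - h t)"
          using G sepn[OF n] unfolding T_def by (intro B'(2) L2b_diff f h) (auto intro: nsep_subset)
        also have "\<dots> \<le> B' * (\<epsilon> * nsq f)" using fh B'(1) by (intro mult_left_mono) auto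
        finally show ?thesis by simp
      qed
      \<comment> \<open>Since \<open>2 * \<epsilon> \<le> 1/2\<close>, the error is absorbed and
        \<open>nsq f \<le> 4 * nsq h\<close> remains.\<close>
      have "nsq f = nsq (\<lambda>t. (f t - h t) + h t)" by simp
      also have "\<dots> \<le> 2 * nsq (\<lambda>t. f t - h t) + 2 * nsq h" by (intro nsq_add_le L2b_diff f h)
      also have "\<dots> \<le> 2 * (\<epsilon> * nsq f) + 2 * nsq h" using fh by simp
      also have "\<epsilon> * nsq f \<le> 1/4 * nsq f" using \<epsilon>_le by (intro mult_right_mono) auto
      finally have "nsq f \<le> 4 * nsq h" by simp
      then have "A * nsq f \<le> 4 * (A * nsq h)" using A by (simp add: mult.left_commute)
      also have "\<dots> \<le> 4 * (a1 * (2 * S + 2 * (B' * (\<epsilon> * nsq f))) + (\<kappa> * s\<^sup>2) * (K * nsq f))"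
        using low mult_left_mono[OF SG a1] mult_left_mono[OF F(4), of "\<kappa> * s\<^sup>2"] \<kappa> by simp
      also have "\<dots> = 8 * a1 * S + (8 * a1 * B' * \<epsilon>) * nsq f + (4 * (\<kappa> * s\<^sup>2) * K) * nsq f"
        by (simp add: algebra_simps)
      \<comment> \<open>The two errors together use half of \<open>A * nsq f\<close>; absorbing them
        doubles the factor \<open>8 * a1\<close>.\<close>
      also have "\<dots> \<le> 8 * a1 * S + A / 4 * nsq f + A / 4 * nsq f"
        by (intro add_mono mult_right_mono \<epsilon>2 s2 order_refl nsq_nonneg)
      finally have "A * nsq f \<le> 16 * a1 * S" by simp
      also have "\<dots> \<le> 16 * (a1 + 1) * S" using S0 by (intro mult_right_mono) auto
      finally have "A / (16 * (a1 + 1)) * nsq f \<le> S" using a1 by (simp add: pos_divide_le_eq mult.commute)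
      then show "\<exists>M. finite M \<and> M \<subseteq> T ` \<Lambda> \<and> A / (16 * (a1 + 1)) * nsq f \<le> energy g M f"
        using G unfolding S_def by blast
    qed
    then show ?case using images[of n] n n0(1) unfolding T_def by auto
  qed
qed

end

section \<open>Passage between Lebesgue classes and Borel functions, and the conclusion\<close>

lemma L2_borel_representative:
  fixes f :: "'d::finite signal"
  assumes f: "f \<in> L2"
  shows "\<exists>f'\<in>L2b. AE t in lebesgue. f t = f' t"
proof -
  have m: "f \<in> borel_measurable lebesgue" and i: "integrable lebesgue (\<lambda>t. (cmod (f t))\<^sup>2)"
    using f by (auto simp: L2_def)
  obtain a where a[measurable]: "a \<in> borel_measurable borel" "AE t in lborel. Re (f t) = a t"
    using completion_ex_borel_measurable_real[of "\<lambda>t. Re (f t)" lborel] m by auto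
  obtain b where b[measurable]: "b \<in> borel_measurable borel" "AE t in lborel. Im (f t) = b t"
    using completion_ex_borel_measurable_real[of "\<lambda>t. Im (f t)" lborel] m by auto
  define f' where "f' = (\<lambda>t. Complex (a t) (b t))"
  have [measurable]: "f' \<in> borel_measurable borel"
    unfolding f'_def Complex_eq by measurable
  have ae: "AE t in lebesgue. f t = f' t"
    unfolding AE_completion_iff using a(2) b(2) by eventually_elim (simp add: f'_def complex_eq_iff)
  have "integrable lebesgue (\<lambda>t. (cmod (f' t))\<^sup>2)"
    by (rule integrable_cong_AE_imp[OF i]) (use ae in \<open>auto intro: measurable_completion\<close>)
  then have "f' \<in> L2b" unfolding L2b_def by (simp add: integrable_completion)
  then show ?thesis using ae by blast
qed

lemma L2b_subset_L2: "f \<in> L2b \<Longrightarrow> f \<in> L2"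
  unfolding L2b_def L2_def by (auto simp: integrable_completion intro: measurable_completion)

lemma inner_L2_eq_ip:
  assumes "AE t in lebesgue. f t = f' t" "AE t in lebesgue. h t = h' t" "f' \<in> L2b" "h' \<in> L2b"
  shows "inner_L2 f h = ip f' h'"
proof -
  have [measurable]: "f' \<in> borel_measurable borel" "h' \<in> borel_measurable borel"
    using assms by (auto intro: L2b_measurable)
  have ae: "AE t in lebesgue. f t * cnj (h t) = f' t * cnj (h' t)"
    using assms(1,2) by eventually_elim simp
  have m: "(\<lambda>t. f' t * cnj (h' t)) \<in> borel_measurable lebesgue" by (rule measurable_completion) measurable
  have "AE t in lebesgue. f' t * cnj (h' t) = f t * cnj (h t)" using ae by eventually_elim simp
  \<comment> \<open>Lebesgue measure is complete, so measurability passes to almost everywhere equal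
    functions.\<close>
  then have "(\<lambda>t. f t * cnj (h t)) \<in> borel_measurable lebesgue" by (rule borel_measurable_AE[OF m])
  then have "inner_L2 f h = (LINT t|lebesgue. f' t * cnj (h' t))"
    unfolding inner_L2_def using m ae by (intro integral_cong_AE)
  also have "\<dots> = ip f' h'" unfolding ip_def by (rule integral_completion) measurable
  finally show ?thesis .
qed

lemma norm_L2_sq_eq_nsq:
  assumes "AE t in lebesgue. f t = f' t" "f' \<in> L2b"
  shows "(norm_L2 f)\<^sup>2 = nsq f'"
proof -
  have [measurable]: "f' \<in> borel_measurable borel" using assms by (auto intro: L2b_measurable)
  have m: "(\<lambda>t. (cmod (f' t))\<^sup>2) \<in> borel_measurable lebesgue" by (rule measurable_completion) measurable
  have "AE t in lebesgue. (cmod (f' t))\<^sup>2 = (cmod (f t))\<^sup>2" using assms(1) by eventually_elim simp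
  then have "(\<lambda>t. (cmod (f t))\<^sup>2) \<in> borel_measurable lebesgue" by (rule borel_measurable_AE[OF m])
  moreover have "AE t in lebesgue. (cmod (f t))\<^sup>2 = (cmod (f' t))\<^sup>2" using assms(1) by eventually_elim simp
  ultimately have "(LINT t|lebesgue. (cmod (f t))\<^sup>2) = (LINT t|lebesgue. (cmod (f' t))\<^sup>2)"
    using m by (intro integral_cong_AE)
  also have "\<dots> = nsq f'" unfolding nsq_def by (rule integral_completion) measurable
  finally show ?thesis unfolding norm_L2_def by simp
qed

lemma AE_tf_shift:
  assumes "AE t in lebesgue. h t = h' t"
  shows "AE t in lebesgue. tf_shift z h t = tf_shift z h' t"
proof -
  have "AE t in lborel. h t = h' t" using assms by (simp add: AE_completion_iff)
  then have "AE t in distr lborel borel ((+) (- fst z)). h t = h' t" unfolding lborel_distr_plus .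
  then have "AE t in lborel. h (- fst z + t) = h' (- fst z + t)" by (rule AE_distrD[rotated]) simp
  then show ?thesis unfolding AE_completion_iff by eventually_elim (simp add: tf_shift_def)
qed

text \<open>If every finite partial sum stayed below half of the lower bound, so would the infinite
  sum; hence the constant \<open>A / 2\<close> is reached on a finite set. Conversely, bounded
  finite sums of nonnegative terms give summability, and the infinite sum dominates each finite
  one.\<close>

lemma gabor_frame_iff_frame_fin:
  assumes g: "AE t in lebesgue. g t = g' t" "g' \<in> L2b"
  shows "gabor_frame g \<Lambda> \<longleftrightarrow> (\<exists>A B. A \<le> B \<and> frame_fin g' \<Lambda> A B)"
proof
  have eq: "inner_L2 f (tf_shift p g) = ip f' (tf_shift p g')"
    if "AE t in lebesgue. f t = f' t" "f' \<in> L2b" for f f' p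
    by (intro inner_L2_eq_ip that AE_tf_shift g L2b_tf_shift)
  {
    assume "gabor_frame g \<Lambda>"
    then obtain A B where AB: "0 < A" "A \<le> B" and fr: "\<And>f. f \<in> L2 \<Longrightarrow>
        (\<lambda>p. (norm (inner_L2 f (tf_shift p g)))\<^sup>2) summable_on \<Lambda> \<and>
           A * (norm_L2 f)\<^sup>2 \<le> (\<Sum>\<^sub>\<infinity>p\<in>\<Lambda>. (norm (inner_L2 f (tf_shift p g)))\<^sup>2) \<and>
           (\<Sum>\<^sub>\<infinity>p\<in>\<Lambda>. (norm (inner_L2 f (tf_shift p g)))\<^sup>2) \<le> B * (norm_L2 f)\<^sup>2"
      unfolding gabor_frame_def by blast
    have fr': "(\<lambda>p. (cmod (ip f (tf_shift p g')))\<^sup>2) summable_on \<Lambda>"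
        "A * nsq f \<le> (\<Sum>\<^sub>\<infinity>p\<in>\<Lambda>. (cmod (ip f (tf_shift p g')))\<^sup>2)"
        "(\<Sum>\<^sub>\<infinity>p\<in>\<Lambda>. (cmod (ip f (tf_shift p g')))\<^sup>2) \<le> B * nsq f" if "f \<in> L2b" for f
      using fr[OF L2b_subset_L2[OF that]] eq[of f f] norm_L2_sq_eq_nsq[of f f] that by auto
    have half: "frame_fin g' \<Lambda> (A / 2) B"
      unfolding frame_fin_def
    proof (intro conjI ballI allI impI)
      fix f :: "'a signal" assume f: "f \<in> L2b"
      show "energy g' M f \<le> B * nsq f" if "finite M" "M \<subseteq> \<Lambda>" for M
        using finite_sum_le_infsum[OF fr'(1)[OF f] that] fr'(3)[OF f] by simp
      show "\<exists>M. finite M \<and> M \<subseteq> \<Lambda> \<and> A / 2 * nsq f \<le> energy g' M f"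
      proof (rule ccontr)
        assume "\<not> ?thesis"
        then have lt: "energy g' M f \<le> A / 2 * nsq f" "energy g' M f < A / 2 * nsq f"
          if "finite M" "M \<subseteq> \<Lambda>" for M using that by (auto simp: not_le less_imp_le)
        have "(\<Sum>\<^sub>\<infinity>p\<in>\<Lambda>. (cmod (ip f (tf_shift p g')))\<^sup>2) \<le> A / 2 * nsq f"
          by (rule infsum_le_finite_sums[OF fr'(1)[OF f] lt(1)])
        then have "A * nsq f \<le> A / 2 * nsq f" using fr'(2)[OF f] by simp
        \<comment> \<open>The empty set has energy 0, so its strict inequality says that
          \<open>f\<close> is nonzero.\<close>
        moreover have "0 < A / 2 * nsq f" using lt(2)[of "{}"] by simp
        ultimately show False by simp
      qed
    qed (use AB in auto)
    show "\<exists>A B. A \<le> B \<and> frame_fin g' \<Lambda> A B" 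
    proof (rule exI[of _ "A / 2"], rule exI[of _ B], intro conjI)
      show "A / 2 \<le> B" using AB by simp
    qed (rule half)
  next
    assume "\<exists>A B. A \<le> B \<and> frame_fin g' \<Lambda> A B"
    then obtain A B where AB: "A \<le> B" and fr: "frame_fin g' \<Lambda> A B" by blast
    show "gabor_frame g \<Lambda>"
      unfolding gabor_frame_def
    proof (rule exI[of _ A], rule exI[of _ B], intro conjI ballI AB)
      show "0 < A" using fr by (simp add: frame_fin_def)
      fix f :: "'a signal" assume "f \<in> L2"
      then obtain f' where f': "f' \<in> L2b" "AE t in lebesgue. f t = f' t" using L2_borel_representative by blast
      have up: "energy g' M f' \<le> B * nsq f'" if "finite M" "M \<subseteq> \<Lambda>" for M
        using fr f'(1) that unfolding frame_fin_def by blast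
      have s: "(\<lambda>p. (cmod (ip f' (tf_shift p g')))\<^sup>2) summable_on \<Lambda>"
        using up by (intro nonneg_bdd_above_summable_on) (auto intro!: bdd_aboveI2)
      obtain M where M: "finite M" "M \<subseteq> \<Lambda>" "A * nsq f' \<le> energy g' M f'"
        using fr f'(1) unfolding frame_fin_def by blast
      show "(\<lambda>p. (norm (inner_L2 f (tf_shift p g)))\<^sup>2) summable_on \<Lambda>"
        using s by (simp add: eq[OF f'(2,1)])
      show "A * (norm_L2 f)\<^sup>2 \<le> (\<Sum>\<^sub>\<infinity>p\<in>\<Lambda>. (norm (inner_L2 f (tf_shift p g)))\<^sup>2)"
        unfolding eq[OF f'(2,1)] norm_L2_sq_eq_nsq[OF f'(2,1)]
        using M finite_sum_le_infsum[OF s M(1,2)] by simp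
      show "(\<Sum>\<^sub>\<infinity>p\<in>\<Lambda>. (norm (inner_L2 f (tf_shift p g)))\<^sup>2) \<le> B * (norm_L2 f)\<^sup>2"
        unfolding eq[OF f'(2,1)] norm_L2_sq_eq_nsq[OF f'(2,1)]
        by (rule infsum_le_finite_sums[OF s up])
    qed
  }
qed

lemma frame_fin_mono:
  assumes fr: "frame_fin g \<Lambda> A B" and le: "B \<le> B'"
  shows "frame_fin g \<Lambda> A B'"
proof -
  have "B * nsq f \<le> B' * nsq f" for f :: "'a signal" using le by (rule mult_right_mono) simp
  then show ?thesis using fr le unfolding frame_fin_def by (auto intro: order_trans)
qed

theorem theorem7p1:
  fixes g :: "real ^ 'd::finite \<Rightarrow> complex"
    and \<Lambda> :: "((real ^ 'd) \<times> (real ^ 'd)) set"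
    and \<Lambda>s :: "nat \<Rightarrow> ((real ^ 'd) \<times> (real ^ 'd)) set"
    and \<tau> :: "nat \<Rightarrow> (real ^ 'd) \<times> (real ^ 'd) \<Rightarrow> (real ^ 'd) \<times> (real ^ 'd)"
  assumes "g \<in> M1"
    and "gabor_frame g \<Lambda>"
    and "lipschitz_deformation \<Lambda> \<Lambda>s \<tau>"
  shows "\<forall>\<^sub>F n in sequentially. gabor_frame g (\<Lambda>s n)"
proof -
  have "g \<in> L2" and fin: "(\<integral>\<^sup>+ z. ennreal (norm (inner_L2 g (tf_shift z g))) \<partial>lebesgue) < \<infinity>"
    using assms(1) by (auto simp: M1_def)
  obtain g' where g': "g' \<in> L2b" "AE t in lebesgue. g t = g' t"
    using L2_borel_representative[OF \<open>g \<in> L2\<close>] by blast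
  obtain A B where AB: "A \<le> B" and fr: "frame_fin g' \<Lambda> A B"
    using assms(2) gabor_frame_iff_frame_fin[OF g'(2,1)] by blast
  have "inner_L2 g (tf_shift z g) = ip g' (tf_shift z g')" for z
    by (intro inner_L2_eq_ip g' AE_tf_shift L2b_tf_shift)
  then have "(\<integral>\<^sup>+ z. ennreal (cmod (ip g' (tf_shift z g'))) \<partial>lborel) < \<infinity>"
    using fin by (simp add: nn_integral_completion)
  then have "wiener (\<lambda>z. cmod (ip g' (tf_shift z g')))"
    by (rule wiener_stft[OF g'(1) frame_fin_window_nonzero[OF g'(1) fr]])
  then interpret wiener_window g' using g'(1) by unfold_locales
  show ?thesis
    using frame_fin_deformation[OF fr AB assms(3)]
  proof eventually_elim
    case (elim n)
    then obtain A' B' where "frame_fin g' (\<Lambda>s n) A' B'" by blast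
    \<comment> \<open>\<open>gabor_frame\<close> asks for ordered bounds; enlarging the upper one is
      harmless.\<close>
    then have "frame_fin g' (\<Lambda>s n) A' (max A' B')" by (rule frame_fin_mono) simp
    then show ?case using gabor_frame_iff_frame_fin[OF g'(2,1)] max.cobounded1 by blast
  qed
qed

end
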